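(* For every real $p$ with $2<p<\infty$ there is a constant $N(p)>0$ such that for all integers $n\ge N(p)$, $$A_{n,p}\left(a^{(n)}\right) > A_{n,p}\left(a^{(2)}\right).$$ In fact, this holds with $N(p)=\frac52 p$ if $p\ge 9$ and with $N(p)=p$ if $p\ge 140$. Moreover, for all $2<p<\infty$, $$\lim_{n\to\infty} A_{n,p}\left(a^{(n)}\right) = 2\,\frac{\Gamma\left(1+\frac2p\right)^2}{\Gamma\left(1+\frac4p\right)} > A_{n,p}\left(a^{(2)}\right) = 2^{1-\frac2p}$$ (in the last two relations, $A_{n,p}(a^{(2)})$ is taken for any $n\ge2$).
   Context: For $1\le p<\infty$ and $n\in\mathbb{N}$, $B_p^n(\mathbb{C})=\{z\in\mathbb{C}^n:\sum_{j=1}^n|z_j|^p\le 1\}$ is the closed unit ball of the complex space $\ell_p^n(\mathbb{C})$. For volume considerations $\mathbb{C}^n$ is identified with $\mathbb{R}^{2n}$, and $\mathrm{vol}_{2(n-1)}$ denotes $2(n-1)$-dimensional Lebesgue volume (on real subspaces of dimension $2(n-1)$). $|\cdot|$ is the Euclidean norm. For $a\in\mathbb{C}^n$ with $|a|=1$, $a^\perp$ is the complex hyperplane $\{z\in\mathbb{C}^n:\langle z,a\rangle_{\mathbb{C}}=0\}$, where $\langle\cdot,\cdot\rangle_{\mathbb C}$ is the standard complex scalar product, and $$A_{n,p}(a):=\frac{\mathrm{vol}_{2(n-1)}\left(a^\perp\cap B_p^n(\mathbb{C})\right)}{\mathrm{vol}_{2(n-1)}\left(B_p^{n-1}(\mathbb{C})\right)}.$$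 Also $a^{(n)}:=\frac1{\sqrt n}(1,\ldots,1)\in\mathbb{C}^n$ and $a^{(2)}:=\frac1{\sqrt2}(1,1,0,\ldots,0)\in\mathbb{C}^n$ (for $n\ge2$). $\Gamma$ is the Gamma function. *)

theory Defs
  imports "HOL-Analysis.Analysis"
begin

text \<open>
  The dimension \<open>n\<close> varies inside the statement, so vectors of \<open>\<complex>\<^sup>n\<close> are functions on
  \<open>{..<n}\<close>, extended by \<open>undefined\<close> as in the space of a product measure.
\<close>

definition cspace :: "nat \<Rightarrow> (nat \<Rightarrow> complex) set" where
  "cspace n = {..<n} \<rightarrow>\<^sub>E UNIV"

definition cinner :: "nat \<Rightarrow> (nat \<Rightarrow> complex) \<Rightarrow> (nat \<Rightarrow> complex) \<Rightarrow> complex" where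
  "cinner n z w = (\<Sum>j<n. z j * cnj (w j))"

text \<open>Scalar product of \<open>\<complex>\<^sup>n\<close> regarded as \<open>\<real>\<^sup>2\<^sup>n\<close>; on the right, \<open>\<bullet>\<close> is that of \<open>\<complex> = \<real>\<^sup>2\<close>.\<close>

definition rinner :: "nat \<Rightarrow> (nat \<Rightarrow> complex) \<Rightarrow> (nat \<Rightarrow> complex) \<Rightarrow> real" where
  "rinner n z w = (\<Sum>j<n. z j \<bullet> w j)"

definition lp_ball :: "nat \<Rightarrow> real \<Rightarrow> (nat \<Rightarrow> complex) set" where
  "lp_ball n p = {z \<in> cspace n. (\<Sum>j<n. cmod (z j) powr p) \<le> 1}"

definition chyperplane :: "nat \<Rightarrow> (nat \<Rightarrow> complex) \<Rightarrow> (nat \<Rightarrow> complex) set" where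
  "chyperplane n a = {z \<in> cspace n. cinner n z a = 0}"

definition real_lincomb ::
  "nat \<Rightarrow> nat \<Rightarrow> (nat \<Rightarrow> nat \<Rightarrow> complex) \<Rightarrow> (nat \<Rightarrow> real) \<Rightarrow> (nat \<Rightarrow> complex)" where
  "real_lincomb n k b x = (\<lambda>j\<in>{..<n}. \<Sum>i<k. x i *\<^sub>R b i j)"

text \<open>\<open>b 0, \<dots>, b (k - 1)\<close> is an orthonormal basis of the \<open>k\<close>-dimensional real subspace \<open>H\<close> of \<open>\<complex>\<^sup>n\<close>.\<close>

definition real_onb ::
  "nat \<Rightarrow> nat \<Rightarrow> (nat \<Rightarrow> complex) set \<Rightarrow> (nat \<Rightarrow> nat \<Rightarrow> complex) \<Rightarrow> bool" where
  "real_onb n k H b \<longleftrightarrow>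
     (\<forall>i<k. b i \<in> cspace n) \<and>
     (\<forall>i<k. \<forall>j<k. rinner n (b i) (b j) = (if i = j then 1 else 0)) \<and>
     H = range (real_lincomb n k b)"

text \<open>
  \<open>k\<close>-dimensional Lebesgue volume on a real subspace \<open>H\<close> of \<open>\<complex>\<^sup>n\<close> of real dimension \<open>k\<close>: the
  Lebesgue measure on \<open>\<real>\<^sup>k\<close> of the set of coordinate vectors with respect to an orthonormal
  basis of \<open>H\<close>. By rotation invariance the value does not depend on the basis chosen.
  Only meaningful if \<open>H\<close> has real dimension \<open>k\<close>, \<open>S \<subseteq> H\<close> is Borel, and \<open>S\<close> has finite volume.
\<close>

definition subspace_vol ::
  "nat \<Rightarrow> nat \<Rightarrow> (nat \<Rightarrow> complex) set \<Rightarrow> (nat \<Rightarrow> complex) set \<Rightarrow> real" where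
  "subspace_vol n k H S =
     (let b = (SOME b. real_onb n k H b)
      in measure (Pi\<^sub>M {..<k} (\<lambda>_. lborel :: real measure))
           {x \<in> {..<k} \<rightarrow>\<^sub>E UNIV. real_lincomb n k b x \<in> S})"

text \<open>
  \<open>vol\<^bsub>2m\<^esub>\<close> on \<open>\<complex>\<^sup>m\<close>; \<open>lborel\<close> on the type \<open>complex\<close> is the two-dimensional Lebesgue measure
  (with respect to the basis \<open>1, \<i>\<close>).
\<close>

definition cspace_vol :: "nat \<Rightarrow> (nat \<Rightarrow> complex) set \<Rightarrow> real" where
  "cspace_vol m S = measure (Pi\<^sub>M {..<m} (\<lambda>_. lborel :: complex measure)) S"

definition section_ratio :: "nat \<Rightarrow> real \<Rightarrow> (nat \<Rightarrow> complex) \<Rightarrow> real" where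
  "section_ratio n p a =
     subspace_vol n (2 * (n - 1)) (chyperplane n a) (chyperplane n a \<inter> lp_ball n p)
       / cspace_vol (n - 1) (lp_ball (n - 1) p)"

definition diag_dir :: "nat \<Rightarrow> (nat \<Rightarrow> complex)" where
  "diag_dir n = (\<lambda>j\<in>{..<n}. complex_of_real (1 / sqrt (real n)))"

text \<open>Intended for \<open>n \<ge> 2\<close>.\<close>

definition two_dir :: "nat \<Rightarrow> (nat \<Rightarrow> complex)" where
  "two_dir n = (\<lambda>j\<in>{..<n}. if j < 2 then complex_of_real (1 / sqrt 2) else 0)"

end

theory Submission
  imports Defs "HOL-Probability.Characteristic_Functions"
begin

text \<open>
  Let \<open>Z\<close> have density proportional to \<open>exp (- \<bar>z\<bar>\<^sup>p)\<close> on \<open>\<complex>\<close>, with characteristic function \<open>\<phi>\<close> and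
  second moment \<open>m\<close>, and let \<open>K\<close> be the normalising constant. By homogeneity, \<open>A\<^bsub>n,p\<^esub>(a)\<close> is \<open>K\<close> times
  the density at the origin of \<open>\<Sum>\<^sub>j a\<^sub>j Z\<^sub>j\<close>, which Fourier inversion, regularised by a Gaussian weight,
  turns into an integral of \<open>\<Prod>\<^sub>j \<phi> (a\<^sub>j \<xi>)\<close>. For \<open>a\<^sup>(\<^sup>2\<^sup>)\<close> this integral is computed by Plancherel.

  For the diagonal direction, the elementary bound \<open>\<phi> \<xi> \<ge> 1 - m \<bar>\<xi>\<bar>\<^sup>2 / 4\<close> on the disc where the right side is
  positive already contributes exactly \<open>n / (n + 1)\<close> times the Gaussian limit. Outside of that disc
  \<open>\<phi> \<ge> - 1 / 2\<close>, because the density is a mixture of uniform densities on discs, and Plancherel bounds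
  the loss by \<open>n 2\<^sup>2\<^sup>-\<^sup>n\<close>. The same splitting with a Gaussian majorant near the origin and \<open>\<bar>\<phi>\<bar> \<le> q < 1\<close>
  elsewhere gives the upper bound needed for the limit.

  With \<open>x = 2 / p\<close>, the limit exceeds \<open>2 powr (1 - x)\<close> since, by the duplication formula,
  the difference of the logarithms is strictly concave in \<open>x\<close> and vanishes at \<open>0\<close> and \<open>1\<close>;
  the explicit ranges of \<open>n\<close> follow from \<open>\<Gamma>(1 + x)\<^sup>2 / \<Gamma>(1 + 2 x) \<ge> exp (- 33 x\<^sup>2 / 20)\<close>.
\<close>

text \<open>Integrability of powers of the characteristic function is never established directly.
  Every Fourier integral carries the weight \<open>gauss_weight \<delta>\<close>, which makes each
  exchange of integrations absolutely convergent, and \<delta> tends to 0 only in the final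
  comparison. What survives the limit is a bound, uniform in \<delta>, on the weighted integral of
  the square; this is why every estimate of an n-th power keeps two factors aside and bounds only
  the other n - 2.

  \<open>subspace_vol\<close> takes an arbitrary orthonormal basis, and vectors are functions on an
  index set. Orthogonal changes of variables are therefore derived from the uniqueness of
  translation-invariant measures, the test function being a Gaussian because orthogonal maps
  preserve it.

  The explicit ranges are a first-order comparison in x = 2 / p: up to an exponentially small term,
  log(1 + 1 / n) < x log 2 - 33 x^2 / 20 is wanted. Here n = 5 p / 2 means 1 / n = x / 5, n = p
  means 1 / n = x / 2, and both 1 / 5 and 1 / 2 are below log 2.\<close>

subsection \<open>Translation-invariant measures\<close>

text \<open>
  Evaluating \<open>\<integral>\<integral> f (x + y) g y\<close> in both orders of integration shows that \<open>M\<close> and \<open>N\<close> are proportional;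
  the test function \<open>g\<close> (in the applications a Gaussian) normalises the factor.
\<close>

lemma nn_integral_unique_of_translation_invariant:
  fixes M N :: "'a measure" and add sub :: "'a \<Rightarrow> 'a \<Rightarrow> 'a" and f g :: "'a \<Rightarrow> ennreal"
  assumes sf: "sigma_finite_measure M" "sigma_finite_measure N"
    and sets_eq[measurable_cong]: "sets N = sets M"
    and add[measurable]: "(\<lambda>(x, y). add x y) \<in> M \<Otimes>\<^sub>M M \<rightarrow>\<^sub>M M"
    and sub[measurable]: "(\<lambda>(x, y). sub x y) \<in> M \<Otimes>\<^sub>M M \<rightarrow>\<^sub>M M"
    and M_inv: "\<And>y h. y \<in> space M \<Longrightarrow> h \<in> borel_measurable M \<Longrightarrow>
                  (\<integral>\<^sup>+ x. h (add x y) \<partial>M) = (\<integral>\<^sup>+ x. h x \<partial>M)"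
    and N_inv: "\<And>y h. y \<in> space M \<Longrightarrow> h \<in> borel_measurable M \<Longrightarrow>
                  (\<integral>\<^sup>+ x. h (sub x y) \<partial>N) = (\<integral>\<^sup>+ x. h x \<partial>N)"
    and add_sub: "\<And>x y. x \<in> space M \<Longrightarrow> y \<in> space M \<Longrightarrow> add x (sub y x) = y"
    and symm: "\<And>x y. x \<in> space M \<Longrightarrow> y \<in> space M \<Longrightarrow> g (sub y (add x y)) = g x"
    and f[measurable]: "f \<in> borel_measurable M" and g[measurable]: "g \<in> borel_measurable M"
    and g_eq: "(\<integral>\<^sup>+ x. g x \<partial>N) = (\<integral>\<^sup>+ x. g x \<partial>M)"
    and g_fin: "(\<integral>\<^sup>+ x. g x \<partial>M) \<noteq> 0" "(\<integral>\<^sup>+ x. g x \<partial>M) \<noteq> \<infinity>"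
  shows "(\<integral>\<^sup>+ x. f x \<partial>M) = (\<integral>\<^sup>+ x. f x \<partial>N)"
proof -
  interpret M: sigma_finite_measure M by fact
  interpret N: sigma_finite_measure N by fact
  interpret MN: pair_sigma_finite M N ..
  have sp: "space N = space M" by (rule sets_eq_imp_space_eq[OF sets_eq])
  have add1[measurable]: "(\<lambda>x. add x y) \<in> M \<rightarrow>\<^sub>M M" if "y \<in> space M" for y
    using measurable_compose[OF measurable_Pair2'[OF that, of M] add] by simp
  have sub1[measurable]: "(\<lambda>x. sub x y) \<in> M \<rightarrow>\<^sub>M M" if "y \<in> space M" for y
    using measurable_compose[OF measurable_Pair2'[OF that, of M] sub] by simp
  have sub2[measurable]: "(\<lambda>y. sub x y) \<in> M \<rightarrow>\<^sub>M M" if "x \<in> space M" for x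
    using measurable_compose[OF measurable_Pair1'[OF that, of M] sub] by simp
  have "(\<integral>\<^sup>+ x. f x \<partial>M) * (\<integral>\<^sup>+ x. g x \<partial>N) = (\<integral>\<^sup>+ y. (\<integral>\<^sup>+ x. f x \<partial>M) * g y \<partial>N)"
    by (simp add: nn_integral_cmult)
  also have "\<dots> = (\<integral>\<^sup>+ y. (\<integral>\<^sup>+ x. f (add x y) \<partial>M) * g y \<partial>N)"
    by (intro nn_integral_cong) (simp add: M_inv sp)
  also have "\<dots> = (\<integral>\<^sup>+ y. (\<integral>\<^sup>+ x. f (add x y) * g y \<partial>M) \<partial>N)"
    by (intro nn_integral_cong) (simp add: nn_integral_multc sp)
  also have "\<dots> = (\<integral>\<^sup>+ x. (\<integral>\<^sup>+ y. f (add x y) * g y \<partial>N) \<partial>M)"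
    by (intro MN.Fubini') measurable
  also have "\<dots> = (\<integral>\<^sup>+ x. (\<integral>\<^sup>+ y. f (add x (sub y x)) * g (sub y x) \<partial>N) \<partial>M)"
  proof (rule nn_integral_cong)
    fix x assume x: "x \<in> space M"
    have "(\<lambda>y. add x y) \<in> M \<rightarrow>\<^sub>M M"
      using measurable_compose[OF measurable_Pair1'[OF x, of M] add] by simp
    then show "(\<integral>\<^sup>+ y. f (add x y) * g y \<partial>N) = (\<integral>\<^sup>+ y. f (add x (sub y x)) * g (sub y x) \<partial>N)"
      using N_inv[OF x, of "\<lambda>y. f (add x y) * g y"] by simp
  qed
  also have "\<dots> = (\<integral>\<^sup>+ x. (\<integral>\<^sup>+ y. f y * g (sub y x) \<partial>N) \<partial>M)"
    by (intro nn_integral_cong) (simp add: add_sub sp)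
  also have "\<dots> = (\<integral>\<^sup>+ y. (\<integral>\<^sup>+ x. f y * g (sub y x) \<partial>M) \<partial>N)"
    by (intro MN.Fubini'[symmetric]) measurable
  also have "\<dots> = (\<integral>\<^sup>+ y. f y * (\<integral>\<^sup>+ x. g x \<partial>M) \<partial>N)"
  proof (intro nn_integral_cong)
    fix y assume "y \<in> space N"
    then have y: "y \<in> space M" by (simp add: sp)
    note [measurable] = sub2[OF y]
    have "(\<integral>\<^sup>+ x. g (sub y x) \<partial>M) = (\<integral>\<^sup>+ x. g (sub y (add x y)) \<partial>M)"
      by (rule M_inv[OF y, symmetric]) simp
    also have "\<dots> = (\<integral>\<^sup>+ x. g x \<partial>M)" by (intro nn_integral_cong) (simp add: symm y)
    finally show "(\<integral>\<^sup>+ x. f y * g (sub y x) \<partial>M) = f y * (\<integral>\<^sup>+ x. g x \<partial>M)"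
      by (simp add: nn_integral_cmult)
  qed
  also have "\<dots> = (\<integral>\<^sup>+ x. f x \<partial>N) * (\<integral>\<^sup>+ x. g x \<partial>M)"
    by (simp add: nn_integral_multc)
  finally have "(\<integral>\<^sup>+ x. g x \<partial>M) * (\<integral>\<^sup>+ x. f x \<partial>M) = (\<integral>\<^sup>+ x. g x \<partial>M) * (\<integral>\<^sup>+ x. f x \<partial>N)"
    by (simp add: g_eq mult.commute)
  then show ?thesis using g_fin by (simp add: ennreal_mult_cancel_left)
qed

text \<open>The maps \<open>T i\<close> may vary with the coordinate, as translations require, while
  the factor \<open>c\<close> is common: 1 for a translation, a power of the ratio for a
  dilation.\<close>

lemma nn_integral_PiM_map:
  fixes M :: "'a measure" and c :: ennreal
  assumes sf: "sigma_finite_measure M" and fin: "finite I"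
    and T[measurable]: "\<And>i. T i \<in> M \<rightarrow>\<^sub>M M"
    and map: "\<And>i h. h \<in> borel_measurable M \<Longrightarrow> (\<integral>\<^sup>+ x. h (T i x) \<partial>M) = c * (\<integral>\<^sup>+ x. h x \<partial>M)"
    and f: "f \<in> borel_measurable (Pi\<^sub>M I (\<lambda>_. M))"
  shows "(\<integral>\<^sup>+ x. f (\<lambda>i\<in>I. T i (x i)) \<partial>Pi\<^sub>M I (\<lambda>_. M)) = c ^ card I * (\<integral>\<^sup>+ x. f x \<partial>Pi\<^sub>M I (\<lambda>_. M))"
  using fin f
proof (induction I arbitrary: f rule: finite_induct)
  case empty
  interpret product_sigma_finite "\<lambda>_::'b. M" using sf by (simp add: product_sigma_finite_def)
  show ?case by (simp add: nn_integral_empty restrict_def space_PiM)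
next
  case (insert i I)
  interpret product_sigma_finite "\<lambda>_::'b. M" using sf by (simp add: product_sigma_finite_def)
  note [measurable] = insert.prems
  have "(\<integral>\<^sup>+ x. f (\<lambda>j\<in>insert i I. T j (x j)) \<partial>Pi\<^sub>M (insert i I) (\<lambda>_. M))
      = (\<integral>\<^sup>+ x. (\<integral>\<^sup>+ y. f (\<lambda>j\<in>insert i I. T j ((x(i := y)) j)) \<partial>M) \<partial>Pi\<^sub>M I (\<lambda>_. M))"
    using insert by (intro product_nn_integral_insert) measurable
  also have "\<dots> = (\<integral>\<^sup>+ x. (\<integral>\<^sup>+ y. f ((\<lambda>j\<in>I. T j (x j))(i := T i y)) \<partial>M) \<partial>Pi\<^sub>M I (\<lambda>_. M))"
    using insert(2)
    by (intro nn_integral_cong arg_cong[where f=f]) (auto simp: fun_eq_iff restrict_def)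
  also have "\<dots> = (\<integral>\<^sup>+ x. c * (\<integral>\<^sup>+ y. f ((\<lambda>j\<in>I. T j (x j))(i := y)) \<partial>M) \<partial>Pi\<^sub>M I (\<lambda>_. M))"
  proof (intro nn_integral_cong)
    fix x assume x: "x \<in> space (Pi\<^sub>M I (\<lambda>_. M))"
    then have "(\<lambda>j\<in>I. T j (x j)) \<in> space (Pi\<^sub>M I (\<lambda>_. M))"
      using measurable_space[OF T] by (auto simp: space_PiM PiE_iff)
    then have "(\<lambda>y. (\<lambda>j\<in>I. T j (x j))(i := y)) \<in> M \<rightarrow>\<^sub>M Pi\<^sub>M (insert i I) (\<lambda>_. M)"
      by (rule measurable_component_update[OF _ insert(2)])
    then have "(\<lambda>y. f ((\<lambda>j\<in>I. T j (x j))(i := y))) \<in> borel_measurable M"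
      by measurable
    from map[OF this] show "(\<integral>\<^sup>+ y. f ((\<lambda>j\<in>I. T j (x j))(i := T i y)) \<partial>M)
        = c * (\<integral>\<^sup>+ y. f ((\<lambda>j\<in>I. T j (x j))(i := y)) \<partial>M)" .
  qed
  also have "\<dots> = c * (\<integral>\<^sup>+ x. (\<integral>\<^sup>+ y. f ((\<lambda>j\<in>I. T j (x j))(i := y)) \<partial>M) \<partial>Pi\<^sub>M I (\<lambda>_. M))"
    by (intro nn_integral_cmult) measurable
  also have "\<dots> = c * (c ^ card I * (\<integral>\<^sup>+ x. (\<integral>\<^sup>+ y. f (x(i := y)) \<partial>M) \<partial>Pi\<^sub>M I (\<lambda>_. M)))"
    by (subst insert.IH[of "\<lambda>x. (\<integral>\<^sup>+ y. f (x(i := y)) \<partial>M)"]) auto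
  also have "(\<integral>\<^sup>+ x. (\<integral>\<^sup>+ y. f (x(i := y)) \<partial>M) \<partial>Pi\<^sub>M I (\<lambda>_. M)) = (\<integral>\<^sup>+ x. f x \<partial>Pi\<^sub>M (insert i I) (\<lambda>_. M))"
    using insert by (intro product_nn_integral_insert[symmetric]) auto
  finally show ?case using insert(1,2) by (simp add: mult.assoc)
qed

lemma nn_integral_lborel_affine:
  fixes t :: "'a :: euclidean_space"
  assumes [measurable]: "f \<in> borel_measurable borel" and c: "c \<noteq> 0"
  shows "(\<integral>\<^sup>+ x. f (t + c *\<^sub>R x) \<partial>lborel) = ennreal (1 / \<bar>c\<bar> ^ DIM('a)) * (\<integral>\<^sup>+ x. f x \<partial>lborel)"
proof -
  have "(\<integral>\<^sup>+ x. f x \<partial>lborel) = ennreal (\<bar>c\<bar> ^ DIM('a)) * (\<integral>\<^sup>+ x. f (t + c *\<^sub>R x) \<partial>lborel)"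
    by (subst lborel_affine[OF c, of t])
      (simp add: nn_integral_density nn_integral_distr nn_integral_cmult)
  then show ?thesis
    using c by (simp add: mult.assoc[symmetric] ennreal_mult[symmetric])
qed

lemma integral_lborel_affine:
  fixes f :: "'a :: euclidean_space \<Rightarrow> 'b :: {banach, second_countable_topology}"
  assumes [measurable]: "f \<in> borel_measurable borel" and c: "c \<noteq> 0"
  shows "(\<integral>x. f (t + c *\<^sub>R x) \<partial>lborel) = (\<integral>x. f x \<partial>lborel) /\<^sub>R \<bar>c\<bar> ^ DIM('a)"
proof -
  have "(\<integral>x. f x \<partial>lborel) = \<bar>c\<bar> ^ DIM('a) *\<^sub>R (\<integral>x. f (t + c *\<^sub>R x) \<partial>lborel)"
    by (subst lborel_affine[OF c, of t]) (simp add: integral_density integral_distr)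
  then show ?thesis using c by simp
qed

lemma nn_integral_PiM_lborel_scale:
  fixes f :: "('i \<Rightarrow> 'a :: euclidean_space) \<Rightarrow> ennreal"
  assumes "finite I" "f \<in> borel_measurable (Pi\<^sub>M I (\<lambda>_. lborel))" "0 < r"
  shows "(\<integral>\<^sup>+ x. f (\<lambda>i\<in>I. r *\<^sub>R x i) \<partial>Pi\<^sub>M I (\<lambda>_. lborel))
       = ennreal (1 / r ^ (DIM('a) * card I)) * (\<integral>\<^sup>+ x. f x \<partial>Pi\<^sub>M I (\<lambda>_. lborel))"
proof -
  have "(\<integral>\<^sup>+ x. f (\<lambda>i\<in>I. r *\<^sub>R x i) \<partial>Pi\<^sub>M I (\<lambda>_. lborel))
      = ennreal (1 / r ^ DIM('a)) ^ card I * (\<integral>\<^sup>+ x. f x \<partial>Pi\<^sub>M I (\<lambda>_. lborel))"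
    using assms nn_integral_lborel_affine[where t="0::'a" and c=r]
    by (intro nn_integral_PiM_map lborel.sigma_finite_measure_axioms) auto
  also have "ennreal (1 / r ^ DIM('a)) ^ card I = ennreal (1 / r ^ (DIM('a) * card I))"
    using assms(3) by (simp add: ennreal_power power_mult power_one_over)
  finally show ?thesis .
qed

lemma nn_integral_PiM_lborel_translate:
  fixes f :: "('i \<Rightarrow> 'a :: euclidean_space) \<Rightarrow> ennreal"
  assumes "finite I" "f \<in> borel_measurable (Pi\<^sub>M I (\<lambda>_. lborel))"
  shows "(\<integral>\<^sup>+ x. f (\<lambda>i\<in>I. x i + y i) \<partial>Pi\<^sub>M I (\<lambda>_. lborel)) = (\<integral>\<^sup>+ x. f x \<partial>Pi\<^sub>M I (\<lambda>_. lborel))"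
proof -
  have "(\<integral>\<^sup>+ x. f (\<lambda>i\<in>I. x i + y i) \<partial>Pi\<^sub>M I (\<lambda>_. lborel))
      = 1 ^ card I * (\<integral>\<^sup>+ x. f x \<partial>Pi\<^sub>M I (\<lambda>_. lborel))"
    using assms nn_integral_lborel_affine[where c=1 and t="y i :: 'a" for i]
    by (intro nn_integral_PiM_map lborel.sigma_finite_measure_axioms) (auto simp: add.commute)
  then show ?thesis by simp
qed

subsection \<open>Planar integrals\<close>

lemma distr_Complex_lborel: "distr lborel borel (\<lambda>(x, y). Complex x y) = lborel"
proof (rule lborel_eqI[symmetric])
  fix l u :: complex
  assume le: "\<And>b. b \<in> Basis \<Longrightarrow> l \<bullet> b \<le> u \<bullet> b"
  have le': "Re l \<le> Re u" "Im l \<le> Im u"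
    using le[of 1] le[of \<i>] by (auto simp: Basis_complex_def)
  have "(\<lambda>(x, y). Complex x y) -` box l u = box (Re l, Im l) (Re u, Im u)"
    by (auto simp: box_def Basis_complex_def Basis_prod_def)
  then show "emeasure (distr lborel borel (\<lambda>(x, y). Complex x y)) (box l u) = ennreal (\<Prod>b\<in>Basis. (u - l) \<bullet> b)"
    using le'
    by (subst emeasure_distr)
      (auto simp: emeasure_lborel_box_eq Basis_complex_def Basis_prod_def prod.union_disjoint
         case_prod_beta' Complex_eq intro!: borel_measurable_continuous_onI continuous_intros)
qed simp

lemma nn_integral_complex:
  assumes [measurable]: "f \<in> borel_measurable borel"
  shows "(\<integral>\<^sup>+ z. f z \<partial>lborel) = (\<integral>\<^sup>+ x. (\<integral>\<^sup>+ y. f (Complex x y) \<partial>lborel) \<partial>lborel)"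
proof -
  have [measurable]: "(\<lambda>(x, y). Complex x y) \<in> borel_measurable borel"
    by (auto simp: case_prod_beta' Complex_eq intro!: borel_measurable_continuous_onI continuous_intros)
  have "(\<integral>\<^sup>+ z. f z \<partial>lborel) = (\<integral>\<^sup>+ p. f (case p of (x, y) \<Rightarrow> Complex x y) \<partial>(lborel \<Otimes>\<^sub>M lborel))"
    by (subst distr_Complex_lborel[symmetric], subst nn_integral_distr) (auto simp: lborel_prod)
  also have "\<dots> = (\<integral>\<^sup>+ x. (\<integral>\<^sup>+ y. f (Complex x y) \<partial>lborel) \<partial>lborel)"
    by (subst lborel.nn_integral_fst[symmetric]) (auto simp: lborel_prod)
  finally show ?thesis .
qed

section \<open>Radial integration from the volume growth of sublevel sets\<close>

text \<open>Half-lines form an intersection-stable generator, and countably many of them exhaust the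
  line. Finiteness is asked on half-lines only, because the push-forward treated next may have
  infinite total mass.\<close>

lemma measure_eqI_atMost:
  fixes M N :: "real measure"
  assumes sets: "sets M = sets borel" "sets N = sets borel"
    and fin: "\<And>a. emeasure M {..a} \<noteq> \<infinity>"
    and eq: "\<And>a. emeasure M {..a} = emeasure N {..a}"
  shows "M = N"
proof (rule measure_eqI_generator_eq[where E="range atMost" and \<Omega>=UNIV and A="\<lambda>i. {..real i}"])
  show "Int_stable (range atMost :: real set set)"
    by (auto simp: Int_stable_def)
  have "\<exists>i. x \<le> real i" for x by (rule real_arch_simple)
  then show "(\<Union>i. {..real i}) = UNIV" by auto
qed (use assms in \<open>auto simp: borel_eq_atMost\<close>)

text \<open>The density is the derivative of the volume \<open>t powr \<alpha> * V\<close>. This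
  stands in for polar coordinates: integrals of functions of \<open>N\<close> become one-dimensional
  as soon as the sublevel volumes obey a power law.\<close>

lemma distr_of_powr_volume:
  fixes N :: "'a \<Rightarrow> real"
  assumes [measurable]: "N \<in> borel_measurable M" and N: "\<And>x. x \<in> space M \<Longrightarrow> 0 \<le> N x"
    and \<alpha>: "0 < \<alpha>" and V: "0 \<le> V"
    and vol: "\<And>t. 0 < t \<Longrightarrow> emeasure M {x \<in> space M. N x \<le> t} = ennreal (t powr \<alpha> * V)"
  shows "distr M borel N = density lborel (\<lambda>t. ennreal (indicator {0..} t * (V * \<alpha> * t powr (\<alpha> - 1))))"
    (is "?D = density lborel ?f")
proof (rule measure_eqI_atMost)
  have eq: "emeasure ?D {..a} = ennreal (if a \<le> 0 then 0 else a powr \<alpha> * V)" for a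
  proof -
    have D: "emeasure ?D {..a} = emeasure M {x \<in> space M. N x \<le> a}"
      by (subst emeasure_distr) (auto intro!: arg_cong[where f="emeasure M"])
    show ?thesis
    proof (cases "a \<le> 0")
      case True
      have "emeasure M {x \<in> space M. N x \<le> a} \<le> ennreal e" if "0 < e" for e
      proof -
        \<comment> \<open>With this choice \<open>t powr \<alpha> * V\<close> is at most
          \<open>e\<close>; \<open>V + 1\<close> covers \<open>V = 0\<close>. The volume hypothesis
          speaks of positive levels only, so level 0 is reached by monotonicity.\<close>
        define t where "t = (e / (V + 1)) powr (1 / \<alpha>)"
        have t: "0 < t" using that V by (auto simp: t_def)
        have "emeasure M {x \<in> space M. N x \<le> a} \<le> emeasure M {x \<in> space M. N x \<le> t}"
          using True t by (intro emeasure_mono) auto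
        also have "\<dots> = ennreal (t powr \<alpha> * V)" by (rule vol[OF t])
        also have "t powr \<alpha> = e / (V + 1)" using \<alpha> that V by (simp add: t_def powr_powr)
        also have "e / (V + 1) * V \<le> e" using that V by (simp add: field_simps)
        finally show ?thesis using that by (simp add: ennreal_leI order_trans)
      qed
      then have "emeasure M {x \<in> space M. N x \<le> a} \<le> 0"
        by (metis add_0 ennreal_le_epsilon)
      then show ?thesis using True D by simp
    next
      case False
      then show ?thesis using D vol by simp
    qed
  qed
  show "emeasure ?D {..a} \<noteq> \<infinity>" for a by (simp add: eq)
  show "emeasure ?D {..a} = emeasure (density lborel ?f) {..a}" for a
  proof -
    have "emeasure (density lborel ?f) {..a} = (\<integral>\<^sup>+ t. ?f t * indicator {..a} t \<partial>lborel)"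
      by (rule emeasure_density) auto
    also have "\<dots> = ennreal (if a \<le> 0 then 0 else a powr \<alpha> * V)"
    proof (cases "a \<le> 0")
      case True
      have "(\<integral>\<^sup>+ t. ?f t * indicator {..a} t \<partial>lborel) = (\<integral>\<^sup>+ t. 0 \<partial>(lborel :: real measure))"
      proof (rule nn_integral_cong_AE)
        show "AE t in lborel. ?f t * indicator {..a} t = 0"
          using AE_lborel_singleton[of "0::real"]
          by eventually_elim (use True in \<open>auto simp: indicator_def\<close>)
      qed
      then show ?thesis using True by simp
    next
      case False
      have "((\<lambda>t. V * \<alpha> * t powr (\<alpha> - 1)) has_integral (V * a powr \<alpha> - V * 0 powr \<alpha>)) {0..a}"
      proof (rule fundamental_theorem_of_calculus_interior)
        show "continuous_on {0..a} (\<lambda>t. V * t powr \<alpha>)"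
          using \<alpha> by (auto intro!: continuous_on_mult continuous_on_powr' continuous_on_const continuous_on_id)
        show "((\<lambda>t. V * t powr \<alpha>) has_vector_derivative V * \<alpha> * t powr (\<alpha> - 1)) (at t)" if "t \<in> {0<..<a}" for t
          using that unfolding has_real_derivative_iff_has_vector_derivative[symmetric]
          by (auto intro!: derivative_eq_intros)
      qed (use False in auto)
      then have "(\<integral>\<^sup>+ t. ennreal (indicator {0..a} t * (V * \<alpha> * t powr (\<alpha> - 1))) \<partial>lborel) = ennreal (V * a powr \<alpha>)"
        using V \<alpha> by (intro nn_integral_has_integral_lebesgue) auto
      also have "(\<integral>\<^sup>+ t. ennreal (indicator {0..a} t * (V * \<alpha> * t powr (\<alpha> - 1))) \<partial>lborel)
          = (\<integral>\<^sup>+ t. ?f t * indicator {..a} t \<partial>lborel)"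
        by (intro nn_integral_cong) (auto simp: indicator_def)
      finally show ?thesis using False by (simp add: mult.commute)
    qed
    finally show ?thesis by (simp add: eq)
  qed
qed auto

lemma nn_integral_of_powr_volume:
  fixes N :: "'a \<Rightarrow> real"
  assumes [measurable]: "N \<in> borel_measurable M" and "\<And>x. x \<in> space M \<Longrightarrow> 0 \<le> N x"
    and "0 < \<alpha>" and "0 \<le> V"
    and "\<And>t. 0 < t \<Longrightarrow> emeasure M {x \<in> space M. N x \<le> t} = ennreal (t powr \<alpha> * V)"
    and [measurable]: "h \<in> borel_measurable borel"
  shows "(\<integral>\<^sup>+ x. h (N x) \<partial>M) = (\<integral>\<^sup>+ t. ennreal (indicator {0..} t * (V * \<alpha> * t powr (\<alpha> - 1))) * h t \<partial>lborel)"
proof -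
  have "(\<integral>\<^sup>+ x. h (N x) \<partial>M) = (\<integral>\<^sup>+ t. h t \<partial>distr M borel N)"
    by (simp add: nn_integral_distr)
  also have "\<dots> = (\<integral>\<^sup>+ t. ennreal (indicator {0..} t * (V * \<alpha> * t powr (\<alpha> - 1))) * h t \<partial>lborel)"
    by (subst distr_of_powr_volume[OF assms(1-5)]) (auto simp: nn_integral_density)
  finally show ?thesis .
qed

lemma nn_integral_powr_exp_of_powr_volume:
  fixes N :: "'a \<Rightarrow> real"
  assumes "N \<in> borel_measurable M" "\<And>x. x \<in> space M \<Longrightarrow> 0 \<le> N x"
    and \<alpha>: "0 < \<alpha>" and V: "0 \<le> V" and \<beta>: "0 \<le> \<beta>"
    and "\<And>t. 0 < t \<Longrightarrow> emeasure M {x \<in> space M. N x \<le> t} = ennreal (t powr \<alpha> * V)"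
  shows "(\<integral>\<^sup>+ x. ennreal (N x powr \<beta> * exp (- N x)) \<partial>M) = ennreal (V * \<alpha> * Gamma (\<alpha> + \<beta>))"
proof -
  have "(\<integral>\<^sup>+ x. ennreal (N x powr \<beta> * exp (- N x)) \<partial>M)
      = (\<integral>\<^sup>+ t. ennreal (indicator {0..} t * (V * \<alpha> * t powr (\<alpha> - 1))) * ennreal (t powr \<beta> * exp (- t)) \<partial>lborel)"
    using assms by (intro nn_integral_of_powr_volume) auto
  also have "\<dots> = (\<integral>\<^sup>+ t. ennreal (V * \<alpha>) * ennreal (indicator {0..} t * t powr (\<alpha> + \<beta> - 1) / exp t) \<partial>lborel)"
  proof (rule nn_integral_cong)
    fix t :: real
    have "t powr (\<alpha> - 1) * t powr \<beta> = t powr (\<alpha> + \<beta> - 1)" by (simp add: powr_add[symmetric] algebra_simps)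
    then show "ennreal (indicator {0..} t * (V * \<alpha> * t powr (\<alpha> - 1))) * ennreal (t powr \<beta> * exp (- t)) =
        ennreal (V * \<alpha>) * ennreal (indicator {0..} t * t powr (\<alpha> + \<beta> - 1) / exp t)"
      using \<alpha> V by (auto simp: ennreal_mult[symmetric] indicator_def exp_minus field_simps)
  qed
  also have "\<dots> = ennreal (V * \<alpha>) * ennreal (Gamma (\<alpha> + \<beta>))"
    using \<alpha> \<beta> by (simp add: nn_integral_cmult Gamma_conv_nn_integral_real)
  also have "\<dots> = ennreal (V * \<alpha> * Gamma (\<alpha> + \<beta>))"
    using \<alpha> \<beta> V by (subst ennreal_mult[symmetric]) (auto intro!: less_imp_le Gamma_real_pos)
  finally show ?thesis .
qed

lemma cmod_powr_le_iff:
  assumes "0 < p" "0 \<le> s"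
  shows "cmod z powr p \<le> s \<longleftrightarrow> cmod z \<le> s powr (1 / p)"
proof
  assume "cmod z powr p \<le> s"
  then have "(cmod z powr p) powr (1 / p) \<le> s powr (1 / p)" using assms by (intro powr_mono2) auto
  then show "cmod z \<le> s powr (1 / p)" using assms by (simp add: powr_powr)
next
  assume "cmod z \<le> s powr (1 / p)"
  then have "cmod z powr p \<le> (s powr (1 / p)) powr p" using assms by (intro powr_mono2) auto
  then show "cmod z powr p \<le> s" using assms by (simp add: powr_powr)
qed

lemma emeasure_cmod_powr_le:
  assumes "0 < q" "0 < t"
  shows "emeasure lborel {z \<in> space lborel. cmod z powr q \<le> t} = ennreal (t powr (2 / q) * pi)"
proof -
  have "{z \<in> space lborel. cmod z powr q \<le> t} = cball 0 (t powr (1 / q))"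
    using assms by (auto simp: cball_def dist_norm cmod_powr_le_iff)
  moreover have "(t powr (1 / q))\<^sup>2 = t powr (2 / q)"
    using assms by (simp add: powr_powr flip: powr_realpow)
  ultimately show ?thesis
    by (simp add: emeasure_cball unit_ball_vol_2 mult.commute)
qed

text \<open>The area of a disc is linear in the squared radius, so the squared modulus carries
  planar Lebesgue measure to pi times Lebesgue measure on the half-line. In this variable Gaussians
  and truncated powers have elementary primitives.\<close>

lemma nn_integral_cmod_sq:
  assumes "h \<in> borel_measurable borel"
  shows "(\<integral>\<^sup>+ z. h ((cmod z)\<^sup>2) \<partial>lborel) = ennreal pi * (\<integral>\<^sup>+ t. h t * indicator {0..} t \<partial>lborel)"
proof -
  have "(\<integral>\<^sup>+ z. h ((cmod z)\<^sup>2) \<partial>lborel)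
      = (\<integral>\<^sup>+ t. ennreal (indicator {0..} t * (pi * 1 * t powr (1 - 1))) * h t \<partial>lborel)"
  proof (rule nn_integral_of_powr_volume)
    fix t :: real assume "0 < t"
    then show "emeasure lborel {z \<in> space lborel. (cmod z)\<^sup>2 \<le> t} = ennreal (t powr 1 * pi)"
      using emeasure_cmod_powr_le[of 2 t] by simp
  qed (use assms in auto)
  also have "\<dots> = (\<integral>\<^sup>+ t. ennreal pi * (h t * indicator {0..} t) \<partial>lborel)"
  \<comment> \<open>The integrands may differ at \<open>t = 0\<close>, because
    \<open>0 powr 0 = 0\<close>.\<close>
  proof (rule nn_integral_cong_AE)
    show "AE t in lborel. ennreal (indicator {0..} t * (pi * 1 * t powr (1 - 1))) * h t
        = ennreal pi * (h t * indicator {0..} t)"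
      using AE_lborel_singleton[of "0::real"]
      by eventually_elim (auto simp: indicator_def mult_ac)
  qed
  also have "\<dots> = ennreal pi * (\<integral>\<^sup>+ t. h t * indicator {0..} t \<partial>lborel)"
    using assms by (intro nn_integral_cmult) auto
  finally show ?thesis .
qed

lemma nn_integral_gauss_complex:
  assumes "0 < c"
  shows "(\<integral>\<^sup>+ z. ennreal (exp (- c * (cmod z)\<^sup>2)) \<partial>lborel) = ennreal (pi / c)"
proof -
  have "(\<integral>\<^sup>+ z. ennreal (exp (- c * (cmod z)\<^sup>2)) \<partial>lborel)
      = ennreal pi * (\<integral>\<^sup>+ t. ennreal (exp (- c * t)) * indicator {0..} t \<partial>lborel)"
    by (rule nn_integral_cmod_sq) auto
  also have "(\<integral>\<^sup>+ t. ennreal (exp (- c * t)) * indicator {0..} t \<partial>lborel) = ennreal (0 - (- exp (- c * 0) / c))"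
  proof (rule nn_integral_FTC_atLeast)
    show "((\<lambda>t. - exp (- c * t) / c) \<longlongrightarrow> 0) at_top"
    proof -
      have "filterlim (\<lambda>t. - c * t) at_bot at_top"
        using assms by (intro filterlim_tendsto_neg_mult_at_bot[OF tendsto_const _ filterlim_ident]) auto
      from filterlim_compose[OF exp_at_bot this] show ?thesis
        using tendsto_divide[OF tendsto_minus tendsto_const[of c], of "\<lambda>t. exp (- c * t)" 0 at_top] assms by auto
    qed
    show "DERIV (\<lambda>t. - exp (- c * t) / c) t :> exp (- c * t)" if "0 \<le> t" for t
      using assms by (auto intro!: derivative_eq_intros)
  qed auto
  finally show ?thesis using assms by (simp add: ennreal_mult[symmetric])
qed

text \<open>The classical squaring argument, run from the planar integral, which is elementary in
  the squared modulus.\<close>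

lemma nn_integral_gauss_real:
  assumes c: "0 < c"
  shows "(\<integral>\<^sup>+ x. ennreal (exp (- c * x\<^sup>2)) \<partial>lborel) = ennreal (sqrt (pi / c))"
proof -
  define I where "I = (\<integral>\<^sup>+ x. ennreal (exp (- c * x\<^sup>2)) \<partial>lborel)"
  have "(\<integral>\<^sup>+ z. ennreal (exp (- c * (cmod z)\<^sup>2)) \<partial>lborel)
      = (\<integral>\<^sup>+ x. (\<integral>\<^sup>+ y. ennreal (exp (- c * x\<^sup>2)) * ennreal (exp (- c * y\<^sup>2)) \<partial>lborel) \<partial>lborel)"
    by (subst nn_integral_complex)
      (auto intro!: nn_integral_cong simp: cmod_power2 ennreal_mult[symmetric] exp_add[symmetric] algebra_simps)
  also have "\<dots> = I * I"
    by (simp add: nn_integral_cmult nn_integral_multc I_def)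
  finally have I: "I * I = ennreal (pi / c)" using nn_integral_gauss_complex[OF c] by simp
  show ?thesis
  proof (cases I rule: ennreal_cases)
    case (real r)
    then have "r\<^sup>2 = pi / c" using I c by (simp add: ennreal_mult[symmetric] power2_eq_square)
    then have "sqrt (pi / c) = r" using real(1) by (rule real_sqrt_unique)
    with real(2) have "I = ennreal (sqrt (pi / c))" by (simp only:)
    then show ?thesis unfolding I_def .
  next
    case top
    then show ?thesis using I by (simp add: ennreal_mult_top)
  qed
qed

text \<open>Not literally the case \<open>\<beta> = 0\<close> of the Gamma integral above: since
  \<open>0 powr 0 = 0\<close>, that integrand vanishes where \<open>N\<close> does.\<close>

lemma nn_integral_exp_of_powr_volume:
  fixes N :: "'a \<Rightarrow> real"
  assumes "N \<in> borel_measurable M" "\<And>x. x \<in> space M \<Longrightarrow> 0 \<le> N x"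
    and \<alpha>: "0 < \<alpha>" and V: "0 \<le> V"
    and "\<And>t. 0 < t \<Longrightarrow> emeasure M {x \<in> space M. N x \<le> t} = ennreal (t powr \<alpha> * V)"
  shows "(\<integral>\<^sup>+ x. ennreal (exp (- N x)) \<partial>M) = ennreal (V * Gamma (1 + \<alpha>))"
proof -
  have "(\<integral>\<^sup>+ x. ennreal (exp (- N x)) \<partial>M)
      = (\<integral>\<^sup>+ t. ennreal (indicator {0..} t * (V * \<alpha> * t powr (\<alpha> - 1))) * ennreal (exp (- t)) \<partial>lborel)"
    using assms by (intro nn_integral_of_powr_volume) auto
  also have "\<dots> = (\<integral>\<^sup>+ t. ennreal (V * \<alpha>) * ennreal (indicator {0..} t * t powr (\<alpha> - 1) / exp t) \<partial>lborel)"
    using \<alpha> V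
    by (intro nn_integral_cong) (auto simp: ennreal_mult[symmetric] indicator_def exp_minus field_simps)
  also have "\<dots> = ennreal (V * \<alpha>) * ennreal (Gamma \<alpha>)"
    using \<alpha> by (simp add: nn_integral_cmult Gamma_conv_nn_integral_real)
  also have "\<dots> = ennreal (V * Gamma (1 + \<alpha>))"
  proof -
    have "Gamma (1 + \<alpha>) = \<alpha> * Gamma \<alpha>"
      by (subst add.commute, rule Gamma_plus1) (use \<alpha> in \<open>auto elim!: nonpos_Ints_cases\<close>)
    then show ?thesis
      using \<alpha> V by (subst ennreal_mult[symmetric]) (auto intro!: less_imp_le Gamma_real_pos simp: mult.assoc)
  qed
  finally show ?thesis .
qed

subsection \<open>Orthogonal splitting along a complex direction\<close>

text \<open>By Markov's inequality the sets where \<open>1 \<le> k * g\<close> have finite measure,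
  and positivity of \<open>g\<close> makes them exhaust the space. This serves image measures, which
  do not inherit sigma-finiteness; \<open>g\<close> will be a Gaussian.\<close>

lemma sigma_finite_measure_of_positive_integrable:
  fixes g :: "'a \<Rightarrow> ennreal"
  assumes [measurable]: "g \<in> borel_measurable M"
    and pos: "\<And>x. x \<in> space M \<Longrightarrow> 0 < g x" and fin: "(\<integral>\<^sup>+ x. g x \<partial>M) \<noteq> \<infinity>"
  shows "sigma_finite_measure M"
proof
  let ?A = "\<lambda>k::nat. {x \<in> space M. 1 \<le> of_nat k * g x}"
  have "emeasure M (?A k) \<noteq> \<infinity>" for k
  proof -
    have "emeasure M (?A k) \<le> of_nat k * (\<integral>\<^sup>+ x. g x * indicator (space M) x \<partial>M)"
      using nn_integral_Markov_inequality[where u=g and c="of_nat k" and A="space M" and M=M] by (simp add: of_nat_less_top)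
    also have "(\<integral>\<^sup>+ x. g x * indicator (space M) x \<partial>M) = (\<integral>\<^sup>+ x. g x \<partial>M)"
      by (intro nn_integral_cong) simp
    also have "of_nat k * (\<integral>\<^sup>+ x. g x \<partial>M) < \<infinity>"
      using fin by (simp add: ennreal_mult_less_top of_nat_less_top less_top)
    finally show ?thesis by simp
  qed
  moreover have "\<exists>k. x \<in> ?A k" if "x \<in> space M" for x
  proof (cases "g x" rule: ennreal_cases)
    case (real r)
    with pos[OF that] have "0 < r" by (auto simp: ennreal_less_zero_iff)
    then obtain k :: nat where "1 < real k * r" using reals_Archimedean3 by blast
    then have "1 \<le> of_nat k * g x"
      using real by (simp add: ennreal_of_nat_eq_real_of_nat ennreal_mult[symmetric])
    then show ?thesis using that by blast
  next
    case top
    then have "1 \<le> of_nat 1 * g x" by simp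
    then show ?thesis using that by blast
  qed
  ultimately show "\<exists>A. countable A \<and> A \<subseteq> sets M \<and> \<Union>A = space M \<and> (\<forall>a\<in>A. emeasure M a \<noteq> \<infinity>)"
    by (intro exI[of _ "range ?A"]) auto
qed

text \<open>For a unit vector \<open>a\<close> and an orthonormal basis \<open>b\<close> of its
  complex hyperplane, this is a linear isometry from the product of real k-space and the complex
  line onto complex n-space; \<open>w\<close> is the complex coordinate along
  \<open>a\<close>.\<close>

definition split_along ::
  "nat \<Rightarrow> nat \<Rightarrow> (nat \<Rightarrow> nat \<Rightarrow> complex) \<Rightarrow> (nat \<Rightarrow> complex) \<Rightarrow> (nat \<Rightarrow> real) \<Rightarrow> complex \<Rightarrow> nat \<Rightarrow> complex" where
  "split_along n k b a x w = (\<lambda>j\<in>{..<n}. (\<Sum>i<k. x i *\<^sub>R b i j) + w * a j)"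

lemma split_along_0: "split_along n k b a x 0 = real_lincomb n k b x"
  by (simp add: split_along_def real_lincomb_def)

lemma space_PiM_cspace: "space (Pi\<^sub>M {..<n} (\<lambda>_. lborel :: complex measure)) = cspace n"
  by (simp add: space_PiM cspace_def)

context
  fixes n k :: nat and a :: "nat \<Rightarrow> complex" and b :: "nat \<Rightarrow> nat \<Rightarrow> complex"
  assumes onb: "real_onb n k (chyperplane n a) b" and a: "rinner n a a = 1" "a \<in> cspace n"
begin

lemma cinner_self: "cinner n a a = 1"
proof -
  have "cinner n a a = of_real (rinner n a a)"
    unfolding cinner_def rinner_def of_real_sum
    by (intro sum.cong) (auto simp: complex_mult_cnj inner_complex_def power2_eq_square)
  then show ?thesis by (simp add: a)
qed

lemma cinner_real_lincomb: "(\<Sum>j<n. (\<Sum>i<k. x i *\<^sub>R b i j) * cnj (a j)) = 0"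
proof -
  have "real_lincomb n k b x \<in> chyperplane n a" using onb by (auto simp: real_onb_def)
  then show ?thesis by (simp add: chyperplane_def cinner_def real_lincomb_def)
qed

lemma cinner_split_along: "cinner n (split_along n k b a x w) a = w"
proof -
  have "cinner n (split_along n k b a x w) a
      = (\<Sum>j<n. (\<Sum>i<k. x i *\<^sub>R b i j) * cnj (a j)) + w * cinner n a a"
    by (simp add: cinner_def split_along_def sum.distrib ring_distribs sum_distrib_left mult.assoc)
  then show ?thesis by (simp only: cinner_real_lincomb cinner_self) simp
qed

text \<open>Pythagoras. The cross term vanishes because a vector that is complex-orthogonal to
  \<open>a\<close> is real-orthogonal to every complex multiple of \<open>a\<close>.\<close>

lemma norm_split_along:
  "(\<Sum>j<n. (cmod (split_along n k b a x w j))\<^sup>2) = (\<Sum>i<k. (x i)\<^sup>2) + (cmod w)\<^sup>2"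
proof -
  let ?S = "\<lambda>j. \<Sum>i<k. x i *\<^sub>R b i j"
  have "(\<Sum>j<n. (cmod (split_along n k b a x w j))\<^sup>2)
      = (\<Sum>j<n. ?S j \<bullet> ?S j) + 2 * (\<Sum>j<n. ?S j \<bullet> (w * a j)) + (\<Sum>j<n. (w * a j) \<bullet> (w * a j))"
    by (simp add: split_along_def power2_norm_eq_inner inner_add_left inner_add_right
        sum.distrib sum_distrib_left inner_commute)
  also have "(\<Sum>j<n. ?S j \<bullet> ?S j) = (\<Sum>i<k. (x i)\<^sup>2)"
  proof -
    have "(\<Sum>j<n. ?S j \<bullet> ?S j) = (\<Sum>j<n. \<Sum>i<k. \<Sum>i'<k. x i * x i' * (b i j \<bullet> b i' j))"
      by (simp add: inner_sum_left inner_sum_right mult.assoc sum_distrib_left mult.left_commute inner_commute)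
    also have "\<dots> = (\<Sum>i<k. \<Sum>j<n. \<Sum>i'<k. x i * x i' * (b i j \<bullet> b i' j))"
      by (rule sum.swap)
    also have "\<dots> = (\<Sum>i<k. \<Sum>i'<k. \<Sum>j<n. x i * x i' * (b i j \<bullet> b i' j))"
      by (intro sum.cong refl sum.swap)
    also have "\<dots> = (\<Sum>i<k. \<Sum>i'<k. x i * x i' * rinner n (b i) (b i'))"
      by (simp add: rinner_def sum_distrib_left)
    also have "\<dots> = (\<Sum>i<k. \<Sum>i'<k. if i = i' then x i * x i' else 0)"
      using onb by (intro sum.cong refl) (auto simp: real_onb_def)
    also have "\<dots> = (\<Sum>i<k. (x i)\<^sup>2)"
      by (simp add: power2_eq_square)
    finally show ?thesis .
  qed
  also have "(\<Sum>j<n. ?S j \<bullet> (w * a j)) = Re (cnj w * (\<Sum>j<n. ?S j * cnj (a j)))"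
  proof -
    have "(\<Sum>j<n. S j \<bullet> (w * a j)) = Re (cnj w * (\<Sum>j<n. S j * cnj (a j)))" for S
      by (simp add: sum_distrib_left Re_sum inner_complex_def algebra_simps)
    then show ?thesis .
  qed
  also have "(\<Sum>j<n. ?S j * cnj (a j)) = 0" by (rule cinner_real_lincomb)
  also have "(\<Sum>j<n. (w * a j) \<bullet> (w * a j)) = (cmod w)\<^sup>2 * rinner n a a"
    by (simp add: rinner_def sum_distrib_left norm_mult power_mult_distrib flip: power2_norm_eq_inner)
  finally show ?thesis using a by simp
qed

lemma split_along_surj:
  assumes y: "y \<in> cspace n"
  obtains x w where "x \<in> {..<k} \<rightarrow>\<^sub>E UNIV" "split_along n k b a x w = y"
proof -
  define w where "w = cinner n y a"
  have "(\<lambda>j\<in>{..<n}. y j - w * a j) \<in> chyperplane n a"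
    using cinner_self
    by (simp add: chyperplane_def cspace_def cinner_def w_def left_diff_distrib sum_subtractf mult.assoc
        flip: sum_distrib_left)
  then obtain x where x: "real_lincomb n k b x = (\<lambda>j\<in>{..<n}. y j - w * a j)"
    using onb by (auto simp: real_onb_def)
  \<comment> \<open>\<open>real_onb\<close> takes the range over all functions, so \<open>x\<close>
    may carry arbitrary values beyond \<open>k\<close>; restricting it puts it into the product
    space without changing the image.\<close>
  have "split_along n k b a (restrict x {..<k}) w j = y j" for j
  proof (cases "j < n")
    case True
    then show ?thesis using fun_cong[OF x, of j] by (simp add: split_along_def real_lincomb_def)
  next
    case False
    then show ?thesis using y by (auto simp: split_along_def cspace_def PiE_def extensional_def)
  qed
  then show ?thesis by (intro that[of "restrict x {..<k}" w]) auto
qed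

lemma measurable_split_along[measurable]:
  "(\<lambda>(x, w). split_along n k b a x w) \<in>
     Pi\<^sub>M {..<k} (\<lambda>_. lborel) \<Otimes>\<^sub>M lborel \<rightarrow>\<^sub>M Pi\<^sub>M {..<n} (\<lambda>_. lborel :: complex measure)"
  unfolding split_along_def case_prod_beta' by (intro measurable_restrict) measurable

text \<open>Fubini in rotated coordinates. The image measure \<open>N\<close> of the product measure
  is translation invariant because the splitting is linear and onto, and it gives the Gaussian the
  right integral by Pythagoras. With the constant pi in the exponent a Gaussian has integral 1 in
  every dimension, so the normalisations agree whatever \<open>k\<close> and \<open>n\<close>
  are.\<close>

lemma nn_integral_split_along:
  assumes f[measurable]: "f \<in> borel_measurable (Pi\<^sub>M {..<n} (\<lambda>_. lborel :: complex measure))"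
  shows "(\<integral>\<^sup>+ z. f z \<partial>Pi\<^sub>M {..<n} (\<lambda>_. lborel))
       = (\<integral>\<^sup>+ x. (\<integral>\<^sup>+ w. f (split_along n k b a x w) \<partial>lborel) \<partial>Pi\<^sub>M {..<k} (\<lambda>_. lborel))"
proof -
  let ?M = "Pi\<^sub>M {..<n} (\<lambda>_. lborel :: complex measure)"
  let ?K = "Pi\<^sub>M {..<k} (\<lambda>_. lborel :: real measure)"
  define N where "N = distr (?K \<Otimes>\<^sub>M lborel) ?M (\<lambda>(x, w). split_along n k b a x w)"
  define g :: "(nat \<Rightarrow> complex) \<Rightarrow> ennreal" where "g = (\<lambda>z. ennreal (exp (- pi * (\<Sum>j<n. (cmod (z j))\<^sup>2))))"
  have [measurable]: "g \<in> borel_measurable ?M" unfolding g_def by measurable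
  have [measurable_cong]: "sets N = sets ?M" by (simp add: N_def)
  interpret C: product_sigma_finite "\<lambda>_::nat. lborel :: complex measure" by standard
  interpret R: product_sigma_finite "\<lambda>_::nat. lborel :: real measure" by standard
  interpret K: sigma_finite_measure ?K by (rule R.sigma_finite) simp
  have nn_N: "(\<integral>\<^sup>+ z. h z \<partial>N) = (\<integral>\<^sup>+ x. (\<integral>\<^sup>+ w. h (split_along n k b a x w) \<partial>lborel) \<partial>?K)"
    if [measurable]: "h \<in> borel_measurable ?M" for h
  proof -
    have "(\<integral>\<^sup>+ z. h z \<partial>N) = (\<integral>\<^sup>+ p. h (case p of (x, w) \<Rightarrow> split_along n k b a x w) \<partial>(?K \<Otimes>\<^sub>M lborel))"
      unfolding N_def by (rule nn_integral_distr) measurable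
    then show ?thesis by (simp add: lborel.nn_integral_fst[symmetric])
  qed
  have gM: "(\<integral>\<^sup>+ z. g z \<partial>?M) = 1"
  proof -
    have "(\<integral>\<^sup>+ z. g z \<partial>?M) = (\<integral>\<^sup>+ z. (\<Prod>j<n. ennreal (exp (- pi * (cmod (z j))\<^sup>2))) \<partial>?M)"
      by (simp add: g_def prod_ennreal exp_sum[symmetric] sum_distrib_left sum_negf)
    also have "\<dots> = (\<Prod>j<n. \<integral>\<^sup>+ z. ennreal (exp (- pi * (cmod z)\<^sup>2)) \<partial>lborel)"
      by (rule C.product_nn_integral_prod) auto
    finally show ?thesis by (simp only: nn_integral_gauss_complex pi_gt_zero) simp
  qed
  have gN: "(\<integral>\<^sup>+ z. g z \<partial>N) = 1"
  proof -
    have "(\<integral>\<^sup>+ z. g z \<partial>N)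
        = (\<integral>\<^sup>+ x. (\<integral>\<^sup>+ w. (\<Prod>i<k. ennreal (exp (- pi * (x i)\<^sup>2))) * ennreal (exp (- pi * (cmod w)\<^sup>2)) \<partial>lborel) \<partial>?K)"
      unfolding nn_N[OF \<open>g \<in> borel_measurable ?M\<close>] unfolding g_def norm_split_along
      by (simp add: prod_ennreal prod_nonneg ennreal_mult[symmetric] exp_sum[symmetric]
          exp_add[symmetric] sum_distrib_left sum_negf ring_distribs)
    also have "\<dots> = (\<integral>\<^sup>+ x. (\<Prod>i<k. ennreal (exp (- pi * (x i)\<^sup>2))) * ennreal (pi / pi) \<partial>?K)"
      using nn_integral_gauss_complex[OF pi_gt_zero] by (simp add: nn_integral_cmult)
    also have "\<dots> = (\<integral>\<^sup>+ x. (\<Prod>i<k. ennreal (exp (- pi * (x i)\<^sup>2))) \<partial>?K)"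
      by simp
    also have "\<dots> = (\<Prod>i<k. \<integral>\<^sup>+ x. ennreal (exp (- pi * x\<^sup>2)) \<partial>lborel)"
      by (rule R.product_nn_integral_prod) auto
    finally show ?thesis by (simp only: nn_integral_gauss_real[OF pi_gt_zero]) simp
  qed
  have "(\<integral>\<^sup>+ z. f z \<partial>?M) = (\<integral>\<^sup>+ z. f z \<partial>N)"
  proof (rule nn_integral_unique_of_translation_invariant[where g=g and
      add="\<lambda>x y. \<lambda>j\<in>{..<n}. x j + y j" and sub="\<lambda>x y. \<lambda>j\<in>{..<n}. x j - y j"])
    show "sigma_finite_measure ?M" by (rule C.sigma_finite) simp
    show "sigma_finite_measure N"
      by (rule sigma_finite_measure_of_positive_integrable[where g=g]) (auto simp: gN, simp add: g_def)
    show "(\<integral>\<^sup>+ x. h (\<lambda>j\<in>{..<n}. x j + y j) \<partial>?M) = (\<integral>\<^sup>+ x. h x \<partial>?M)"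
      if "h \<in> borel_measurable ?M" for y h
      by (rule nn_integral_PiM_lborel_translate) (use that in auto)
    show "(\<integral>\<^sup>+ x. h (\<lambda>j\<in>{..<n}. x j - y j) \<partial>N) = (\<integral>\<^sup>+ x. h x \<partial>N)"
      if y: "y \<in> space ?M" and h[measurable]: "h \<in> borel_measurable ?M" for y h
    proof -
      \<comment> \<open>By surjectivity a translation by \<open>y\<close> lifts to a translation by
        \<open>(x', w')\<close> in the source, where the product measure is invariant.\<close>
      obtain x' w' where x': "x' \<in> {..<k} \<rightarrow>\<^sub>E UNIV" "split_along n k b a x' w' = y"
        using split_along_surj y by (auto simp: space_PiM_cspace)
      let ?shift = "\<lambda>x. \<lambda>i\<in>{..<k}. x i + (- x' i)"
      have diff: "(\<lambda>j\<in>{..<n}. split_along n k b a x w j - y j)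
          = split_along n k b a (?shift x) (- w' + 1 *\<^sub>R w)" for x w
        by (auto simp: split_along_def x'(2)[symmetric] fun_eq_iff sum_subtractf sum.distrib
            algebra_simps)
      have m[measurable]: "(\<lambda>z. h (\<lambda>j\<in>{..<n}. z j - y j)) \<in> borel_measurable ?M"
      proof -
        have "(\<lambda>z. \<lambda>j\<in>{..<n}. z j - y j) \<in> ?M \<rightarrow>\<^sub>M ?M" by (intro measurable_restrict) measurable
        then show ?thesis by measurable
      qed
      have "(\<integral>\<^sup>+ x. h (\<lambda>j\<in>{..<n}. x j - y j) \<partial>N)
          = (\<integral>\<^sup>+ x. (\<integral>\<^sup>+ w. h (split_along n k b a (?shift x) (- w' + 1 *\<^sub>R w)) \<partial>lborel) \<partial>?K)"
        by (simp only: nn_N[OF m] diff)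
      also have "\<dots> = (\<integral>\<^sup>+ x. (\<integral>\<^sup>+ w. h (split_along n k b a (?shift x) w) \<partial>lborel) \<partial>?K)"
      proof (rule nn_integral_cong)
        fix x :: "nat \<Rightarrow> real"
        have "(?shift x) \<in> space ?K" by (simp add: space_PiM)
        from measurable_compose[OF measurable_Pair1'[OF this] measurable_split_along]
        have "(\<lambda>w. split_along n k b a (?shift x) w) \<in> lborel \<rightarrow>\<^sub>M ?M" by simp
        then have "(\<lambda>w. h (split_along n k b a (?shift x) w)) \<in> borel_measurable borel"
          using measurable_compose[OF _ h] by (simp add: measurable_lborel1)
        from nn_integral_lborel_affine[OF this, of 1 "- w'"]
        show "(\<integral>\<^sup>+ w. h (split_along n k b a (?shift x) (- w' + 1 *\<^sub>R w)) \<partial>lborel)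
            = (\<integral>\<^sup>+ w. h (split_along n k b a (?shift x) w) \<partial>lborel)"
          by simp
      qed
      also have "\<dots> = (\<integral>\<^sup>+ x. (\<integral>\<^sup>+ w. h (split_along n k b a x w) \<partial>lborel) \<partial>?K)"
        by (rule nn_integral_PiM_lborel_translate[where y="\<lambda>i. - x' i"]) auto
      finally show ?thesis by (simp add: nn_N)
    qed
    show "g (\<lambda>j\<in>{..<n}. y j - (\<lambda>j\<in>{..<n}. x j + y j) j) = g x" for x y
      by (simp add: g_def)
    show "sets N = sets ?M" by (simp add: N_def)
  qed (auto simp: gM gN space_PiM_cspace cspace_def PiE_iff extensional_def fun_eq_iff intro!: measurable_restrict)
  then show ?thesis by (simp add: nn_N)
qed

end

subsection \<open>An orthonormal basis of a complex hyperplane\<close>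

lemma sum_lessThan_double: "(\<Sum>i<2 * N. f i) = (\<Sum>m<N. f (2 * m) + f (Suc (2 * m)))" for f :: "nat \<Rightarrow> 'a::comm_monoid_add"
  by (induction N) (auto simp: add.assoc)

text \<open>
  The column \<open>j\<close> of the reflection that exchanges \<open>\<alpha>\<close> and the unit vector \<open>e\<^sub>0\<close>;
  the columns \<open>j > 0\<close> span the orthogonal complement of \<open>\<alpha>\<close>.
\<close>

definition householder :: "(nat \<Rightarrow> real) \<Rightarrow> nat \<Rightarrow> nat \<Rightarrow> real" where
  "householder \<alpha> j l = (if l = j then 1 else 0) + \<alpha> j / (1 - \<alpha> 0) * ((if l = 0 then 1 else 0) - \<alpha> l)"

context
  fixes n :: nat and \<alpha> :: "nat \<Rightarrow> real"
  assumes n: "0 < n" and \<alpha>: "(\<Sum>j<n. (\<alpha> j)\<^sup>2) = 1" "\<alpha> 0 < 1"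
begin

text \<open>All correction terms cancel because the squared length of the difference between the
  unit vectors \<alpha> and \<open>e\<^sub>0\<close> is \<open>2 * (1 - \<alpha> 0)\<close>.\<close>

lemma householder_orthonormal:
  assumes "0 < j" "j < n" "0 < j'" "j' < n"
  shows "(\<Sum>l<n. householder \<alpha> j l * householder \<alpha> j' l) = (if j = j' then 1 else 0)"
proof -
  define c c' where "c = \<alpha> j / (1 - \<alpha> 0)" and "c' = \<alpha> j' / (1 - \<alpha> 0)"
  define e where "e = (\<lambda>j l::nat. if l = j then 1 else 0 :: real)"
  have e: "(\<Sum>l<n. e j l * f l) = f j" if "j < n" for j f
    using that by (simp add: e_def if_distrib[where f="\<lambda>x. x * _"] cong: if_cong)
  have "(\<Sum>l<n. householder \<alpha> j l * householder \<alpha> j' l)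
      = (\<Sum>l<n. e j l * (e j' l + c' * (e 0 l - \<alpha> l)) + e 0 l * (c * (e j' l + c' * (e 0 l - \<alpha> l)))
           - e j' l * (c * \<alpha> l) - e 0 l * (c * c' * \<alpha> l) + c * c' * (\<alpha> l)\<^sup>2)"
  proof (intro sum.cong refl)
    fix l
    have "householder \<alpha> j l = e j l + c * (e 0 l - \<alpha> l)" "householder \<alpha> j' l = e j' l + c' * (e 0 l - \<alpha> l)"
      by (simp_all add: householder_def e_def c_def c'_def)
    then show "householder \<alpha> j l * householder \<alpha> j' l
        = e j l * (e j' l + c' * (e 0 l - \<alpha> l)) + e 0 l * (c * (e j' l + c' * (e 0 l - \<alpha> l)))
           - e j' l * (c * \<alpha> l) - e 0 l * (c * c' * \<alpha> l) + c * c' * (\<alpha> l)\<^sup>2"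
      by (simp only:) (simp add: algebra_simps power2_eq_square)
  qed
  also have "\<dots> = (e j' j + c' * (e 0 j - \<alpha> j)) + c * (e j' 0 + c' * (e 0 0 - \<alpha> 0))
           - c * \<alpha> j' - c * c' * \<alpha> 0 + c * c' * (\<Sum>l<n. (\<alpha> l)\<^sup>2)"
    by (simp only: sum.distrib sum_subtractf e[OF \<open>j < n\<close>] e[OF n] e[OF \<open>j' < n\<close>] sum_distrib_left)
  also have "\<dots> = (if j = j' then 1 else 0) - c' * \<alpha> j - c * \<alpha> j' + 2 * (c * c') * (1 - \<alpha> 0)"
    using assms \<alpha>(1) by (simp add: e_def algebra_simps)
  also have "\<dots> = (if j = j' then 1 else 0)"
    using \<alpha>(2) by (simp add: c_def c'_def)
  finally show ?thesis .
qed

lemma householder_orthogonal: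
  assumes "0 < j" "j < n"
  shows "(\<Sum>l<n. householder \<alpha> j l * \<alpha> l) = 0"
proof -
  define c where "c = \<alpha> j / (1 - \<alpha> 0)"
  have "(\<Sum>l<n. householder \<alpha> j l * \<alpha> l)
      = (\<Sum>l<n. (if l = j then \<alpha> l else 0) + (if l = 0 then c * \<alpha> l else 0) - c * (\<alpha> l)\<^sup>2)"
    by (intro sum.cong refl) (simp add: householder_def c_def[symmetric] algebra_simps power2_eq_square)
  also have "\<dots> = \<alpha> j + c * \<alpha> 0 - c * (\<Sum>l<n. (\<alpha> l)\<^sup>2)"
    using assms n by (simp add: sum.distrib sum_subtractf sum_distrib_left)
  also have "\<dots> = 0" using \<alpha> by (simp add: c_def field_simps)
  finally show ?thesis .
qed

text \<open>The coefficient \<open>?c m\<close> is the scalar product of \<open>z\<close> with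
  column \<open>Suc m\<close>, from which the term containing the scalar product of \<open>z\<close>
  and \<alpha> has dropped out by hypothesis.\<close>

lemma householder_span:
  fixes z :: "nat \<Rightarrow> complex"
  assumes z: "(\<Sum>l<n. z l * of_real (\<alpha> l)) = 0" and l: "l < n"
  shows "(\<Sum>m<n - 1. (z (Suc m) + of_real (\<alpha> (Suc m) / (1 - \<alpha> 0)) * z 0) * of_real (householder \<alpha> (Suc m) l)) = z l"
    (is "(\<Sum>m<n-1. ?c m * _) = _")
proof -
  define D where "D = complex_of_real (1 - \<alpha> 0)"
  have D: "D \<noteq> 0" using \<alpha> by (simp add: D_def del: of_real_diff)
  obtain N where N: "n = Suc N" using n by (cases n) auto
  have z': "(\<Sum>m<N. z (Suc m) * of_real (\<alpha> (Suc m))) = - z 0 * of_real (\<alpha> 0)"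
    using z by (simp add: N sum.lessThan_Suc_shift eq_neg_iff_add_eq_0 add.commute del: sum.lessThan_Suc)
  have a': "(\<Sum>m<N. (\<alpha> (Suc m))\<^sup>2) = (1 - \<alpha> 0) * (1 + \<alpha> 0)"
    using \<alpha>(1) by (simp add: N sum.lessThan_Suc_shift algebra_simps power2_eq_square del: sum.lessThan_Suc)
  have "(\<Sum>m<N. ?c m * of_real (\<alpha> (Suc m)))
      = (\<Sum>m<N. z (Suc m) * of_real (\<alpha> (Suc m))) + z 0 / D * of_real (\<Sum>m<N. (\<alpha> (Suc m))\<^sup>2)"
    unfolding of_real_sum sum_distrib_left sum.distrib[symmetric]
    by (intro sum.cong refl) (simp add: D_def[symmetric] of_real_divide ring_distribs power2_eq_square del: of_real_diff)
  also have "\<dots> = z 0"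
  proof -
    have e: "complex_of_real ((1 - \<alpha> 0) * (1 + \<alpha> 0)) = D * (1 + of_real (\<alpha> 0))"
      by (simp add: D_def)
    show ?thesis unfolding z' a' e using D by (simp add: ring_distribs)
  qed
  finally have S: "(\<Sum>m<N. ?c m * of_real (\<alpha> (Suc m))) = z 0" .
  define q where "q = complex_of_real ((if l = 0 then 1 else 0) - \<alpha> l)"
  have "(\<Sum>m<N. ?c m * of_real (householder \<alpha> (Suc m) l))
      = (\<Sum>m<N. (if l = Suc m then ?c m else 0) + q / D * (?c m * of_real (\<alpha> (Suc m))))"
  proof (intro sum.cong refl)
    fix m
    have "complex_of_real (householder \<alpha> (Suc m) l) = (if l = Suc m then 1 else 0) + of_real (\<alpha> (Suc m)) / D * q"
      by (simp add: householder_def q_def D_def)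
    then show "?c m * of_real (householder \<alpha> (Suc m) l)
        = (if l = Suc m then ?c m else 0) + q / D * (?c m * of_real (\<alpha> (Suc m)))"
      by (simp only:) (simp add: ring_distribs mult_ac)
  qed
  also have "\<dots> = (\<Sum>m<N. if l = Suc m then ?c m else 0) + q / D * z 0"
    by (simp only: sum.distrib sum_distrib_left[symmetric] S)
  also have "\<dots> = z l"
  proof (cases l)
    case 0
    then have "q = D" by (simp add: q_def D_def)
    then show ?thesis using 0 D by simp
  next
    case (Suc l')
    then have s: "(\<Sum>m<N. if l = Suc m then ?c m else 0) = ?c l'"
      using l N by simp
    have c: "complex_of_real (\<alpha> (Suc l') / (1 - \<alpha> 0)) = - q / D"
      using Suc by (simp add: q_def D_def)
    show ?thesis unfolding s c using Suc by simp
  qed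
  finally show ?thesis by (simp add: N)
qed

text \<open>For a real direction the Householder columns are real, so they form a complex
  orthonormal basis of the hyperplane. Together with their multiples by \<open>\<i>\<close> they
  form a real one: index \<open>i\<close> stands for column \<open>Suc (i div 2)\<close>, multiplied
  by \<open>\<i>\<close> when \<open>i\<close> is odd.\<close>

lemma real_onb_chyperplane:
  "\<exists>b. real_onb n (2 * (n - 1)) (chyperplane n (\<lambda>j\<in>{..<n}. complex_of_real (\<alpha> j))) b"
proof -
  define u where "u i = (if even i then 1 else \<i> :: complex)" for i :: nat
  define b where "b i = (\<lambda>j\<in>{..<n}. u i * of_real (householder \<alpha> (Suc (i div 2)) j))" for i :: nat
  let ?H = "chyperplane n (\<lambda>j\<in>{..<n}. complex_of_real (\<alpha> j))"
  have idx: "Suc (i div 2) < n" if "i < 2 * (n - 1)" for i using that by linarith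
  have "rinner n (b i) (b i') = (if i = i' then 1 else 0)" if "i < 2 * (n - 1)" "i' < 2 * (n - 1)" for i i'
  proof -
    have "rinner n (b i) (b i') = (u i \<bullet> u i') * (\<Sum>l<n. householder \<alpha> (Suc (i div 2)) l * householder \<alpha> (Suc (i' div 2)) l)"
      unfolding rinner_def sum_distrib_left
      by (intro sum.cong refl) (simp add: b_def inner_complex_def algebra_simps)
    also have "\<dots> = (u i \<bullet> u i') * (if i div 2 = i' div 2 then 1 else 0)"
      using householder_orthonormal[of "Suc (i div 2)" "Suc (i' div 2)"] idx[OF that(1)] idx[OF that(2)] by simp
    also have "\<dots> = (if i = i' then 1 else 0)"
      by (auto simp: u_def inner_complex_def elim!: evenE oddE)
    finally show ?thesis .
  qed
  moreover have "?H = range (real_lincomb n (2 * (n - 1)) b)"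
  proof (intro equalityI subsetI)
    fix z assume z: "z \<in> ?H"
    then have z0: "(\<Sum>l<n. z l * of_real (\<alpha> l)) = 0" and zc: "z \<in> cspace n"
      by (auto simp: chyperplane_def cinner_def)
    define c where "c m = z (Suc m) + of_real (\<alpha> (Suc m) / (1 - \<alpha> 0)) * z 0" for m
    define x where "x i = (if even i then Re (c (i div 2)) else Im (c (i div 2)))" for i :: nat
    have "real_lincomb n (2 * (n - 1)) b x l = z l" for l
    proof (cases "l < n")
      case True
      have "real_lincomb n (2 * (n - 1)) b x l = (\<Sum>m<n - 1. c m * of_real (householder \<alpha> (Suc m) l))"
        unfolding real_lincomb_def sum_lessThan_double using True
        by (auto intro!: sum.cong simp: x_def b_def u_def complex_eq_iff algebra_simps)
      then show ?thesis using householder_span[OF z0 True] by (simp add: c_def)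
    next
      case False
      then show ?thesis using zc by (auto simp: real_lincomb_def cspace_def PiE_def extensional_def)
    qed
    then show "z \<in> range (real_lincomb n (2 * (n - 1)) b)" by (metis ext rangeI)
  next
    fix z assume "z \<in> range (real_lincomb n (2 * (n - 1)) b)"
    then obtain x where x: "z = real_lincomb n (2 * (n - 1)) b x" by auto
    have "(\<Sum>l<n. z l * of_real (\<alpha> l))
        = (\<Sum>l<n. \<Sum>i<2 * (n - 1). of_real (x i) * u i * of_real (householder \<alpha> (Suc (i div 2)) l * \<alpha> l))"
      by (intro sum.cong refl) (simp add: x real_lincomb_def b_def sum_distrib_right scaleR_conv_of_real mult.assoc)
    also have "\<dots> = (\<Sum>i<2 * (n - 1). of_real (x i) * u i * of_real (\<Sum>l<n. householder \<alpha> (Suc (i div 2)) l * \<alpha> l))"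
      unfolding of_real_sum sum_distrib_left by (rule sum.swap)
    also have "\<dots> = 0" using householder_orthogonal idx by (intro sum.neutral) auto
    finally show "z \<in> ?H"
      by (simp add: chyperplane_def cinner_def) (simp add: x real_lincomb_def cspace_def)
  qed
  ultimately show ?thesis
    by (intro exI[of _ b]) (auto simp: real_onb_def b_def cspace_def)
qed

end

subsection \<open>Section volumes as limits of Gaussian averages\<close>

text \<open>Homogeneity of degree \<open>p\<close> in real dimension D makes the volume of a
  sublevel set grow like the power D / p of the level. This trades the volume of a body for an
  exponential integral, which factorises over coordinates when \<open>N\<close> is a sum.\<close>

lemma nn_integral_exp_homogeneous:
  fixes N :: "(nat \<Rightarrow> 'a :: euclidean_space) \<Rightarrow> real"
  defines "M \<equiv> \<lambda>d. Pi\<^sub>M {..<d} (\<lambda>_. lborel :: 'a measure)"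
  assumes [measurable]: "N \<in> borel_measurable (M d)" and N: "\<And>x. 0 \<le> N x" and d: "0 < d" and p: "0 < p"
    and hom: "\<And>r x. 0 < r \<Longrightarrow> N (\<lambda>i\<in>{..<d}. r *\<^sub>R x i) = r powr p * N x"
    and fin: "(\<integral>\<^sup>+ x. ennreal (exp (- N x)) \<partial>M d) < \<infinity>"
  shows "(\<integral>\<^sup>+ x. ennreal (exp (- N x)) \<partial>M d)
       = ennreal (measure (M d) {x \<in> space (M d). N x \<le> 1} * Gamma (1 + real (DIM('a) * d) / p))"
proof (rule nn_integral_exp_of_powr_volume)
  \<comment> \<open>\<open>measure\<close> sends infinite volume to 0, so finiteness of the unit
    sublevel set has to be secured first; on that set
    \<open>1 \<le> exp 1 * exp (- N x)\<close>.\<close>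
  have "emeasure (M d) {x \<in> space (M d). N x \<le> 1}
      \<le> (\<integral>\<^sup>+ x. ennreal (exp 1) * ennreal (exp (- N x)) \<partial>M d)"
  proof -
    have "emeasure (M d) {x \<in> space (M d). N x \<le> 1} = (\<integral>\<^sup>+ x. indicator {x \<in> space (M d). N x \<le> 1} x \<partial>M d)"
      by simp
    also have "\<dots> \<le> (\<integral>\<^sup>+ x. ennreal (exp 1) * ennreal (exp (- N x)) \<partial>M d)"
      by (intro nn_integral_mono) (auto simp: indicator_def ennreal_mult[symmetric] exp_add[symmetric] simp flip: ennreal_1 intro!: ennreal_leI)
    finally show ?thesis .
  qed
  also have "\<dots> < \<infinity>" using fin by (simp add: nn_integral_cmult ennreal_mult_less_top)
  finally have V: "emeasure (M d) {x \<in> space (M d). N x \<le> 1} = ennreal (measure (M d) {x \<in> space (M d). N x \<le> 1})"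
    by (simp add: measure_def)
  fix t :: real assume t: "0 < t"
  define r where "r = t powr (1 / p)"
  have r: "0 < r" and rp: "r powr p = t" using t p by (auto simp: r_def powr_powr)
  define f :: "(nat \<Rightarrow> 'a) \<Rightarrow> ennreal" where "f = indicator {x \<in> space (M d). N x \<le> t}"
  have f[measurable]: "f \<in> borel_measurable (M d)" unfolding f_def by measurable
  have "emeasure (M d) {x \<in> space (M d). N x \<le> 1} = (\<integral>\<^sup>+ x. f (\<lambda>i\<in>{..<d}. r *\<^sub>R x i) \<partial>M d)"
  proof -
    have "f (\<lambda>i\<in>{..<d}. r *\<^sub>R x i) = indicator {x \<in> space (M d). N x \<le> 1} x" if "x \<in> space (M d)" for x
      using that t by (simp add: f_def indicator_def M_def space_PiM hom[OF r] rp)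
    then have "(\<integral>\<^sup>+ x. f (\<lambda>i\<in>{..<d}. r *\<^sub>R x i) \<partial>M d) = (\<integral>\<^sup>+ x. indicator {x \<in> space (M d). N x \<le> 1} x \<partial>M d)"
      by (intro nn_integral_cong) auto
    then show ?thesis by simp
  qed
  also have "\<dots> = ennreal (1 / r ^ (DIM('a) * d)) * emeasure (M d) {x \<in> space (M d). N x \<le> t}"
  proof -
    have "M d = Pi\<^sub>M {..<d} (\<lambda>_. lborel)" by (simp add: M_def)
    then have "(\<integral>\<^sup>+ x. f (\<lambda>i\<in>{..<d}. r *\<^sub>R x i) \<partial>M d) = ennreal (1 / r ^ (DIM('a) * d)) * (\<integral>\<^sup>+ x. f x \<partial>M d)"
      using nn_integral_PiM_lborel_scale[of "{..<d}" f r] f r by simp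
    then show ?thesis by (simp add: f_def)
  qed
  finally have e: "ennreal (r ^ (DIM('a) * d)) * emeasure (M d) {x \<in> space (M d). N x \<le> 1}
      = emeasure (M d) {x \<in> space (M d). N x \<le> t}"
    using r by (simp add: mult.assoc[symmetric] ennreal_mult[symmetric])
  have "r ^ (DIM('a) * d) = t powr (real (DIM('a) * d) / p)"
    using r t unfolding powr_realpow[OF r, symmetric] by (simp add: r_def powr_powr)
  then show "emeasure (M d) {x \<in> space (M d). N x \<le> t}
      = ennreal (t powr (real (DIM('a) * d) / p) * measure (M d) {x \<in> space (M d). N x \<le> 1})"
    using e V by (simp add: ennreal_mult)
qed (use d p N in auto)

section \<open>Volume of the complex unit ball\<close>

definition lp_power :: "nat \<Rightarrow> real \<Rightarrow> (nat \<Rightarrow> complex) \<Rightarrow> real" where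
  "lp_power n p z = (\<Sum>j<n. cmod (z j) powr p)"

lemma lp_power_nonneg: "0 \<le> lp_power n p z"
  by (simp add: lp_power_def sum_nonneg)

lemma measurable_lp_power[measurable]:
  "lp_power n p \<in> borel_measurable (Pi\<^sub>M {..<n} (\<lambda>_. lborel))"
  unfolding lp_power_def by measurable

text \<open>The integral of \<open>exp (- \<bar>z\<bar>\<^sup>p)\<close> over \<open>\<complex>\<close>.\<close>

definition disc_const :: "real \<Rightarrow> real" where
  "disc_const p = pi * Gamma (1 + 2 / p)"

lemma disc_const_pos: "0 < p \<Longrightarrow> 0 < disc_const p"
  by (auto simp: disc_const_def intro!: mult_pos_pos Gamma_real_pos add_pos_pos)

lemma nn_integral_exp_cmod_powr:
  assumes "0 < p"
  shows "(\<integral>\<^sup>+ z. ennreal (exp (- (cmod z powr p))) \<partial>lborel) = ennreal (disc_const p)"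
  unfolding disc_const_def
  by (rule nn_integral_exp_of_powr_volume) (use assms emeasure_cmod_powr_le[of p] in auto)

lemma exp_lp_power: "exp (- lp_power n p z) = (\<Prod>j<n. exp (- (cmod (z j) powr p)))"
  by (simp add: lp_power_def exp_sum sum_negf[symmetric])

lemma nn_integral_exp_lp_power:
  assumes "0 < p"
  shows "(\<integral>\<^sup>+ z. ennreal (exp (- lp_power n p z)) \<partial>Pi\<^sub>M {..<n} (\<lambda>_. lborel)) = ennreal (disc_const p ^ n)"
proof -
  interpret product_sigma_finite "\<lambda>_::nat. lborel :: complex measure" by standard
  have "(\<integral>\<^sup>+ z. ennreal (exp (- lp_power n p z)) \<partial>Pi\<^sub>M {..<n} (\<lambda>_. lborel))
      = (\<integral>\<^sup>+ z. (\<Prod>j<n. ennreal (exp (- (cmod (z j) powr p)))) \<partial>Pi\<^sub>M {..<n} (\<lambda>_. lborel))"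
    by (simp add: exp_lp_power prod_ennreal)
  also have "\<dots> = (\<Prod>j<n. \<integral>\<^sup>+ z. ennreal (exp (- (cmod z powr p))) \<partial>lborel)"
    by (rule product_nn_integral_prod) auto
  also have "\<dots> = ennreal (disc_const p ^ n)"
    using disc_const_pos[OF assms] by (simp add: nn_integral_exp_cmod_powr[OF assms] ennreal_power)
  finally show ?thesis .
qed

text \<open>Dirichlet's volume formula, multiplied out so that the Gamma factor can later be
  cancelled against the one of the section.\<close>

lemma cspace_vol_lp_ball:
  assumes "0 < p" "0 < m"
  shows "cspace_vol m (lp_ball m p) * Gamma (1 + real (2 * m) / p) = disc_const p ^ m"
proof -
  let ?M = "Pi\<^sub>M {..<m} (\<lambda>_. lborel :: complex measure)"
  have "ennreal (disc_const p ^ m)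
      = ennreal (measure ?M {x \<in> space ?M. lp_power m p x \<le> 1} * Gamma (1 + real (2 * m) / p))"
    unfolding nn_integral_exp_lp_power[OF assms(1), symmetric]
    by (subst nn_integral_exp_homogeneous[where p=p])
      (use assms nn_integral_exp_lp_power[OF assms(1), of m] in
        \<open>auto simp: lp_power_nonneg lp_power_def powr_mult sum_distrib_left intro!: sum_nonneg\<close>)
  moreover have "{x \<in> space ?M. lp_power m p x \<le> 1} = lp_ball m p"
    by (auto simp: lp_ball_def lp_power_def space_PiM_cspace)
  ultimately show ?thesis
    using disc_const_pos[OF assms(1)] assms
    by (subst (asm) ennreal_inj)
      (auto simp: cspace_vol_def intro!: mult_nonneg_nonneg less_imp_le[OF Gamma_real_pos] add_pos_nonneg)
qed

text \<open>The planar Gaussian density with variance \<open>\<delta>\<^sup>2\<close> in each real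
  coordinate, an approximation of the point mass at the origin.\<close>

definition gauss_kernel :: "real \<Rightarrow> complex \<Rightarrow> real" where
  "gauss_kernel \<delta> w = exp (- (cmod w)\<^sup>2 / (2 * \<delta>\<^sup>2)) / (2 * pi * \<delta>\<^sup>2)"

lemma gauss_kernel_nonneg: "0 \<le> gauss_kernel \<delta> w"
  by (simp add: gauss_kernel_def)

lemma measurable_gauss_kernel[measurable]: "gauss_kernel \<delta> \<in> borel_measurable borel"
  unfolding gauss_kernel_def[abs_def] by measurable

lemma gauss_kernel_scale: "0 < \<delta> \<Longrightarrow> gauss_kernel \<delta> (\<delta> *\<^sub>R w) = gauss_kernel 1 w / \<delta>\<^sup>2"
  by (simp add: gauss_kernel_def power_mult_distrib)

text \<open>Moves \<delta> from the kernel into the argument of \<open>f\<close>, so that the kernel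
  stays fixed in the later dominated convergence.\<close>

lemma nn_integral_gauss_kernel_scale:
  assumes [measurable]: "f \<in> borel_measurable borel" and \<delta>: "0 < \<delta>"
  shows "(\<integral>\<^sup>+ w. f w * ennreal (gauss_kernel \<delta> w) \<partial>lborel)
       = (\<integral>\<^sup>+ w. f (\<delta> *\<^sub>R w) * ennreal (gauss_kernel 1 w) \<partial>lborel)"
proof -
  have "(\<integral>\<^sup>+ w. f (\<delta> *\<^sub>R w) * ennreal (gauss_kernel 1 w) \<partial>lborel)
      = (\<integral>\<^sup>+ w. ennreal (\<delta>\<^sup>2) * (f (\<delta> *\<^sub>R w) * ennreal (gauss_kernel \<delta> (\<delta> *\<^sub>R w))) \<partial>lborel)"
  proof (rule nn_integral_cong)
    fix w
    have "ennreal (gauss_kernel 1 w) = ennreal (\<delta>\<^sup>2) * ennreal (gauss_kernel \<delta> (\<delta> *\<^sub>R w))"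
      using \<delta> gauss_kernel_nonneg[of 1 w] by (simp add: gauss_kernel_scale ennreal_mult[symmetric])
    then show "f (\<delta> *\<^sub>R w) * ennreal (gauss_kernel 1 w)
        = ennreal (\<delta>\<^sup>2) * (f (\<delta> *\<^sub>R w) * ennreal (gauss_kernel \<delta> (\<delta> *\<^sub>R w)))"
      by (simp add: mult_ac)
  qed
  also have "\<dots> = ennreal (\<delta>\<^sup>2) * (\<integral>\<^sup>+ w. f (0 + \<delta> *\<^sub>R w) * ennreal (gauss_kernel \<delta> (0 + \<delta> *\<^sub>R w)) \<partial>lborel)"
    by (simp add: nn_integral_cmult)
  also have "\<dots> = ennreal (\<delta>\<^sup>2) * (ennreal (1 / \<delta>\<^sup>2) * (\<integral>\<^sup>+ w. f w * ennreal (gauss_kernel \<delta> w) \<partial>lborel))"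
    using \<delta> by (subst nn_integral_lborel_affine[where f="\<lambda>w. f w * ennreal (gauss_kernel \<delta> w)"]) auto
  also have "\<dots> = (\<integral>\<^sup>+ w. f w * ennreal (gauss_kernel \<delta> w) \<partial>lborel)"
    using \<delta> by (simp add: mult.assoc[symmetric] ennreal_mult[symmetric])
  finally show ?thesis by simp
qed

lemma nn_integral_gauss_kernel:
  assumes "0 < \<delta>"
  shows "(\<integral>\<^sup>+ w. ennreal (gauss_kernel \<delta> w) \<partial>lborel) = 1"
proof -
  have "(\<integral>\<^sup>+ w. ennreal (gauss_kernel \<delta> w) \<partial>lborel)
      = (\<integral>\<^sup>+ w. ennreal (1 / (2 * pi * \<delta>\<^sup>2)) * ennreal (exp (- (1 / (2 * \<delta>\<^sup>2)) * (cmod w)\<^sup>2)) \<partial>lborel)"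
    by (intro nn_integral_cong) (simp add: gauss_kernel_def ennreal_mult[symmetric])
  also have "\<dots> = ennreal (1 / (2 * pi * \<delta>\<^sup>2)) * ennreal (pi / (1 / (2 * \<delta>\<^sup>2)))"
    using assms nn_integral_gauss_complex[of "1 / (2 * \<delta>\<^sup>2)"] by (subst nn_integral_cmult) auto
  also have "\<dots> = 1" using assms by (simp add: ennreal_mult[symmetric] field_simps)
  finally show ?thesis .
qed

text \<open>Summed over the coordinates, this bounds \<open>exp (- lp_power n p z)\<close> by a
  Gaussian, which stays explicit after an orthogonal splitting.\<close>

lemma cmod_powr_ge: "2 \<le> p \<Longrightarrow> cmod z powr p \<ge> (cmod z)\<^sup>2 - 1"
proof (cases "cmod z \<le> 1")
  case True
  then show ?thesis by (smt (verit) norm_ge_zero powr_ge_zero power_le_one)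
next
  case False
  assume "2 \<le> p"
  with False have "cmod z powr 2 \<le> cmod z powr p" by (intro powr_mono) auto
  then show ?thesis using False by simp
qed

text \<open>The kernel in the coordinate along \<open>a\<close> concentrates the integral on the
  hyperplane. After splitting along \<open>a\<close> and rescaling \<open>w\<close>, dominated
  convergence leaves the integral of \<open>exp (- lp_power n p z)\<close> over the hyperplane, and
  homogeneity in real dimension \<open>2 * (n - 1)\<close> turns it into the section volume.\<close>

lemma section_volume_limit:
  assumes n: "2 \<le> n" and p: "2 \<le> p" and \<delta>: "\<And>m. 0 < \<delta> m" "\<delta> \<longlonglongrightarrow> 0"
    and ex: "\<exists>b. real_onb n (2 * (n - 1)) (chyperplane n a) b" and a: "rinner n a a = 1" "a \<in> cspace n"
  shows "(\<lambda>m. \<integral>\<^sup>+ z. ennreal (exp (- lp_power n p z) * gauss_kernel (\<delta> m) (cinner n z a)) \<partial>Pi\<^sub>M {..<n} (\<lambda>_. lborel))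
    \<longlonglongrightarrow> ennreal (subspace_vol n (2 * (n - 1)) (chyperplane n a) (chyperplane n a \<inter> lp_ball n p)
            * Gamma (1 + real (2 * (n - 1)) / p))"
proof -
  define k where "k = 2 * (n - 1)"
  have k: "0 < k" using n by (simp add: k_def)
  let ?M = "Pi\<^sub>M {..<n} (\<lambda>_. lborel :: complex measure)"
  let ?K = "Pi\<^sub>M {..<k} (\<lambda>_. lborel :: real measure)"
  \<comment> \<open>The very basis that \<open>subspace_vol\<close> selects; \<open>ex\<close>
    ensures that the choice does yield a basis.\<close>
  define b where "b = (SOME b. real_onb n k (chyperplane n a) b)"
  have onb: "real_onb n k (chyperplane n a) b" unfolding b_def unfolding k_def by (rule someI_ex[OF ex])
  interpret R: product_sigma_finite "\<lambda>_::nat. lborel :: real measure" by standard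
  interpret K: sigma_finite_measure ?K by (rule R.sigma_finite) simp
  let ?\<Psi> = "split_along n k b a"
  let ?u = "\<lambda>m x w. ennreal (exp (- lp_power n p (?\<Psi> x (\<delta> m *\<^sub>R w)))) * ennreal (gauss_kernel 1 w)"
  define S where "S x = real_lincomb n k b x" for x
  note [measurable] = measurable_split_along[OF onb a]
  have S_meas[measurable]: "S \<in> ?K \<rightarrow>\<^sub>M ?M"
    unfolding S_def real_lincomb_def by (intro measurable_restrict) measurable
  have [measurable]: "(\<lambda>z. cinner n z a) \<in> borel_measurable ?M"
    unfolding cinner_def by measurable
  \<comment> \<open>The squared modulus of \<open>w\<close> is discarded, so the bound is uniform in
    \<delta>. Integrability in \<open>w\<close> comes from the fixed kernel
    \<open>gauss_kernel 1\<close>.\<close>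
  have bound: "exp (- lp_power n p (?\<Psi> x w)) \<le> exp (real n) * exp (- (\<Sum>i<k. (x i)\<^sup>2))" for x w
  proof -
    have "(\<Sum>i<k. (x i)\<^sup>2) - real n \<le> (\<Sum>j<n. (cmod (?\<Psi> x w j))\<^sup>2 - 1)"
      unfolding sum_subtractf norm_split_along[OF onb a] by simp
    also have "\<dots> \<le> lp_power n p (?\<Psi> x w)"
      unfolding lp_power_def by (intro sum_mono cmod_powr_ge p)
    finally show ?thesis by (simp add: exp_add[symmetric])
  qed
  define W :: "(nat \<Rightarrow> real) \<Rightarrow> ennreal" where "W x = ennreal (exp (real n) * exp (- (\<Sum>i<k. (x i)\<^sup>2)))" for x
  have [measurable]: "W \<in> borel_measurable ?K" unfolding W_def by measurable
  have W_fin: "(\<integral>\<^sup>+ x. W x \<partial>?K) < \<infinity>"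
  proof -
    have "(\<integral>\<^sup>+ x. W x \<partial>?K) = (\<integral>\<^sup>+ x. ennreal (exp (real n)) * (\<Prod>i<k. ennreal (exp (- 1 * (x i)\<^sup>2))) \<partial>?K)"
      by (intro nn_integral_cong) (simp add: W_def prod_ennreal ennreal_mult[symmetric] prod_nonneg exp_sum sum_negf[symmetric])
    also have "\<dots> = ennreal (exp (real n)) * (\<Prod>i<k. \<integral>\<^sup>+ x. ennreal (exp (- 1 * x\<^sup>2)) \<partial>lborel)"
      by (subst nn_integral_cmult, measurable, subst R.product_nn_integral_prod) auto
    also have "\<dots> < \<infinity>"
      unfolding nn_integral_gauss_real[OF zero_less_one] by (simp add: ennreal_power ennreal_mult[symmetric])
    finally show ?thesis .
  qed
  have eq: "(\<integral>\<^sup>+ z. ennreal (exp (- lp_power n p z) * gauss_kernel (\<delta> m) (cinner n z a)) \<partial>?M)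
      = (\<integral>\<^sup>+ (x, w). ?u m x w \<partial>(?K \<Otimes>\<^sub>M lborel))" for m
  proof -
    have "(\<integral>\<^sup>+ z. ennreal (exp (- lp_power n p z) * gauss_kernel (\<delta> m) (cinner n z a)) \<partial>?M)
        = (\<integral>\<^sup>+ x. (\<integral>\<^sup>+ w. ennreal (exp (- lp_power n p (?\<Psi> x w))) * ennreal (gauss_kernel (\<delta> m) w) \<partial>lborel) \<partial>?K)"
    proof -
      have "(\<lambda>z. ennreal (exp (- lp_power n p z) * gauss_kernel (\<delta> m) (cinner n z a))) \<in> borel_measurable ?M"
        by measurable
      from nn_integral_split_along[OF onb a this] show ?thesis
        unfolding cinner_split_along[OF onb a]
        by (simp add: ennreal_mult gauss_kernel_nonneg)
    qed
    also have "\<dots> = (\<integral>\<^sup>+ x. (\<integral>\<^sup>+ w. ?u m x w \<partial>lborel) \<partial>?K)"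
    proof (rule nn_integral_cong)
      fix x assume "x \<in> space ?K"
      from measurable_compose[OF measurable_Pair1'[OF this] measurable_split_along[OF onb a]]
      have [measurable]: "(\<lambda>w. ?\<Psi> x w) \<in> borel \<rightarrow>\<^sub>M ?M" by simp
      show "(\<integral>\<^sup>+ w. ennreal (exp (- lp_power n p (?\<Psi> x w))) * ennreal (gauss_kernel (\<delta> m) w) \<partial>lborel)
          = (\<integral>\<^sup>+ w. ?u m x w \<partial>lborel)"
        by (rule nn_integral_gauss_kernel_scale[OF _ \<delta>(1)]) measurable
    qed
    also have "\<dots> = (\<integral>\<^sup>+ (x, w). ?u m x w \<partial>(?K \<Otimes>\<^sub>M lborel))"
      by (subst lborel.nn_integral_fst[symmetric]) auto
    finally show ?thesis .
  qed
  have lim: "(\<lambda>m. \<integral>\<^sup>+ (x, w). ?u m x w \<partial>(?K \<Otimes>\<^sub>M lborel))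
      \<longlonglongrightarrow> (\<integral>\<^sup>+ (x, w). ennreal (exp (- lp_power n p (S x))) * ennreal (gauss_kernel 1 w) \<partial>(?K \<Otimes>\<^sub>M lborel))"
  proof (rule nn_integral_dominated_convergence)
    show "AE q in ?K \<Otimes>\<^sub>M lborel. (case q of (x, w) \<Rightarrow> ?u m x w)
        \<le> (case q of (x, w) \<Rightarrow> W x * ennreal (gauss_kernel 1 w))" for m
      by (intro AE_I2) (auto simp: W_def intro!: mult_right_mono ennreal_leI bound)
    have "(\<integral>\<^sup>+ q. (case q of (x, w) \<Rightarrow> W x * ennreal (gauss_kernel 1 w)) \<partial>(?K \<Otimes>\<^sub>M lborel)) = (\<integral>\<^sup>+ x. W x \<partial>?K)"
      by (subst lborel.nn_integral_fst[symmetric]) (auto simp: nn_integral_cmult nn_integral_gauss_kernel)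
    then show "(\<integral>\<^sup>+ q. (case q of (x, w) \<Rightarrow> W x * ennreal (gauss_kernel 1 w)) \<partial>(?K \<Otimes>\<^sub>M lborel)) < \<infinity>"
      using W_fin by simp
    have "(\<lambda>m. lp_power n p (?\<Psi> x (\<delta> m *\<^sub>R w))) \<longlonglongrightarrow> lp_power n p (S x)" for x w
      unfolding lp_power_def
    proof (rule tendsto_sum)
      fix j assume "j \<in> {..<n}"
      then have j: "?\<Psi> x (\<delta> m *\<^sub>R w) j = S x j + \<delta> m *\<^sub>R w * a j" for m
        by (simp add: split_along_def S_def real_lincomb_def)
      have "(\<lambda>m. S x j + \<delta> m *\<^sub>R w * a j) \<longlonglongrightarrow> S x j + 0 *\<^sub>R w * a j"
        by (intro tendsto_intros \<delta>)
      then have "(\<lambda>m. cmod (S x j + \<delta> m *\<^sub>R w * a j)) \<longlonglongrightarrow> cmod (S x j)"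
        using tendsto_norm by fastforce
      then show "(\<lambda>m. cmod (?\<Psi> x (\<delta> m *\<^sub>R w) j) powr p) \<longlonglongrightarrow> cmod (S x j) powr p"
        unfolding j using p by (intro tendsto_powr') auto
    qed
    then show "AE q in ?K \<Otimes>\<^sub>M lborel. (\<lambda>m. case q of (x, w) \<Rightarrow> ?u m x w)
        \<longlonglongrightarrow> (case q of (x, w) \<Rightarrow> ennreal (exp (- lp_power n p (S x))) * ennreal (gauss_kernel 1 w))"
      by (intro AE_I2) (auto simp: ennreal_mult[symmetric] gauss_kernel_nonneg intro!: tendsto_intros tendsto_ennrealI)
  qed measurable
  have int: "(\<integral>\<^sup>+ (x, w). ennreal (exp (- lp_power n p (S x))) * ennreal (gauss_kernel 1 w) \<partial>(?K \<Otimes>\<^sub>M lborel))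
      = (\<integral>\<^sup>+ x. ennreal (exp (- lp_power n p (S x))) \<partial>?K)"
    by (subst lborel.nn_integral_fst[symmetric]) (auto simp: nn_integral_cmult nn_integral_gauss_kernel)
  have "(\<integral>\<^sup>+ x. ennreal (exp (- lp_power n p (S x))) \<partial>?K)
      = ennreal (measure ?K {x \<in> space ?K. lp_power n p (S x) \<le> 1} * Gamma (1 + real (DIM(real) * k) / p))"
  proof (rule nn_integral_exp_homogeneous)
    show "lp_power n p (S (\<lambda>i\<in>{..<k}. r *\<^sub>R x i)) = r powr p * lp_power n p (S x)" if "0 < r" for r x
    proof -
      have "S (\<lambda>i\<in>{..<k}. r *\<^sub>R x i) j = r *\<^sub>R S x j" if "j < n" for j
        using that by (simp add: S_def real_lincomb_def scaleR_sum_right)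
      then show ?thesis using that by (simp add: lp_power_def powr_mult sum_distrib_left)
    qed
    have "(\<integral>\<^sup>+ x. ennreal (exp (- lp_power n p (S x))) \<partial>?K) \<le> (\<integral>\<^sup>+ x. W x \<partial>?K)"
      unfolding W_def S_def split_along_0[of n k b a, symmetric]
      by (intro nn_integral_mono ennreal_leI bound)
    then show "(\<integral>\<^sup>+ x. ennreal (exp (- lp_power n p (S x))) \<partial>?K) < \<infinity>"
      using W_fin by (rule order.strict_trans1)
  qed (use k p lp_power_nonneg in auto)
  moreover have "{x \<in> {..<k} \<rightarrow>\<^sub>E UNIV. real_lincomb n k b x \<in> chyperplane n a \<inter> lp_ball n p}
      = {x \<in> space ?K. lp_power n p (S x) \<le> 1}"
    using onb by (auto simp: real_onb_def space_PiM S_def lp_ball_def lp_power_def real_lincomb_def cspace_def)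
  ultimately show ?thesis
    using lim unfolding eq int subspace_vol_def Let_def k_def[symmetric] b_def[symmetric] by simp
qed

subsection \<open>Fourier transform of the Gaussian kernel\<close>

text \<open>The rotated measure is again translation invariant, a shift by \<open>y\<close> being a
  shift by \<open>y / u\<close> before the rotation, and a rotation fixes the Gaussian. Uniqueness
  does the rest.\<close>

lemma distr_rotate_lborel:
  assumes u: "cmod u = 1"
  shows "distr lborel borel (\<lambda>z. u * z) = (lborel :: complex measure)"
proof (rule measure_eqI)
  let ?N = "distr lborel borel (\<lambda>z. u * z) :: complex measure"
  have u0: "u \<noteq> 0" using u by auto
  have nn_N: "(\<integral>\<^sup>+ z. h z \<partial>?N) = (\<integral>\<^sup>+ z. h (u * z) \<partial>lborel)" if "h \<in> borel_measurable borel" for h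
    by (rule nn_integral_distr) (use that in auto)
  define g :: "complex \<Rightarrow> ennreal" where "g z = ennreal (exp (- pi * (cmod z)\<^sup>2))" for z
  have [measurable]: "g \<in> borel_measurable borel" unfolding g_def by measurable
  have g1: "(\<integral>\<^sup>+ z. g z \<partial>lborel) = 1"
    unfolding g_def nn_integral_gauss_complex[OF pi_gt_zero] by simp
  have gN: "(\<integral>\<^sup>+ z. g z \<partial>?N) = 1"
    using g1 by (subst nn_N) (auto simp: g_def norm_mult u)
  fix A assume "A \<in> sets ?N"
  then have A: "A \<in> sets borel" by simp
  have "(\<integral>\<^sup>+ z. indicator A z \<partial>lborel) = (\<integral>\<^sup>+ z. indicator A z \<partial>?N)"
  proof (rule nn_integral_unique_of_translation_invariant[where g=g and add="(+)" and sub="(-)"])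
    show "sigma_finite_measure ?N"
      by (rule sigma_finite_measure_of_positive_integrable[where g=g]) (auto simp: gN, simp add: g_def)
    show "(\<integral>\<^sup>+ x. h (x + y) \<partial>lborel) = (\<integral>\<^sup>+ x. h x \<partial>lborel)" if "h \<in> borel_measurable lborel" for y h
      using nn_integral_lborel_affine[of h 1 y] that by (simp add: add.commute)
    show "(\<integral>\<^sup>+ x. h (x - y) \<partial>?N) = (\<integral>\<^sup>+ x. h x \<partial>?N)" if "h \<in> borel_measurable lborel" for y h
    proof -
      have [measurable]: "h \<in> borel_measurable borel" using that by simp
      have "(\<integral>\<^sup>+ x. h (x - y) \<partial>?N) = (\<integral>\<^sup>+ x. h (u * (- (y / u) + 1 *\<^sub>R x)) \<partial>lborel)"
        using u0 by (subst nn_N) (auto simp: algebra_simps)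
      also have "\<dots> = (\<integral>\<^sup>+ x. h (u * x) \<partial>lborel)"
        using nn_integral_lborel_affine[of "\<lambda>x. h (u * x)" 1 "- (y / u)"] by simp
      finally show ?thesis by (simp add: nn_N)
    qed
    show "g (y - (x + y)) = g x" for x y by (simp add: g_def)
  qed (use A in \<open>auto simp: gN g1 sigma_finite_lborel\<close>)
  then show "emeasure ?N A = emeasure lborel A" using A by simp
qed simp

lemma integral_rotate:
  fixes h :: "complex \<Rightarrow> 'a :: {banach, second_countable_topology}"
  assumes "cmod u = 1" "h \<in> borel_measurable borel"
  shows "(\<integral>z. h (u * z) \<partial>lborel) = (\<integral>z. h z \<partial>lborel)"
  using assms by (subst (2) distr_rotate_lborel[OF assms(1), symmetric]) (simp add: integral_distr)

text \<open>The integrand is dominated by the product of the norms of \<open>f\<close> and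
  \<open>g\<close>. In the applications \<open>c\<close> is a character \<open>cis\<close> of a
  scalar product, and one of the two functions carries the Gaussian weight.\<close>

lemma Fubini_bounded_kernel:
  fixes f :: "'a \<Rightarrow> real" and g :: "'b \<Rightarrow> real" and c :: "'a \<Rightarrow> 'b \<Rightarrow> complex"
  assumes sf: "sigma_finite_measure M" "sigma_finite_measure N"
    and f: "integrable M f" and g: "integrable N g"
    and c[measurable]: "(\<lambda>(x, y). c x y) \<in> borel_measurable (M \<Otimes>\<^sub>M N)" and c1: "\<And>x y. norm (c x y) \<le> 1"
  shows "(\<integral>x. of_real (f x) * (\<integral>y. of_real (g y) * c x y \<partial>N) \<partial>M)
       = (\<integral>y. of_real (g y) * (\<integral>x. of_real (f x) * c x y \<partial>M) \<partial>N)"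
    and "integrable M (\<lambda>x. of_real (f x) * (\<integral>y. of_real (g y) * c x y \<partial>N))"
proof -
  interpret M: sigma_finite_measure M by fact
  interpret N: sigma_finite_measure N by fact
  interpret P: pair_sigma_finite M N ..
  note [measurable] = borel_measurable_integrable[OF f] borel_measurable_integrable[OF g]
  define h where "h = (\<lambda>(x, y). of_real (f x) * (of_real (g y) * c x y))"
  have [measurable]: "h \<in> borel_measurable (M \<Otimes>\<^sub>M N)" unfolding h_def by measurable
  have int: "integrable (M \<Otimes>\<^sub>M N) h"
  proof (rule integrableI_bounded)
    have "(\<integral>\<^sup>+ q. ennreal (norm (h q)) \<partial>(M \<Otimes>\<^sub>M N))
        \<le> (\<integral>\<^sup>+ q. ennreal (norm (f (fst q))) * ennreal (norm (g (snd q))) \<partial>(M \<Otimes>\<^sub>M N))"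
    proof (rule nn_integral_mono)
      fix q :: "'a \<times> 'b"
      have "norm (h q) \<le> norm (f (fst q)) * (norm (g (snd q)) * 1)"
        unfolding h_def by (cases q) (auto simp: norm_mult intro!: mult_left_mono c1 simp del: mult_1_right)
      then show "ennreal (norm (h q)) \<le> ennreal (norm (f (fst q))) * ennreal (norm (g (snd q)))"
        by (simp add: ennreal_mult[symmetric] ennreal_leI)
    qed
    also have "\<dots> = (\<integral>\<^sup>+ x. ennreal (norm (f x)) \<partial>M) * (\<integral>\<^sup>+ y. ennreal (norm (g y)) \<partial>N)"
      by (subst N.nn_integral_fst[symmetric]) (auto simp: nn_integral_cmult nn_integral_multc)
    also have "\<dots> < \<infinity>"
      using f g by (simp add: integrable_iff_bounded ennreal_mult_less_top)
    finally show "(\<integral>\<^sup>+ q. ennreal (norm (h q)) \<partial>(M \<Otimes>\<^sub>M N)) < \<infinity>" .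
  qed simp
  have int': "integrable (M \<Otimes>\<^sub>M N) (\<lambda>(x, y). of_real (f x) * (of_real (g y) * c x y))"
    using int by (simp add: h_def)
  have eq: "(\<integral>y. of_real (f x) * (of_real (g y) * c x y) \<partial>N) = of_real (f x) * (\<integral>y. of_real (g y) * c x y \<partial>N)" for x
    by simp
  show "integrable M (\<lambda>x. of_real (f x) * (\<integral>y. of_real (g y) * c x y \<partial>N))"
    using P.integrable_fst[OF int'] by (simp only: eq)
  have "(\<integral>x. of_real (f x) * (\<integral>y. of_real (g y) * c x y \<partial>N) \<partial>M)
      = (\<integral>y. (\<integral>x. of_real (f x) * (of_real (g y) * c x y) \<partial>M) \<partial>N)"
    using P.Fubini_integral[OF int'] by (simp only: eq)
  also have "\<dots> = (\<integral>y. (\<integral>x. of_real (g y) * (of_real (f x) * c x y) \<partial>M) \<partial>N)"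
    by (simp only: mult.left_commute)
  also have "\<dots> = (\<integral>y. of_real (g y) * (\<integral>x. of_real (f x) * c x y \<partial>M) \<partial>N)"
    by simp
  finally show "(\<integral>x. of_real (f x) * (\<integral>y. of_real (g y) * c x y \<partial>N) \<partial>M)
       = (\<integral>y. of_real (g y) * (\<integral>x. of_real (f x) * c x y \<partial>M) \<partial>N)" .
qed

lemma measurable_cis[measurable]: "cis \<in> borel_measurable borel"
  by (intro borel_measurable_continuous_onI continuous_intros)

lemma measurable_Complex[measurable]:
  "(\<lambda>q. Complex (fst q) (snd q)) \<in> borel_measurable borel"
  by (auto simp: Complex_eq intro!: borel_measurable_continuous_onI continuous_intros)

lemma integrable_complex_lborel_iff:
  "integrable (lborel :: complex measure) f \<longleftrightarrow> integrable (lborel \<Otimes>\<^sub>M lborel) (\<lambda>(x, y). f (Complex x y))"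
  if [measurable]: "f \<in> borel_measurable borel" for f :: "complex \<Rightarrow> 'a :: {banach, second_countable_topology}"
proof -
  have [measurable]: "(\<lambda>(x, y). Complex x y) \<in> borel_measurable borel"
    using measurable_Complex by (simp add: case_prod_beta')
  show ?thesis
    by (subst distr_Complex_lborel[symmetric], subst integrable_distr_eq) (auto simp: lborel_prod case_prod_beta')
qed

lemma integral_complex_lborel:
  fixes f :: "complex \<Rightarrow> 'a :: {banach, second_countable_topology}"
  assumes f: "integrable lborel f"
  shows "(\<integral>z. f z \<partial>lborel) = (\<integral>x. (\<integral>y. f (Complex x y) \<partial>lborel) \<partial>lborel)"
proof -
  have [measurable]: "(\<lambda>(x, y). Complex x y) \<in> borel_measurable borel"
    using measurable_Complex by (simp add: case_prod_beta')
  have [measurable]: "f \<in> borel_measurable borel" using borel_measurable_integrable[OF f] by simp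
  have "(\<integral>z. f z \<partial>lborel) = (\<integral>q. f (case q of (x, y) \<Rightarrow> Complex x y) \<partial>(lborel \<Otimes>\<^sub>M lborel))"
    by (subst distr_Complex_lborel[symmetric], subst integral_distr) (auto simp: lborel_prod)
  also have "\<dots> = (\<integral>x. (\<integral>y. f (Complex x y) \<partial>lborel) \<partial>lborel)"
    using f[unfolded integrable_complex_lborel_iff[OF \<open>f \<in> borel_measurable borel\<close>]]
    by (subst lborel_pair.integral_fst'[symmetric]) (auto simp: case_prod_beta')
  finally show ?thesis .
qed

lemma integral_gauss_cis:
  "(\<integral>x. of_real (exp (- x\<^sup>2 / 2)) * cis (t * x) \<partial>lborel) = of_real (sqrt (2 * pi) * exp (- t\<^sup>2 / 2))"
proof -
  have "char std_normal_distribution t = of_real (exp (- t\<^sup>2 / 2))"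
    by (simp add: char_std_normal_distribution)
  then have "(\<integral>x. std_normal_density x *\<^sub>R cis (t * x) \<partial>lborel) = of_real (exp (- t\<^sup>2 / 2))"
    unfolding char_def cis_conv_exp by (subst (asm) integral_density) auto
  then have "of_real (sqrt (2 * pi)) * (\<integral>x. std_normal_density x *\<^sub>R cis (t * x) \<partial>lborel)
      = of_real (sqrt (2 * pi) * exp (- t\<^sup>2 / 2))"
    by simp
  also have "of_real (sqrt (2 * pi)) * (\<integral>x. std_normal_density x *\<^sub>R cis (t * x) \<partial>lborel)
      = (\<integral>x. of_real (sqrt (2 * pi)) * (std_normal_density x *\<^sub>R cis (t * x)) \<partial>lborel)"
    by (rule integral_mult_right_zero[symmetric])
  also have "\<dots> = (\<integral>x. of_real (exp (- x\<^sup>2 / 2)) * cis (t * x) \<partial>lborel)"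
    by (intro Bochner_Integration.integral_cong refl) (simp add: std_normal_density_def scaleR_conv_of_real)
  finally show ?thesis .
qed

text \<open>Its Fourier transform is \<open>gauss_kernel \<delta>\<close> up to the factor
  \<open>(2 * pi)\<^sup>2\<close>; it tends to 1 as \<delta> tends to 0.\<close>

definition gauss_weight :: "real \<Rightarrow> complex \<Rightarrow> real" where
  "gauss_weight \<delta> \<xi> = exp (- (\<delta>\<^sup>2 * (cmod \<xi>)\<^sup>2 / 2))"

lemma measurable_gauss_weight[measurable]: "gauss_weight \<delta> \<in> borel_measurable borel"
  unfolding gauss_weight_def[abs_def] by measurable

lemma gauss_weight_pos: "0 < gauss_weight \<delta> \<xi>" and gauss_weight_le: "gauss_weight \<delta> \<xi> \<le> 1"
  by (simp_all add: gauss_weight_def)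

lemma integrable_gauss_weight:
  assumes "0 < \<delta>" shows "integrable lborel (gauss_weight \<delta>)"
proof (rule integrableI_bounded)
  have "(\<integral>\<^sup>+ \<xi>. ennreal (norm (gauss_weight \<delta> \<xi>)) \<partial>lborel) = (\<integral>\<^sup>+ \<xi>. ennreal (exp (- (\<delta>\<^sup>2 / 2) * (cmod \<xi>)\<^sup>2)) \<partial>lborel)"
    by (simp add: gauss_weight_def)
  also have "\<dots> < \<infinity>" using assms by (subst nn_integral_gauss_complex) auto
  finally show "(\<integral>\<^sup>+ \<xi>. ennreal (norm (gauss_weight \<delta> \<xi>)) \<partial>lborel) < \<infinity>" .
qed simp

lemma integral_gauss_weight_cis:
  assumes \<delta>: "0 < \<delta>"
  shows "(\<integral>\<xi>. of_real (gauss_weight \<delta> \<xi>) * cis (\<xi> \<bullet> w) \<partial>lborel) = of_real ((2 * pi)\<^sup>2 * gauss_kernel \<delta> w)"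
proof -
  have 1: "(\<integral>\<xi>. of_real (gauss_weight 1 \<xi>) * cis (\<xi> \<bullet> v) \<partial>lborel) = of_real (2 * pi * exp (- (cmod v)\<^sup>2 / 2))" for v
  proof -
    have int: "integrable lborel (\<lambda>\<xi>. of_real (gauss_weight 1 \<xi>) * cis (\<xi> \<bullet> v))"
      by (rule Bochner_Integration.integrable_bound[OF integrable_gauss_weight[OF zero_less_one]])
        (auto simp: norm_mult)
    have "(\<integral>\<xi>. of_real (gauss_weight 1 \<xi>) * cis (\<xi> \<bullet> v) \<partial>lborel)
        = (\<integral>x. (\<integral>y. (of_real (exp (- x\<^sup>2 / 2)) * cis (Re v * x)) * (of_real (exp (- y\<^sup>2 / 2)) * cis (Im v * y)) \<partial>lborel) \<partial>lborel)"
      unfolding integral_complex_lborel[OF int]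
      by (intro Bochner_Integration.integral_cong refl)
        (simp add: gauss_weight_def cmod_power2 inner_complex_def cis_mult[symmetric] exp_add[symmetric]
          add_divide_distrib mult_ac exp_diff[symmetric] flip: of_real_mult)
    also have "\<dots> = of_real (sqrt (2 * pi) * exp (- (Re v)\<^sup>2 / 2)) * of_real (sqrt (2 * pi) * exp (- (Im v)\<^sup>2 / 2))"
      by (simp only: integral_mult_right_zero integral_mult_left_zero integral_gauss_cis)
    also have "\<dots> = of_real (2 * pi * exp (- (cmod v)\<^sup>2 / 2))"
    proof -
      have "- (Re v)\<^sup>2 / 2 + - (Im v)\<^sup>2 / 2 = - (cmod v)\<^sup>2 / 2" by (simp add: cmod_power2 field_simps)
      then have "exp (- (cmod v)\<^sup>2 / 2) = exp (- (Re v)\<^sup>2 / 2) * exp (- (Im v)\<^sup>2 / 2)"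
        by (simp only: exp_add[symmetric])
      then have "(sqrt (2 * pi) * exp (- (Re v)\<^sup>2 / 2)) * (sqrt (2 * pi) * exp (- (Im v)\<^sup>2 / 2))
          = (sqrt (2 * pi) * sqrt (2 * pi)) * exp (- (cmod v)\<^sup>2 / 2)"
        by (simp only: mult_ac)
      also have "sqrt (2 * pi) * sqrt (2 * pi) = 2 * pi" by simp
      finally show ?thesis by (simp only: of_real_mult[symmetric])
    qed
    finally show ?thesis .
  qed
  define v where "v = w /\<^sub>R \<delta>"
  have "(\<integral>\<xi>. of_real (gauss_weight 1 \<xi>) * cis (\<xi> \<bullet> v) \<partial>lborel)
      = \<delta>\<^sup>2 *\<^sub>R (\<integral>\<xi>. of_real (gauss_weight 1 (\<delta> *\<^sub>R \<xi>)) * cis ((\<delta> *\<^sub>R \<xi>) \<bullet> v) \<partial>lborel)"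
  proof -
    let ?h = "\<lambda>\<xi>. of_real (gauss_weight 1 \<xi>) * cis (\<xi> \<bullet> v)"
    have [measurable]: "?h \<in> borel_measurable borel" by measurable
    have "(\<integral>\<xi>. ?h (0 + \<delta> *\<^sub>R \<xi>) \<partial>lborel) = (\<integral>\<xi>. ?h \<xi> \<partial>lborel) /\<^sub>R \<bar>\<delta>\<bar> ^ DIM(complex)"
      using \<delta> by (intro integral_lborel_affine) auto
    then show ?thesis using \<delta> by simp
  qed
  moreover have "gauss_weight 1 (\<delta> *\<^sub>R \<xi>) = gauss_weight \<delta> \<xi>" for \<xi>
    by (simp add: gauss_weight_def power_mult_distrib)
  moreover have "(\<delta> *\<^sub>R \<xi>) \<bullet> v = \<xi> \<bullet> w" for \<xi> using \<delta> by (simp add: v_def)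
  ultimately have "\<delta>\<^sup>2 *\<^sub>R (\<integral>\<xi>. of_real (gauss_weight \<delta> \<xi>) * cis (\<xi> \<bullet> w) \<partial>lborel) = of_real (2 * pi * exp (- (cmod v)\<^sup>2 / 2))"
    using 1[of v] by simp
  then have "(\<integral>\<xi>. of_real (gauss_weight \<delta> \<xi>) * cis (\<xi> \<bullet> w) \<partial>lborel) = of_real (2 * pi * exp (- (cmod v)\<^sup>2 / 2)) /\<^sub>R \<delta>\<^sup>2"
    using \<delta> by (metis less_irrefl power_not_zero scaleR_scaleR scaleR_one left_inverse)
  also have "\<dots> = of_real ((2 * pi)\<^sup>2 * gauss_kernel \<delta> w)"
  proof -
    have "(cmod v)\<^sup>2 = (cmod w)\<^sup>2 / \<delta>\<^sup>2"
      using \<delta> by (simp add: v_def power_mult_distrib power_inverse divide_inverse mult.commute)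
    then have "2 * pi * exp (- (cmod v)\<^sup>2 / 2) / \<delta>\<^sup>2 = (2 * pi)\<^sup>2 * gauss_kernel \<delta> w"
      using \<delta> by (simp add: gauss_kernel_def power2_eq_square mult.commute)
    moreover have "of_real x /\<^sub>R c = complex_of_real (x / c)" for x c
      unfolding scaleR_conv_of_real of_real_mult[symmetric] divide_inverse by (simp only: mult.commute)
    ultimately show ?thesis by (simp only:)
  qed
  finally show ?thesis .
qed

subsection \<open>The Fourier formula for sections\<close>

text \<open>The function \<phi> of the overview times \<open>disc_const p\<close>. The cosine alone
  suffices because the density is even, and leaving out the normalisation keeps quotients out of the
  integral identities.\<close>

definition disc_char :: "real \<Rightarrow> complex \<Rightarrow> real" where
  "disc_char p \<xi> = (\<integral>z. exp (- (cmod z powr p)) * cos (\<xi> \<bullet> z) \<partial>lborel)"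

lemma
  assumes "0 < p"
  shows integrable_exp_cmod_powr: "integrable lborel (\<lambda>z. exp (- (cmod z powr p)))"
    and integral_exp_cmod_powr: "(\<integral>z. exp (- (cmod z powr p)) \<partial>lborel) = disc_const p"
  using nn_integral_exp_cmod_powr[OF assms] disc_const_pos[OF assms]
  by (auto intro!: integrableI_nonneg integral_eq_nn_integral[THEN trans] simp: less_imp_le)

lemma integrable_exp_cmod_powr_mult:
  fixes g :: "complex \<Rightarrow> 'a :: {banach, second_countable_topology, real_normed_algebra_1}"
  assumes "0 < p" and [measurable]: "g \<in> borel_measurable borel" and "\<And>z. norm (g z) \<le> 1"
  shows "integrable lborel (\<lambda>z. of_real (exp (- (cmod z powr p))) * g z)"
  by (rule Bochner_Integration.integrable_bound[OF integrable_exp_cmod_powr[OF assms(1)]])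
    (auto intro!: order_trans[OF norm_mult_ineq] simp: assms(3))

lemma disc_char_cis:
  assumes p: "0 < p"
  shows "(\<integral>z. of_real (exp (- (cmod z powr p))) * cis (\<xi> \<bullet> z) \<partial>lborel) = of_real (disc_char p \<xi>)"
proof -
  let ?I = "\<integral>z. of_real (exp (- (cmod z powr p))) * cis (\<xi> \<bullet> z) \<partial>lborel"
  have int: "integrable lborel (\<lambda>z. of_real (exp (- (cmod z powr p))) * cis (\<xi> \<bullet> z))"
    by (rule integrable_exp_cmod_powr_mult[OF p]) auto
  have Re: "Re ?I = disc_char p \<xi>"
    unfolding disc_char_def integral_Re[OF int, symmetric] by simp
  have "Im ?I = (\<integral>z. exp (- (cmod z powr p)) * sin (\<xi> \<bullet> z) \<partial>lborel)"
    unfolding integral_Im[OF int, symmetric] by simp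
  also have "\<dots> = - (\<integral>z. exp (- (cmod z powr p)) * sin (\<xi> \<bullet> z) \<partial>lborel)"
    using integral_rotate[of "-1" "\<lambda>z. exp (- (cmod z powr p)) * sin (\<xi> \<bullet> z)"] by simp
  finally have "Im ?I = 0" using \<open>Im ?I = _\<close> by simp
  then show ?thesis using Re by (simp add: complex_eq_iff)
qed

lemma abs_disc_char_le:
  assumes p: "0 < p" shows "\<bar>disc_char p \<xi>\<bar> \<le> disc_const p"
proof -
  have "\<bar>disc_char p \<xi>\<bar> \<le> (\<integral>z. norm (exp (- (cmod z powr p)) * cos (\<xi> \<bullet> z)) \<partial>lborel)"
    unfolding disc_char_def real_norm_def[symmetric] by (rule integral_norm_bound)
  also have "\<dots> \<le> (\<integral>z. exp (- (cmod z powr p)) \<partial>lborel)"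
    using integrable_exp_cmod_powr_mult[OF p, of "\<lambda>z. cos (\<xi> \<bullet> z)"] integrable_exp_cmod_powr[OF p]
    by (intro integral_mono integrable_norm) (auto simp: abs_mult)
  finally show ?thesis by (simp add: integral_exp_cmod_powr[OF p])
qed

lemma measurable_disc_char[measurable]: "disc_char p \<in> borel_measurable borel"
  unfolding disc_char_def[abs_def] by measurable

lemma inner_sum_of_real:
  fixes \<xi> :: complex
  shows "\<xi> \<bullet> (\<Sum>j<n. z j * of_real (\<alpha> j)) = (\<Sum>j<n. (\<alpha> j *\<^sub>R \<xi>) \<bullet> z j)"
  unfolding inner_sum_right by (intro sum.cong refl) (simp add: inner_complex_def algebra_simps)

lemma cis_sum: "cis (sum f A) = (\<Prod>j\<in>A. cis (f j))"
  by (induction A rule: infinite_finite_induct) (auto simp: cis_mult[symmetric])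

text \<open>Writing the kernel as the Fourier integral of its weight and exchanging the integrals
  leaves, for fixed \<xi>, a product over the coordinates of one-variable transforms.\<close>

lemma integral_exp_lp_power_gauss_kernel:
  assumes p: "0 < p" and \<delta>: "0 < \<delta>"
  shows "(\<integral>z. exp (- lp_power n p z) * gauss_kernel \<delta> (\<Sum>j<n. z j * of_real (\<alpha> j)) \<partial>Pi\<^sub>M {..<n} (\<lambda>_. lborel))
       = (\<integral>\<xi>. gauss_weight \<delta> \<xi> * (\<Prod>j<n. disc_char p (\<alpha> j *\<^sub>R \<xi>)) \<partial>lborel) / (2 * pi)\<^sup>2"
proof -
  let ?M = "Pi\<^sub>M {..<n} (\<lambda>_. lborel :: complex measure)"
  interpret C: product_sigma_finite "\<lambda>_::nat. lborel :: complex measure" by standard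
  have sf: "sigma_finite_measure ?M" by (rule C.sigma_finite) simp
  define s where "s z = (\<Sum>j<n. z j * of_real (\<alpha> j))" for z :: "nat \<Rightarrow> complex"
  have [measurable]: "s \<in> borel_measurable ?M" unfolding s_def by measurable
  have int_e: "integrable ?M (\<lambda>z. exp (- lp_power n p z))"
    using nn_integral_exp_lp_power[OF p, of n] by (intro integrableI_nonneg) auto
  have "complex_of_real ((2 * pi)\<^sup>2 * (\<integral>z. exp (- lp_power n p z) * gauss_kernel \<delta> (s z) \<partial>?M))
      = (\<integral>z. of_real (exp (- lp_power n p z)) * of_real ((2 * pi)\<^sup>2 * gauss_kernel \<delta> (s z)) \<partial>?M)"
    unfolding integral_mult_right_zero[symmetric] integral_complex_of_real[symmetric]
    by (intro Bochner_Integration.integral_cong refl) simp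
  also have "\<dots> = (\<integral>z. of_real (exp (- lp_power n p z)) * (\<integral>\<xi>. of_real (gauss_weight \<delta> \<xi>) * cis (\<xi> \<bullet> s z) \<partial>lborel) \<partial>?M)"
    by (simp only: integral_gauss_weight_cis[OF \<delta>])
  also have "\<dots> = (\<integral>\<xi>. of_real (gauss_weight \<delta> \<xi>) * (\<integral>z. of_real (exp (- lp_power n p z)) * cis (\<xi> \<bullet> s z) \<partial>?M) \<partial>lborel)"
    by (rule Fubini_bounded_kernel(1)[OF sf sigma_finite_lborel int_e integrable_gauss_weight[OF \<delta>]]) auto
  also have "\<dots> = (\<integral>\<xi>. of_real (gauss_weight \<delta> \<xi>) * of_real (\<Prod>j<n. disc_char p (\<alpha> j *\<^sub>R \<xi>)) \<partial>lborel)"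
  proof (intro Bochner_Integration.integral_cong refl arg_cong2[where f="(*)"])
    fix \<xi>
    have "(\<integral>z. of_real (exp (- lp_power n p z)) * cis (\<xi> \<bullet> s z) \<partial>?M)
        = (\<integral>z. (\<Prod>j<n. of_real (exp (- (cmod (z j) powr p))) * cis ((\<alpha> j *\<^sub>R \<xi>) \<bullet> z j)) \<partial>?M)"
      by (intro Bochner_Integration.integral_cong refl)
        (simp only: s_def exp_lp_power inner_sum_of_real cis_sum of_real_prod prod.distrib)
    also have "\<dots> = (\<Prod>j<n. \<integral>z. of_real (exp (- (cmod z powr p))) * cis ((\<alpha> j *\<^sub>R \<xi>) \<bullet> z) \<partial>lborel)"
      by (rule C.product_integral_prod) (auto intro!: integrable_exp_cmod_powr_mult[OF p] simp del: inner_scaleR_left)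
    finally show "(\<integral>z. of_real (exp (- lp_power n p z)) * cis (\<xi> \<bullet> s z) \<partial>?M) = of_real (\<Prod>j<n. disc_char p (\<alpha> j *\<^sub>R \<xi>))"
      by (simp only: disc_char_cis[OF p] of_real_prod)
  qed
  also have "\<dots> = of_real (\<integral>\<xi>. gauss_weight \<delta> \<xi> * (\<Prod>j<n. disc_char p (\<alpha> j *\<^sub>R \<xi>)) \<partial>lborel)"
    by (simp only: integral_complex_of_real[symmetric] of_real_mult)
  finally have "(2 * pi)\<^sup>2 * (\<integral>z. exp (- lp_power n p z) * gauss_kernel \<delta> (s z) \<partial>?M)
      = (\<integral>\<xi>. gauss_weight \<delta> \<xi> * (\<Prod>j<n. disc_char p (\<alpha> j *\<^sub>R \<xi>)) \<partial>lborel)"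
    by (simp only: of_real_eq_iff)
  then show ?thesis by (simp add: s_def eq_divide_eq mult.commute)
qed

text \<open>The section and the ball in dimension \<open>n - 1\<close> have the same real dimension
  \<open>2 * (n - 1)\<close>, hence the same Gamma factor, and it cancels in the ratio. What remains
  of the ball is \<open>disc_const p ^ (n - 1)\<close>.\<close>

lemma section_ratio_limit:
  fixes \<alpha> :: "nat \<Rightarrow> real"
  assumes n: "2 \<le> n" and p: "2 \<le> p" and \<delta>: "\<And>m. 0 < \<delta> m" "\<delta> \<longlonglongrightarrow> 0"
    and \<alpha>: "(\<Sum>j<n. (\<alpha> j)\<^sup>2) = 1" "\<alpha> 0 < 1"
  shows "(\<lambda>m. (\<integral>\<xi>. gauss_weight (\<delta> m) \<xi> * (\<Prod>j<n. disc_char p (\<alpha> j *\<^sub>R \<xi>)) \<partial>lborel) / (2 * pi)\<^sup>2 / disc_const p ^ (n - 1))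
     \<longlonglongrightarrow> section_ratio n p (\<lambda>j\<in>{..<n}. complex_of_real (\<alpha> j))"
proof -
  define a where "a = (\<lambda>j\<in>{..<n}. complex_of_real (\<alpha> j))"
  let ?M = "Pi\<^sub>M {..<n} (\<lambda>_. lborel :: complex measure)"
  define H where "H = subspace_vol n (2 * (n - 1)) (chyperplane n a) (chyperplane n a \<inter> lp_ball n p)"
  define B where "B = cspace_vol (n - 1) (lp_ball (n - 1) p)"
  define g where "g = Gamma (1 + real (2 * (n - 1)) / p)"
  have g: "0 < g" using p unfolding g_def by (intro Gamma_real_pos add_pos_nonneg) auto
  have Bg: "B * g = disc_const p ^ (n - 1)"
    unfolding B_def g_def by (rule cspace_vol_lp_ball) (use n p in auto)
  have K: "0 < disc_const p ^ (n - 1)" using disc_const_pos[of p] p by simp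
  then have B: "B \<noteq> 0" using Bg by auto
  have a1: "rinner n a a = 1" "a \<in> cspace n"
    using \<alpha>(1) by (auto simp: rinner_def a_def cspace_def inner_complex_def power2_eq_square)
  have ex: "\<exists>b. real_onb n (2 * (n - 1)) (chyperplane n a) b"
    unfolding a_def using n \<alpha> by (intro real_onb_chyperplane) auto
  have cin: "cinner n z a = (\<Sum>j<n. z j * of_real (\<alpha> j))" for z
    by (simp add: cinner_def a_def)
  have meas[measurable]: "(\<lambda>z. exp (- lp_power n p z) * gauss_kernel (\<delta> m) (\<Sum>j<n. z j * of_real (\<alpha> j))) \<in> borel_measurable ?M" for m
    by measurable
  define J where "J m = (\<integral>z. exp (- lp_power n p z) * gauss_kernel (\<delta> m) (\<Sum>j<n. z j * of_real (\<alpha> j)) \<partial>?M)" for m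
  have J: "(\<integral>\<^sup>+ z. ennreal (exp (- lp_power n p z) * gauss_kernel (\<delta> m) (cinner n z a)) \<partial>?M) = ennreal (J m)" for m
    unfolding J_def cin
  proof (rule nn_integral_eq_integral)
    have "integrable ?M (\<lambda>z. exp (- lp_power n p z) * (1 / (2 * pi * (\<delta> m)\<^sup>2)))"
      using nn_integral_exp_lp_power[of p n] p by (intro integrable_mult_left integrableI_nonneg) auto
    then show "integrable ?M (\<lambda>z. exp (- lp_power n p z) * gauss_kernel (\<delta> m) (\<Sum>j<n. z j * of_real (\<alpha> j)))"
      by (rule Bochner_Integration.integrable_bound)
        (auto simp: gauss_kernel_def divide_right_mono intro!: divide_right_mono)
  qed (auto simp: gauss_kernel_nonneg)
  have Hg: "0 \<le> H * g" using g by (auto simp: H_def subspace_vol_def Let_def)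
  have "(\<lambda>m. ennreal (J m)) \<longlonglongrightarrow> ennreal (H * g)"
    using section_volume_limit[OF n p \<delta> ex a1] unfolding J H_def g_def .
  moreover have "0 \<le> J m" for m unfolding J_def by (intro integral_nonneg_AE AE_I2) (auto simp: gauss_kernel_nonneg)
  ultimately have "J \<longlonglongrightarrow> H * g" using Hg by (simp add: tendsto_ennreal_iff)
  then have "(\<lambda>m. J m / disc_const p ^ (n - 1)) \<longlonglongrightarrow> H * g / disc_const p ^ (n - 1)"
    using K by (intro tendsto_divide[OF _ tendsto_const]) (assumption, linarith)
  also have "H * g / disc_const p ^ (n - 1) = section_ratio n p a"
    unfolding section_ratio_def Bg[symmetric] H_def[symmetric] B_def[symmetric] using g by simp
  finally show ?thesis
    using p \<delta>(1) unfolding J_def a_def by (simp add: integral_exp_lp_power_gauss_kernel)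
qed

text \<open>A weighted Plancherel identity, obtained by expanding one factor at a time. Up to
  normalisation the right side is the mean of the kernel at s (Z + Z') for independent copies Z, Z',
  so it concentrates at z' = - z as \<delta> tends to 0.\<close>

lemma integral_disc_char_square:
  assumes p: "0 < p" and \<delta>: "0 < \<delta>"
  shows "(\<integral>\<xi>. gauss_weight \<delta> \<xi> * (disc_char p (s *\<^sub>R \<xi>))\<^sup>2 \<partial>lborel) / (2 * pi)\<^sup>2
      = (\<integral>z. exp (- (cmod z powr p)) * (\<integral>z'. exp (- (cmod z' powr p)) * gauss_kernel \<delta> (s *\<^sub>R (z + z')) \<partial>lborel) \<partial>lborel)"
proof -
  define e where "e z = exp (- (cmod z powr p))" for z :: complex
  have e: "integrable lborel e" unfolding e_def by (rule integrable_exp_cmod_powr[OF p])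
  have [measurable]: "e \<in> borel_measurable borel" unfolding e_def by measurable
  have \<Phi>: "(\<integral>z. of_real (e z) * cis ((s *\<^sub>R \<xi>) \<bullet> z) \<partial>lborel) = of_real (disc_char p (s *\<^sub>R \<xi>))" for \<xi>
    unfolding e_def by (rule disc_char_cis[OF p])
  have int_w: "integrable lborel (\<lambda>\<xi>. gauss_weight \<delta> \<xi> * disc_char p (s *\<^sub>R \<xi>))"
    by (rule Bochner_Integration.integrable_bound[OF integrable_mult_left[OF integrable_gauss_weight[OF \<delta>], of "disc_const p"]])
      (use abs_disc_char_le[OF p] disc_const_pos[OF p] gauss_weight_pos[of \<delta>] in \<open>auto simp: abs_mult less_imp_le intro!: mult_left_mono\<close>)
  have "complex_of_real (\<integral>\<xi>. gauss_weight \<delta> \<xi> * (disc_char p (s *\<^sub>R \<xi>))\<^sup>2 \<partial>lborel)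
      = (\<integral>\<xi>. of_real (gauss_weight \<delta> \<xi> * disc_char p (s *\<^sub>R \<xi>)) * (\<integral>z. of_real (e z) * cis ((s *\<^sub>R \<xi>) \<bullet> z) \<partial>lborel) \<partial>lborel)"
    unfolding \<Phi> integral_complex_of_real[symmetric]
    by (intro Bochner_Integration.integral_cong refl) (simp add: power2_eq_square)
  also have "\<dots> = (\<integral>z. of_real (e z) * (\<integral>\<xi>. of_real (gauss_weight \<delta> \<xi> * disc_char p (s *\<^sub>R \<xi>)) * cis ((s *\<^sub>R \<xi>) \<bullet> z) \<partial>lborel) \<partial>lborel)"
    by (rule Fubini_bounded_kernel(1)[OF sigma_finite_lborel sigma_finite_lborel int_w e]) auto
  also have "\<dots> = (\<integral>z. of_real (e z) * (\<integral>z'. of_real (e z') * of_real ((2 * pi)\<^sup>2 * gauss_kernel \<delta> (s *\<^sub>R (z + z'))) \<partial>lborel) \<partial>lborel)"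
  proof -
    have "(\<integral>\<xi>. of_real (gauss_weight \<delta> \<xi> * disc_char p (s *\<^sub>R \<xi>)) * cis ((s *\<^sub>R \<xi>) \<bullet> z) \<partial>lborel)
        = (\<integral>z'. of_real (e z') * of_real ((2 * pi)\<^sup>2 * gauss_kernel \<delta> (s *\<^sub>R (z + z'))) \<partial>lborel)" for z
    proof -
    have "(\<integral>\<xi>. of_real (gauss_weight \<delta> \<xi> * disc_char p (s *\<^sub>R \<xi>)) * cis ((s *\<^sub>R \<xi>) \<bullet> z) \<partial>lborel)
        = (\<integral>\<xi>. of_real (gauss_weight \<delta> \<xi>) * (cis ((s *\<^sub>R \<xi>) \<bullet> z) * (\<integral>z'. of_real (e z') * cis ((s *\<^sub>R \<xi>) \<bullet> z') \<partial>lborel)) \<partial>lborel)"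
      unfolding \<Phi> by (intro Bochner_Integration.integral_cong refl) simp
    also have "\<dots> = (\<integral>\<xi>. of_real (gauss_weight \<delta> \<xi>) * (\<integral>z'. of_real (e z') * cis (\<xi> \<bullet> (s *\<^sub>R (z + z'))) \<partial>lborel) \<partial>lborel)"
    proof -
      have "cis ((s *\<^sub>R \<xi>) \<bullet> z) * (\<integral>z'. of_real (e z') * cis ((s *\<^sub>R \<xi>) \<bullet> z') \<partial>lborel)
          = (\<integral>z'. of_real (e z') * cis (\<xi> \<bullet> (s *\<^sub>R (z + z'))) \<partial>lborel)" for \<xi>
        unfolding integral_mult_right_zero[symmetric]
        by (intro Bochner_Integration.integral_cong refl)
          (simp add: mult.left_commute[of "cis _"] cis_mult inner_add_right ring_distribs)
      then show ?thesis by (simp only:)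
    qed
    also have "\<dots> = (\<integral>z'. of_real (e z') * (\<integral>\<xi>. of_real (gauss_weight \<delta> \<xi>) * cis (\<xi> \<bullet> (s *\<^sub>R (z + z'))) \<partial>lborel) \<partial>lborel)"
      by (rule Fubini_bounded_kernel(1)[OF sigma_finite_lborel sigma_finite_lborel integrable_gauss_weight[OF \<delta>] e]) auto
    finally show "(\<integral>\<xi>. of_real (gauss_weight \<delta> \<xi> * disc_char p (s *\<^sub>R \<xi>)) * cis ((s *\<^sub>R \<xi>) \<bullet> z) \<partial>lborel)
        = (\<integral>z'. of_real (e z') * of_real ((2 * pi)\<^sup>2 * gauss_kernel \<delta> (s *\<^sub>R (z + z'))) \<partial>lborel)"
      by (simp only: integral_gauss_weight_cis[OF \<delta>])
    qed
    then show ?thesis by (simp only:)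
  qed
  also have "\<dots> = of_real ((2 * pi)\<^sup>2 * (\<integral>z. e z * (\<integral>z'. e z' * gauss_kernel \<delta> (s *\<^sub>R (z + z')) \<partial>lborel) \<partial>lborel))"
  proof -
    have "(\<integral>z'. of_real (e z') * of_real ((2 * pi)\<^sup>2 * gauss_kernel \<delta> (s *\<^sub>R (z + z'))) \<partial>lborel)
        = complex_of_real ((2 * pi)\<^sup>2 * (\<integral>z'. e z' * gauss_kernel \<delta> (s *\<^sub>R (z + z')) \<partial>lborel))" for z
      unfolding integral_mult_right_zero[symmetric] integral_complex_of_real[symmetric]
      by (intro Bochner_Integration.integral_cong refl) simp
    then show ?thesis
      unfolding integral_mult_right_zero[symmetric] integral_complex_of_real[symmetric]
      by (intro Bochner_Integration.integral_cong refl) simp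
  qed
  finally show ?thesis unfolding of_real_eq_iff e_def by simp
qed

subsection \<open>Bounds on the characteristic function\<close>

text \<open>The integral of \<open>\<bar>z\<bar>\<^sup>2 exp (- \<bar>z\<bar>\<^sup>p)\<close> over \<open>\<complex>\<close>.\<close>

definition disc_moment :: "real \<Rightarrow> real" where
  "disc_moment p = pi / 2 * Gamma (1 + 4 / p)"

lemma disc_moment_pos: "0 < p \<Longrightarrow> 0 < disc_moment p"
  by (auto simp: disc_moment_def intro!: mult_pos_pos Gamma_real_pos add_pos_pos)

lemma nn_integral_cmod_power_exp:
  assumes p: "0 < p" and k: "0 < k"
  shows "(\<integral>\<^sup>+ z. ennreal (cmod z ^ k * exp (- (cmod z powr p))) \<partial>lborel)
       = ennreal (pi * (2 / p) * Gamma (2 / p + real k / p))"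
proof -
  have "(\<integral>\<^sup>+ z. ennreal ((cmod z powr p) powr (real k / p) * exp (- (cmod z powr p))) \<partial>lborel)
      = ennreal (pi * (2 / p) * Gamma (2 / p + real k / p))"
    by (rule nn_integral_powr_exp_of_powr_volume) (use p emeasure_cmod_powr_le[of p] in auto)
  \<comment> \<open>At \<open>z = 0\<close> the left side is 0, which agrees with the right side
    because \<open>k\<close> is positive.\<close>
  moreover have "(cmod z powr p) powr (real k / p) = cmod z ^ k" for z
    using p k by (cases "z = 0") (auto simp: powr_powr powr_realpow)
  ultimately show ?thesis by simp
qed

lemma integrable_cmod_power_exp:
  assumes p: "0 < p" and k: "0 < k"
  shows "integrable lborel (\<lambda>z. cmod z ^ k * exp (- (cmod z powr p)))"
  using nn_integral_cmod_power_exp[OF assms] by (intro integrableI_nonneg) auto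

lemma integral_cmod_sq_exp:
  assumes p: "0 < p"
  shows "(\<integral>z. (cmod z)\<^sup>2 * exp (- (cmod z powr p)) \<partial>lborel) = disc_moment p"
proof -
  have "Gamma (1 + 4 / p) = 4 / p * Gamma (4 / p)"
  proof (subst add.commute, rule Gamma_plus1)
    have "0 < 4 / p" using p by simp
    then show "4 / p \<notin> \<int>\<^sub>\<le>\<^sub>0" using nonpos_Ints_nonpos[of "4 / p"] by linarith
  qed
  then have "pi * (2 / p) * Gamma (2 / p + real 2 / p) = disc_moment p"
    by (simp add: disc_moment_def add_divide_distrib[symmetric])
  then have "(\<integral>\<^sup>+ z. ennreal ((cmod z)\<^sup>2 * exp (- (cmod z powr p))) \<partial>lborel) = ennreal (disc_moment p)"
    using nn_integral_cmod_power_exp[OF p, of 2] by simp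
  then show ?thesis
    using disc_moment_pos[OF p] by (subst integral_eq_nn_integral) auto
qed

text \<open>Rotates \<xi> to a positive multiple of \<open>\<i>\<close>, so that the cosine depends
  on \<open>Im z\<close> only and planar integrals can be evaluated along vertical lines.\<close>

lemma disc_char_norm: "disc_char p \<xi> = (\<integral>z. exp (- (cmod z powr p)) * cos (cmod \<xi> * Im z) \<partial>lborel)"
proof (cases "\<xi> = 0")
  case False
  define v where "v = - \<i> * (\<xi> / cmod \<xi>)"
  have v: "cmod v = 1" using False by (simp add: v_def norm_mult norm_divide)
  have "\<xi> \<bullet> (v * z) = cmod \<xi> * Im z" for z
  proof -
    have "\<xi> \<bullet> (v * z) = ((Re \<xi>)\<^sup>2 + (Im \<xi>)\<^sup>2) / cmod \<xi> * Im z"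
      using False by (simp add: v_def inner_complex_def field_simps power2_eq_square)
    also have "((Re \<xi>)\<^sup>2 + (Im \<xi>)\<^sup>2) / cmod \<xi> = cmod \<xi>"
      unfolding cmod_power2[symmetric] using False by (simp add: power2_eq_square)
    finally show ?thesis .
  qed
  then show ?thesis
    using integral_rotate[OF v, of "\<lambda>z. exp (- (cmod z powr p)) * cos (\<xi> \<bullet> z)"]
    by (simp add: disc_char_def norm_mult v)
qed (simp add: disc_char_def)

lemma one_minus_cos_bounds: "1 - cos x \<le> x\<^sup>2 / 2" "x\<^sup>2 / 2 - x ^ 4 / 24 \<le> 1 - cos x" for x :: real
proof -
  have "(sin (x / 2))\<^sup>2 \<le> (x / 2)\<^sup>2" using abs_sin_x_le_abs_x[of "x / 2"] by (simp only: abs_le_square_iff)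
  then show "1 - cos x \<le> x\<^sup>2 / 2" using cos_double_sin[of "x / 2"] by (simp add: power_divide)
  have "cmod (iexp x - (\<Sum>k\<le>3. (\<i> * x)^k / fact k)) \<le> \<bar>x\<bar> ^ Suc 3 / fact (Suc 3)" by (rule iexp_approx1)
  then have "\<bar>Re (iexp x - (\<Sum>k\<le>3. (\<i> * x)^k / fact k))\<bar> \<le> x ^ 4 / 24"
    by (intro order_trans[OF abs_Re_le_cmod]) (simp add: fact_numeral power_even_abs)
  moreover have "Re (iexp x - (\<Sum>k\<le>3. (\<i> * x)^k / fact k)) = cos x - 1 + x\<^sup>2 / 2"
    by (simp add: numeral_eq_Suc Re_exp power_mult_distrib)
  ultimately show "x\<^sup>2 / 2 - x ^ 4 / 24 \<le> 1 - cos x" by linarith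
qed

text \<open>A quarter turn does not change the integral, and the squares of the scalar products of
  \<xi> with \<open>z\<close> and with \<open>\<i> * z\<close> add up to the product of the squared
  moduli.\<close>

lemma integral_inner_sq_exp:
  assumes p: "0 < p"
  shows "(\<integral>z. (\<xi> \<bullet> z)\<^sup>2 * exp (- (cmod z powr p)) \<partial>lborel) = (cmod \<xi>)\<^sup>2 * disc_moment p / 2"
    and "integrable lborel (\<lambda>z. (\<xi> \<bullet> z)\<^sup>2 * exp (- (cmod z powr p)))"
proof -
  have bnd: "(\<xi> \<bullet> z)\<^sup>2 \<le> (cmod \<xi>)\<^sup>2 * (cmod z)\<^sup>2" for z
    using Cauchy_Schwarz_ineq[of \<xi> z] by (simp add: power2_norm_eq_inner)
  have int: "integrable lborel (\<lambda>z. (\<xi> \<bullet> (u * z))\<^sup>2 * exp (- (cmod z powr p)))" if "cmod u = 1" for u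
    by (rule Bochner_Integration.integrable_bound[OF integrable_mult_left[OF integrable_cmod_power_exp[OF p, of 2], of "(cmod \<xi>)\<^sup>2"]])
      (use bnd[of "u * _"] that in \<open>auto simp: norm_mult mult_ac intro!: mult_left_mono\<close>)
  then show "integrable lborel (\<lambda>z. (\<xi> \<bullet> z)\<^sup>2 * exp (- (cmod z powr p)))" using int[of 1] by simp
  have "(\<integral>z. (\<xi> \<bullet> z)\<^sup>2 * exp (- (cmod z powr p)) \<partial>lborel) = (\<integral>z. (\<xi> \<bullet> (\<i> * z))\<^sup>2 * exp (- (cmod z powr p)) \<partial>lborel)"
    using integral_rotate[of \<i> "\<lambda>z. (\<xi> \<bullet> z)\<^sup>2 * exp (- (cmod z powr p))"] by (simp add: norm_mult)
  then have "2 * (\<integral>z. (\<xi> \<bullet> z)\<^sup>2 * exp (- (cmod z powr p)) \<partial>lborel)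
      = (\<integral>z. (\<xi> \<bullet> z)\<^sup>2 * exp (- (cmod z powr p)) + (\<xi> \<bullet> (\<i> * z))\<^sup>2 * exp (- (cmod z powr p)) \<partial>lborel)"
    using int[of 1] int[of \<i>] by (subst Bochner_Integration.integral_add) auto
  also have "\<dots> = (\<integral>z. (cmod \<xi>)\<^sup>2 * ((cmod z)\<^sup>2 * exp (- (cmod z powr p))) \<partial>lborel)"
  proof (rule Bochner_Integration.integral_cong[OF refl])
    fix z
    have "(\<xi> \<bullet> z)\<^sup>2 + (\<xi> \<bullet> (\<i> * z))\<^sup>2 = (cmod \<xi>)\<^sup>2 * (cmod z)\<^sup>2"
      by (simp add: inner_complex_def cmod_power2) (simp add: power2_eq_square algebra_simps)
    then show "(\<xi> \<bullet> z)\<^sup>2 * exp (- (cmod z powr p)) + (\<xi> \<bullet> (\<i> * z))\<^sup>2 * exp (- (cmod z powr p))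
        = (cmod \<xi>)\<^sup>2 * ((cmod z)\<^sup>2 * exp (- (cmod z powr p)))"
      by (simp only: ring_distribs(2)[symmetric] mult.assoc[symmetric])
  qed
  also have "\<dots> = (cmod \<xi>)\<^sup>2 * disc_moment p" by (simp add: integral_cmod_sq_exp[OF p])
  finally show "(\<integral>z. (\<xi> \<bullet> z)\<^sup>2 * exp (- (cmod z powr p)) \<partial>lborel) = (cmod \<xi>)\<^sup>2 * disc_moment p / 2" by simp
qed

lemma integrable_exp_cos:
  assumes p: "0 < p" shows "integrable lborel (\<lambda>z. exp (- (cmod z powr p)) * cos (\<xi> \<bullet> z))"
  using integrable_exp_cmod_powr_mult[OF p, of "\<lambda>z. cos (\<xi> \<bullet> z)"] by simp

lemma disc_char_ge_quadratic:
  assumes p: "0 < p"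
  shows "disc_const p - (cmod \<xi>)\<^sup>2 * disc_moment p / 4 \<le> disc_char p \<xi>"
proof -
  have "(\<integral>z. exp (- (cmod z powr p)) - (\<xi> \<bullet> z)\<^sup>2 * exp (- (cmod z powr p)) / 2 \<partial>lborel) \<le> disc_char p \<xi>"
    unfolding disc_char_def
  proof (rule integral_mono)
    show "exp (- (cmod z powr p)) - (\<xi> \<bullet> z)\<^sup>2 * exp (- (cmod z powr p)) / 2 \<le> exp (- (cmod z powr p)) * cos (\<xi> \<bullet> z)" for z
      using mult_left_mono[OF one_minus_cos_bounds(1)[of "\<xi> \<bullet> z"], of "exp (- (cmod z powr p))"]
      by (simp add: algebra_simps)
  qed (use integral_inner_sq_exp(2)[OF p] integrable_exp_cmod_powr[OF p] integrable_exp_cos[OF p] in auto)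
  then show ?thesis
    using integral_inner_sq_exp[OF p] integrable_exp_cmod_powr[OF p]
    by (simp add: integral_exp_cmod_powr[OF p])
qed

text \<open>The constant is the fourth absolute moment over 24, from the Taylor remainder of the
  cosine. Only its finiteness matters: the quartic term is absorbed near the origin.\<close>

lemma disc_char_le_quartic:
  assumes p: "0 < p"
  obtains C where "0 \<le> C"
    "\<And>\<xi>. disc_char p \<xi> \<le> disc_const p - (cmod \<xi>)\<^sup>2 * disc_moment p / 4 + C * (cmod \<xi>) ^ 4"
proof -
  define C where "C = (\<integral>z. cmod z ^ 4 * exp (- (cmod z powr p)) \<partial>lborel) / 24"
  have "disc_char p \<xi> \<le> disc_const p - (cmod \<xi>)\<^sup>2 * disc_moment p / 4 + C * (cmod \<xi>) ^ 4" for \<xi>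
  proof -
    have "disc_char p \<xi> \<le> (\<integral>z. exp (- (cmod z powr p)) - (\<xi> \<bullet> z)\<^sup>2 * exp (- (cmod z powr p)) / 2
        + (cmod \<xi>) ^ 4 * (cmod z ^ 4 * exp (- (cmod z powr p))) / 24 \<partial>lborel)"
      unfolding disc_char_def
    proof (rule integral_mono)
      fix z
      have "(\<xi> \<bullet> z) ^ 4 \<le> (cmod \<xi> * cmod z) ^ 4"
        using Cauchy_Schwarz_ineq2[of \<xi> z] by (metis abs_ge_zero power_even_abs_numeral power_mono even_numeral)
      then have "cos (\<xi> \<bullet> z) \<le> 1 - (\<xi> \<bullet> z)\<^sup>2 / 2 + (cmod \<xi>) ^ 4 * cmod z ^ 4 / 24"
        using one_minus_cos_bounds(2)[of "\<xi> \<bullet> z"] by (simp add: power_mult_distrib)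
      from mult_left_mono[OF this, of "exp (- (cmod z powr p))"]
      show "exp (- (cmod z powr p)) * cos (\<xi> \<bullet> z) \<le> exp (- (cmod z powr p)) - (\<xi> \<bullet> z)\<^sup>2 * exp (- (cmod z powr p)) / 2
        + (cmod \<xi>) ^ 4 * (cmod z ^ 4 * exp (- (cmod z powr p))) / 24"
        by (simp add: algebra_simps)
    qed (use integral_inner_sq_exp(2)[OF p] integrable_exp_cmod_powr[OF p] integrable_exp_cos[OF p]
          integrable_cmod_power_exp[OF p, of 4] in auto)
    then show ?thesis
      using integral_inner_sq_exp[OF p, of \<xi>] integrable_exp_cmod_powr[OF p] integrable_cmod_power_exp[OF p, of 4]
      by (simp add: integral_exp_cmod_powr[OF p] C_def mult.commute)
  qed
  moreover have "0 \<le> C" unfolding C_def by (auto intro!: integral_nonneg_AE)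
  ultimately show ?thesis using that by blast
qed

text \<open>An explicit gap away from the origin in place of a compactness argument. The integrand
  is nonnegative, so the integral may be restricted to the unit square; there the modulus is at most
  sqrt 2, so the density is at least \<open>exp (- (2 powr (p / 2)))\<close>, and the mean of
  \<open>1 - cos (t * y)\<close> over the unit interval is \<open>1 - sin t / t\<close>.\<close>

lemma disc_const_minus_disc_char_ge:
  assumes p: "0 < p"
  shows "disc_const p - disc_char p \<xi> \<ge> exp (- (2 powr (p / 2))) * min ((cmod \<xi>)\<^sup>2) 1 / 9"
proof (cases "\<xi> = 0")
  case True
  then show ?thesis by (simp add: disc_char_def integral_exp_cmod_powr[OF p])
next
  case False
  define t where "t = cmod \<xi>"
  define c where "c = exp (- (2 powr (p / 2)))"
  have t: "0 < t" using False by (simp add: t_def)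
  have int: "integrable lborel (\<lambda>z. exp (- (cmod z powr p)) * (1 - cos (t * Im z)))"
    using integrable_exp_cmod_powr[OF p] integrable_exp_cos[OF p, of "\<i> * t"]
    by (simp add: right_diff_distrib inner_complex_def)
  have "disc_const p - disc_char p \<xi> = (\<integral>z. exp (- (cmod z powr p)) * (1 - cos (t * Im z)) \<partial>lborel)"
    using integrable_exp_cmod_powr[OF p] integrable_exp_cos[OF p, of "\<i> * t"]
    by (simp add: right_diff_distrib inner_complex_def disc_char_norm t_def integral_exp_cmod_powr[OF p])
  then have "ennreal (disc_const p - disc_char p \<xi>) = (\<integral>\<^sup>+ z. ennreal (exp (- (cmod z powr p)) * (1 - cos (t * Im z))) \<partial>lborel)"
    using int by (simp add: nn_integral_eq_integral)
  also have "\<dots> = (\<integral>\<^sup>+ x. (\<integral>\<^sup>+ y. ennreal (exp (- (cmod (Complex x y) powr p)) * (1 - cos (t * y))) \<partial>lborel) \<partial>lborel)"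
    by (subst nn_integral_complex) auto
  also have "\<dots> \<ge> (\<integral>\<^sup>+ x. (\<integral>\<^sup>+ y. indicator {0..1::real} x * (ennreal c * (ennreal (1 - cos (t * y)) * indicator {0..1} y)) \<partial>lborel) \<partial>lborel)"
  proof (intro nn_integral_mono)
    fix x y :: real
    show "indicator {0..1::real} x * (ennreal c * (ennreal (1 - cos (t * y)) * indicator {0..1} y))
        \<le> ennreal (exp (- (cmod (Complex x y) powr p)) * (1 - cos (t * y)))"
    proof (cases "x \<in> {0..1} \<and> y \<in> {0..1}")
      case True
      then have "x\<^sup>2 + y\<^sup>2 \<le> 1 + 1" by (intro add_mono power_le_one) auto
      then have "cmod (Complex x y) \<le> sqrt 2" by (simp add: cmod_def)
      then have "cmod (Complex x y) powr p \<le> sqrt 2 powr p" using p by (intro powr_mono2) auto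
      also have "sqrt 2 powr p = 2 powr (p / 2)" by (simp add: powr_half_sqrt[symmetric] powr_powr)
      finally have "c \<le> exp (- (cmod (Complex x y) powr p))" by (simp add: c_def)
      then show ?thesis using True
        by (auto simp: ennreal_mult[symmetric] c_def intro!: ennreal_leI mult_right_mono)
    qed (auto simp: indicator_def)
  qed
  also have "(\<integral>\<^sup>+ x. (\<integral>\<^sup>+ y. indicator {0..1::real} x * (ennreal c * (ennreal (1 - cos (t * y)) * indicator {0..1} y)) \<partial>lborel) \<partial>lborel)
      = ennreal c * (\<integral>\<^sup>+ y. ennreal (1 - cos (t * y)) * indicator {0..1} y \<partial>lborel)"
    by (simp add: nn_integral_cmult nn_integral_multc)
  also have "(\<integral>\<^sup>+ y. ennreal (1 - cos (t * y)) * indicator {0..1} y \<partial>lborel) = ennreal ((1 - sin (t * 1) / t) - (0 - sin (t * 0) / t))"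
  proof (rule nn_integral_FTC_Icc)
    show "((\<lambda>y. y - sin (t * y) / t) has_real_derivative 1 - cos (t * y)) (at y)" for y
      using t by (auto intro!: derivative_eq_intros)
  qed auto
  finally have "ennreal (c * (1 - sin t / t)) \<le> ennreal (disc_const p - disc_char p \<xi>)"
    by (simp add: ennreal_mult' c_def)
  moreover have "0 \<le> disc_const p - disc_char p \<xi>" using abs_disc_char_le[OF p, of \<xi>] by linarith
  ultimately have ge: "c * (1 - sin t / t) \<le> disc_const p - disc_char p \<xi>"
    by (simp add: ennreal_le_iff)
  have "min (t\<^sup>2) 1 / 9 \<le> 1 - sin t / t"
  proof (cases "t \<le> 2")
    case True
    \<comment> \<open>For arguments up to 2 the quartic Taylor term is at most a sixth of the
      square, and 1 / 2 - 1 / 6 = 1 / 3; integrating over the unit interval turns this into the 1 /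
      9.\<close>
    have "(t * y)\<^sup>2 / 3 \<le> 1 - cos (t * y)" if "y \<in> {0..1}" for y
    proof -
      have "t * y \<le> 2 * 1" using that True t by (intro mult_mono) auto
      then have "(t * y)\<^sup>2 \<le> 2\<^sup>2" using that t by (intro power_mono) auto
      then have "(t * y)\<^sup>2 * (t * y)\<^sup>2 \<le> (t * y)\<^sup>2 * 4" by (intro mult_left_mono) auto
      then show ?thesis using one_minus_cos_bounds(2)[of "t * y"]
        by (simp add: power4_eq_xxxx power2_eq_square)
    qed
    moreover have "((\<lambda>y. (t * y)\<^sup>2 / 3) has_integral (t\<^sup>2 * 1 ^ 3 / 9 - t\<^sup>2 * 0 ^ 3 / 9)) {0..1}"
      by (rule fundamental_theorem_of_calculus)
        (auto simp: has_real_derivative_iff_has_vector_derivative[symmetric] power_mult_distrib intro!: derivative_eq_intros)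
    moreover have "((\<lambda>y. 1 - cos (t * y)) has_integral ((1 - sin (t * 1) / t) - (0 - sin (t * 0) / t))) {0..1}"
      using t by (intro fundamental_theorem_of_calculus)
        (auto simp: has_real_derivative_iff_has_vector_derivative[symmetric] intro!: derivative_eq_intros)
    ultimately have "t\<^sup>2 / 9 \<le> 1 - sin t / t"
      by (auto dest: has_integral_le)
    then show ?thesis by linarith
  next
    case False
    then have "sin t * 2 \<le> t" using sin_le_one[of t] by linarith
    then have "sin t / t \<le> 1 / 2" using t by (simp add: divide_le_eq)
    then show ?thesis by linarith
  qed
  then have "c * (min (t\<^sup>2) 1 / 9) \<le> c * (1 - sin t / t)" by (intro mult_left_mono) (auto simp: c_def)
  with ge have "c * (min (t\<^sup>2) 1 / 9) \<le> disc_const p - disc_char p \<xi>" by linarith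
  then show ?thesis by (simp add: c_def t_def)
qed

lemma nn_integral_exp_tail:
  assumes "0 \<le> N"
  shows "(\<integral>\<^sup>+ s. ennreal (exp (- s)) * indicator {N..} s \<partial>lborel) = ennreal (exp (- N))"
proof -
  have "(\<integral>\<^sup>+ s. ennreal (exp (- s)) * indicator {N..} s \<partial>lborel) = ennreal (0 - (- exp (- N)))"
  proof (rule nn_integral_FTC_atLeast)
    have "((\<lambda>s. exp (- s)) \<longlongrightarrow> (0::real)) at_top"
      by (rule filterlim_compose[OF exp_at_bot filterlim_uminus_at_bot_at_top])
    then show "((\<lambda>s. - exp (- s)) \<longlongrightarrow> (0::real)) at_top" using tendsto_minus by fastforce
  qed (auto intro!: derivative_eq_intros)
  then show ?thesis by simp
qed

text \<open>The mean of \<open>cos (t * y)\<close> over a symmetric interval is sin(t h) / (t h),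
  which is at least - 1 / 2: it is nonnegative for t h up to pi and at least - 1 / pi beyond. Adding
  1 keeps the integrands nonnegative.\<close>

lemma nn_integral_symmetric_interval_cos:
  assumes t: "0 < t" and h: "0 \<le> h"
  shows "(\<integral>\<^sup>+ y. ennreal (1 / 2) * indicator {-h..h} y \<partial>lborel)
       \<le> (\<integral>\<^sup>+ y. ennreal (1 + cos (t * y)) * indicator {-h..h} y \<partial>lborel)"
proof -
  have "(\<integral>\<^sup>+ y. ennreal (1 + cos (t * y)) * indicator {-h..h} y \<partial>lborel)
      = ennreal ((h + sin (t * h) / t) - (- h + sin (t * (- h)) / t))"
  proof (rule nn_integral_FTC_Icc)
    show "((\<lambda>y. y + sin (t * y) / t) has_real_derivative 1 + cos (t * y)) (at y)" for y
      using t by (auto intro!: derivative_eq_intros)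
    show "0 \<le> 1 + cos (t * y)" for y using cos_ge_minus_one[of "t * y"] by linarith
  qed (use h in auto)
  moreover have "- (t * h) / 2 \<le> sin (t * h)"
  proof (cases "t * h \<le> pi")
    case True
    moreover have th: "0 \<le> t * h" using t h by simp
    ultimately have "0 \<le> sin (t * h)" by (intro sin_ge_zero)
    then show ?thesis using th by linarith
  next
    case False
    then show ?thesis using sin_ge_minus_one[of "t * h"] pi_gt3 by linarith
  qed
  then have "- (t * h) / 2 / t \<le> sin (t * h) / t" using t by (intro divide_right_mono) auto
  then have "- h / 2 \<le> sin (t * h) / t" using t by simp
  moreover have "(\<integral>\<^sup>+ y. ennreal (1 / 2) * indicator {-h..h} y \<partial>lborel) = ennreal (1 / 2 * (2 * h))"
  proof -
    have "(\<integral>\<^sup>+ y. ennreal (1 / 2) * indicator {-h..h} y \<partial>lborel) = ennreal (1 / 2) * ennreal (2 * h)"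
      using h by (subst nn_integral_cmult) auto
    also have "\<dots> = ennreal (1 / 2 * (2 * h))" by (rule ennreal_mult'[symmetric]) simp
    finally show ?thesis .
  qed
  ultimately show ?thesis by (simp add: ennreal_leI)
qed

text \<open>The layer-cake formula writes the density as a mixture of disc indicators, and each
  vertical chord of a disc centred at the origin is a symmetric interval. The one-dimensional bound
  therefore applies chord by chord, with no need to evaluate the transform of a disc.\<close>

lemma disc_char_ge_neg_half:
  assumes p: "0 < p"
  shows "- disc_const p / 2 \<le> disc_char p \<xi>"
proof (cases "\<xi> = 0")
  case True
  then show ?thesis using disc_const_pos[OF p] by (simp add: disc_char_def integral_exp_cmod_powr[OF p])
next
  case False
  define t where "t = cmod \<xi>"
  have t: "0 < t" using False by (simp add: t_def)
  have layer: "(\<integral>\<^sup>+ z. ennreal (exp (- (cmod z powr p))) * ennreal (g (Im z)) \<partial>lborel)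
      = (\<integral>\<^sup>+ s. ennreal (exp (- s)) * (\<integral>\<^sup>+ x. (\<integral>\<^sup>+ y. ennreal (g y) * indicator {- s..0} (- (cmod (Complex x y) powr p)) \<partial>lborel) \<partial>lborel) \<partial>lborel)"
    if [measurable]: "g \<in> borel_measurable borel" for g :: "real \<Rightarrow> real"
  proof -
    \<comment> \<open>Both sides say that \<open>cmod z powr p \<le> s\<close>; the right one reads
      this as a condition on \<open>z\<close> for fixed \<open>s\<close>, as the exchange of
      integrals requires. For negative \<open>s\<close> the interval is empty.\<close>
    have ind: "indicator {cmod z powr p..} s = (indicator {- s..0} (- (cmod z powr p)) :: ennreal)" for z s
      by (auto simp: indicator_def)
    have m[measurable]: "(\<lambda>(s, z). indicator {- s..0} (- (cmod z powr p)) :: ennreal) \<in> borel_measurable (lborel \<Otimes>\<^sub>M lborel)"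
    proof -
      have "(\<lambda>(s, z). indicator {q. - fst q \<le> - (cmod (snd q) powr p)} (s, z) :: ennreal) \<in> borel_measurable (lborel \<Otimes>\<^sub>M lborel)"
        by measurable
      then show ?thesis by (simp add: indicator_def case_prod_beta' cong: measurable_cong)
    qed
    have "(\<integral>\<^sup>+ z. ennreal (exp (- (cmod z powr p))) * ennreal (g (Im z)) \<partial>lborel)
        = (\<integral>\<^sup>+ z. (\<integral>\<^sup>+ s. ennreal (exp (- s)) * (ennreal (g (Im z)) * indicator {- s..0} (- (cmod z powr p))) \<partial>lborel) \<partial>lborel)"
    proof (rule nn_integral_cong)
      fix z :: complex
      have "ennreal (exp (- (cmod z powr p))) * ennreal (g (Im z))
          = (\<integral>\<^sup>+ s. ennreal (exp (- s)) * indicator {cmod z powr p..} s \<partial>lborel) * ennreal (g (Im z))"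
        by (simp only: nn_integral_exp_tail[OF powr_ge_zero])
      also have "\<dots> = (\<integral>\<^sup>+ s. ennreal (exp (- s)) * indicator {cmod z powr p..} s * ennreal (g (Im z)) \<partial>lborel)"
        by (rule nn_integral_multc[symmetric]) simp
      finally show "ennreal (exp (- (cmod z powr p))) * ennreal (g (Im z))
          = (\<integral>\<^sup>+ s. ennreal (exp (- s)) * (ennreal (g (Im z)) * indicator {- s..0} (- (cmod z powr p))) \<partial>lborel)"
        by (simp only: ind mult.assoc mult.commute[of "ennreal (g (Im z))"])
    qed
    also have "\<dots> = (\<integral>\<^sup>+ s. (\<integral>\<^sup>+ z. ennreal (exp (- s)) * (ennreal (g (Im z)) * indicator {- s..0} (- (cmod z powr p))) \<partial>lborel) \<partial>lborel)"
      by (rule lborel_pair.Fubini') measurable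
    also have "\<dots> = (\<integral>\<^sup>+ s. ennreal (exp (- s)) * (\<integral>\<^sup>+ z. ennreal (g (Im z)) * indicator {- s..0} (- (cmod z powr p)) \<partial>lborel) \<partial>lborel)"
      by (intro nn_integral_cong nn_integral_cmult) measurable
    also have "\<dots> = (\<integral>\<^sup>+ s. ennreal (exp (- s)) * (\<integral>\<^sup>+ x. (\<integral>\<^sup>+ y. ennreal (g y) * indicator {- s..0} (- (cmod (Complex x y) powr p)) \<partial>lborel) \<partial>lborel) \<partial>lborel)"
      by (subst nn_integral_complex) auto
    finally show ?thesis .
  qed
  have "(\<integral>\<^sup>+ z. ennreal (exp (- (cmod z powr p))) * ennreal (1 / 2) \<partial>lborel)
      \<le> (\<integral>\<^sup>+ z. ennreal (exp (- (cmod z powr p))) * ennreal (1 + cos (t * Im z)) \<partial>lborel)"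
    unfolding layer[OF borel_measurable_const] layer[of "\<lambda>y. 1 + cos (t * y)", simplified]
  proof (rule nn_integral_mono, rule mult_left_mono, rule nn_integral_mono)
    fix s x :: real
    show "(\<integral>\<^sup>+ y. ennreal (1 / 2) * indicator {- s..0} (- (cmod (Complex x y) powr p)) \<partial>lborel)
        \<le> (\<integral>\<^sup>+ y. ennreal (1 + cos (t * y)) * indicator {- s..0} (- (cmod (Complex x y) powr p)) \<partial>lborel)"
    \<comment> \<open>In this case the vertical line through \<open>x\<close> meets the disc in a
      chord of half-length \<open>h\<close>; otherwise it misses the disc and both sides
      vanish.\<close>
    proof (cases "0 \<le> s \<and> \<bar>x\<bar> \<le> s powr (1 / p)")
      case True
      define h where "h = sqrt ((s powr (1 / p))\<^sup>2 - x\<^sup>2)"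
      have x2: "x\<^sup>2 \<le> (s powr (1 / p))\<^sup>2" using True by (metis abs_le_square_iff abs_of_nonneg powr_ge_zero)
      then have h: "0 \<le> h" and h2: "h\<^sup>2 = (s powr (1 / p))\<^sup>2 - x\<^sup>2" by (auto simp: h_def)
      have "cmod (Complex x y) powr p \<le> s \<longleftrightarrow> y \<in> {-h..h}" for y
      proof -
        have "cmod (Complex x y) \<le> s powr (1 / p) \<longleftrightarrow> (cmod (Complex x y))\<^sup>2 \<le> (s powr (1 / p))\<^sup>2"
          using abs_le_square_iff[of "cmod (Complex x y)" "s powr (1 / p)"] by simp
        also have "\<dots> \<longleftrightarrow> y\<^sup>2 \<le> h\<^sup>2" by (auto simp: cmod_power2 h2)
        also have "\<dots> \<longleftrightarrow> y \<in> {-h..h}" using abs_le_square_iff[of y h] h by (auto simp: abs_le_iff)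
        finally show ?thesis using cmod_powr_le_iff[OF p, of s] True by simp
      qed
      then have "indicator {- s..0} (- (cmod (Complex x y) powr p)) = (indicator {-h..h} y :: ennreal)" for y
        by (auto simp: indicator_def)
      then show ?thesis using nn_integral_symmetric_interval_cos[OF t h] by simp
    next
      case False
      have "\<not> cmod (Complex x y) powr p \<le> s" for y
      proof
        assume *: "cmod (Complex x y) powr p \<le> s"
        then have s: "0 \<le> s" using powr_ge_zero order_trans by blast
        with * have "cmod (Complex x y) \<le> s powr (1 / p)" using cmod_powr_le_iff[OF p] by blast
        then have "\<bar>x\<bar> \<le> s powr (1 / p)" using abs_Re_le_cmod[of "Complex x y"] by simp
        with s False show False by simp
      qed
      then show ?thesis by (simp add: indicator_def)
    qed
  qed simp
  also have "\<dots> = ennreal (disc_const p + disc_char p \<xi>)"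
  proof -
    have nn: "0 \<le> 1 + cos (t * y)" for y using cos_ge_minus_one[of "t * y"] by linarith
    have int: "integrable lborel (\<lambda>z. exp (- (cmod z powr p)) * (1 + cos (t * Im z)))"
      using integrable_exp_cmod_powr[OF p] integrable_exp_cos[OF p, of "\<i> * t"]
      by (simp add: distrib_left inner_complex_def)
    have "(\<integral>z. exp (- (cmod z powr p)) * (1 + cos (t * Im z)) \<partial>lborel) = disc_const p + disc_char p \<xi>"
      using integrable_exp_cmod_powr[OF p] integrable_exp_cos[OF p, of "\<i> * t"]
      by (simp add: distrib_left inner_complex_def disc_char_norm t_def integral_exp_cmod_powr[OF p])
    then show ?thesis using nn_integral_eq_integral[OF int] nn by (simp add: ennreal_mult[symmetric])
  qed
  also have "(\<integral>\<^sup>+ z. ennreal (exp (- (cmod z powr p))) * ennreal (1 / 2) \<partial>lborel) = ennreal (disc_const p / 2)"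
  proof -
    have "(\<integral>\<^sup>+ z. ennreal (exp (- (cmod z powr p))) * ennreal (1 / 2) \<partial>lborel) = ennreal (disc_const p) * ennreal (1 / 2)"
      unfolding nn_integral_exp_cmod_powr[OF p, symmetric] by (rule nn_integral_multc) simp
    also have "\<dots> = ennreal (disc_const p * (1 / 2))" by (rule ennreal_mult''[symmetric]) simp
    finally show ?thesis by simp
  qed
  finally show ?thesis
    using abs_disc_char_le[OF p, of \<xi>] by (simp add: ennreal_le_iff)
qed

section \<open>Plancherel estimates for the square\<close>

lemma
  assumes "0 < \<delta>"
  shows integrable_gauss_kernel: "integrable lborel (gauss_kernel \<delta>)"
    and integral_gauss_kernel: "(\<integral>w. gauss_kernel \<delta> w \<partial>lborel) = 1"
  using nn_integral_gauss_kernel[OF assms] gauss_kernel_nonneg[of \<delta>]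
  by (auto intro!: integrableI_nonneg integral_eq_nn_integral[THEN trans])

text \<open>In the Plancherel identity the inner density is at most 1, and the kernel then has
  integral \<open>1 / s\<^sup>2\<close> in \<open>z'\<close>. The bound does not involve \<delta>;
  with \<open>s\<^sup>2 = 1 / n\<close> it puts the factor \<open>n\<close> into the error terms for
  the diagonal.\<close>

lemma disc_char_square_tail:
  assumes p: "0 < p" and \<delta>: "0 < \<delta>" and s: "0 < s"
  shows "(\<integral>\<xi>. gauss_weight \<delta> \<xi> * (disc_char p (s *\<^sub>R \<xi>))\<^sup>2 \<partial>lborel) / (2 * pi)\<^sup>2 \<le> disc_const p / s\<^sup>2"
proof -
  define e where "e z = exp (- (cmod z powr p))" for z :: complex
  have e: "0 \<le> e z" "e z \<le> 1" for z by (auto simp: e_def)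
  have inner: "(\<integral>z'. e z' * gauss_kernel \<delta> (s *\<^sub>R (z + z')) \<partial>lborel) \<le> 1 / s\<^sup>2" for z
  proof -
    have "(\<integral>z'. gauss_kernel \<delta> (s *\<^sub>R z + s *\<^sub>R z') \<partial>lborel) = 1 / s\<^sup>2"
      using s \<delta> by (subst integral_lborel_affine) (auto simp: integral_gauss_kernel divide_inverse)
    \<comment> \<open>The Bochner integral of a non-integrable function is 0, so the positive value
      just computed certifies integrability.\<close>
    moreover have "integrable lborel (\<lambda>z'. gauss_kernel \<delta> (s *\<^sub>R z + s *\<^sub>R z'))"
      using not_integrable_integral_eq[of lborel "\<lambda>z'. gauss_kernel \<delta> (s *\<^sub>R z + s *\<^sub>R z')"] calculation s by auto
    ultimately show ?thesis
      using integral_mono'[of lborel "\<lambda>z'. gauss_kernel \<delta> (s *\<^sub>R z + s *\<^sub>R z')" "\<lambda>z'. e z' * gauss_kernel \<delta> (s *\<^sub>R (z + z'))"]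
        e gauss_kernel_nonneg[of \<delta>] by (auto simp: scaleR_add_right intro: mult_left_le_one_le)
  qed
  have "(\<integral>z. e z * (\<integral>z'. e z' * gauss_kernel \<delta> (s *\<^sub>R (z + z')) \<partial>lborel) \<partial>lborel) \<le> (\<integral>z. e z * (1 / s\<^sup>2) \<partial>lborel)"
  proof (rule integral_mono')
    show "integrable lborel (\<lambda>z. e z * (1 / s\<^sup>2))"
      unfolding e_def by (intro integrable_mult_left integrable_exp_cmod_powr[OF p])
    show "e z * (\<integral>z'. e z' * gauss_kernel \<delta> (s *\<^sub>R (z + z')) \<partial>lborel) \<le> e z * (1 / s\<^sup>2)" for z
      by (intro mult_left_mono inner e)
  qed (use e in auto)
  also have "\<dots> = disc_const p / s\<^sup>2" using integral_exp_cmod_powr[OF p] by (simp add: e_def)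
  finally show ?thesis unfolding integral_disc_char_square[OF p \<delta>] e_def .
qed

lemma integral_exp_cmod_powr_sq:
  assumes p: "0 < p"
  shows "(\<integral>z. exp (- (cmod z powr p)) * exp (- (cmod z powr p)) \<partial>lborel) = 2 powr (- 2 / p) * disc_const p"
proof -
  define c where "c = 2 powr (1 / p)"
  have c: "0 < c" "c powr p = 2" using p by (auto simp: c_def powr_powr)
  have "(\<integral>z. exp (- (cmod z powr p)) * exp (- (cmod z powr p)) \<partial>lborel) = (\<integral>z. exp (- (cmod (0 + c *\<^sub>R z) powr p)) \<partial>lborel)"
    using c by (intro Bochner_Integration.integral_cong refl) (simp add: exp_add[symmetric] powr_mult)
  also have "\<dots> = disc_const p / c\<^sup>2"
    using c by (subst integral_lborel_affine) (auto simp: integral_exp_cmod_powr[OF p] divide_inverse)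
  also have "c\<^sup>2 = 2 powr (2 / p)" by (simp add: c_def powr_powr flip: powr_realpow)
  finally show ?thesis by (simp add: powr_minus divide_inverse mult.commute)
qed

text \<open>The substitution \<open>z' = - z + sqrt 2 * \<delta> * u\<close> fixes the kernel and
  contributes the Jacobian 2. As \<delta> tends to 0 the inner factor tends to the density at - z,
  that is at z, leaving the integral of the squared density.\<close>

lemma disc_char_square_limit:
  assumes p: "0 < p" and \<delta>: "\<And>m. 0 < \<delta> m" "\<delta> \<longlonglongrightarrow> 0"
  shows "(\<lambda>m. (\<integral>\<xi>. gauss_weight (\<delta> m) \<xi> * (disc_char p ((1 / sqrt 2) *\<^sub>R \<xi>))\<^sup>2 \<partial>lborel) / (2 * pi)\<^sup>2)
    \<longlonglongrightarrow> 2 * (2 powr (- 2 / p) * disc_const p)"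
proof -
  define e where "e z = exp (- (cmod z powr p))" for z :: complex
  have e: "0 \<le> e z" "e z \<le> 1" "e (- z) = e z" for z by (auto simp: e_def)
  have [measurable]: "e \<in> borel_measurable borel" unfolding e_def by measurable
  have e_cont: "(\<lambda>m. e (f m)) \<longlonglongrightarrow> e a" if "f \<longlonglongrightarrow> a" for f a
    unfolding e_def using p that by (intro tendsto_intros tendsto_powr') auto
  define I where "I m z = (\<integral>u. e (sqrt 2 *\<^sub>R \<delta> m *\<^sub>R u - z) * gauss_kernel 1 u \<partial>lborel)" for m z
  have I: "(\<integral>z'. e z' * gauss_kernel (\<delta> m) ((1 / sqrt 2) *\<^sub>R (z + z')) \<partial>lborel) = 2 * I m z" for m z
  proof -
    let ?h = "\<lambda>z'. e z' * gauss_kernel (\<delta> m) ((1 / sqrt 2) *\<^sub>R (z + z'))"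
    define c where "c = sqrt 2 * \<delta> m"
    have c: "c \<noteq> 0" "c\<^sup>2 = 2 * (\<delta> m)\<^sup>2" using \<delta>(1)[of m] by (auto simp: c_def power_mult_distrib)
    have "(\<integral>u. ?h (- z + c *\<^sub>R u) \<partial>lborel) = (\<integral>z'. ?h z' \<partial>lborel) /\<^sub>R \<bar>c\<bar> ^ DIM(complex)"
      by (rule integral_lborel_affine) (use c in auto)
    moreover have "?h (- z + c *\<^sub>R u) = (e (sqrt 2 *\<^sub>R \<delta> m *\<^sub>R u - z) * gauss_kernel 1 u) / (\<delta> m)\<^sup>2" for u
      using gauss_kernel_scale[OF \<delta>(1), of m u] by (simp add: c_def)
    ultimately have "I m z / (\<delta> m)\<^sup>2 = (\<integral>z'. ?h z' \<partial>lborel) / c\<^sup>2"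
      by (simp only: integral_divide_zero I_def) (simp add: divide_inverse mult.commute)
    moreover have "x = 2 * y" if "y / d = x / (2 * d)" "d \<noteq> 0" for x y d :: real
      using that by (simp add: field_simps)
    ultimately show ?thesis using \<delta>(1)[of m] unfolding c(2) by simp
  qed
  have int1: "integrable lborel (gauss_kernel 1)" by (rule integrable_gauss_kernel) simp
  have I_lim: "(\<lambda>m. I m z) \<longlonglongrightarrow> e z" for z
  proof -
    have "(\<lambda>m. I m z) \<longlonglongrightarrow> (\<integral>u. e (- z) * gauss_kernel 1 u \<partial>lborel)"
      unfolding I_def
    proof (rule integral_dominated_convergence[where w="gauss_kernel 1"])
      show "AE u in lborel. (\<lambda>m. e (sqrt 2 *\<^sub>R \<delta> m *\<^sub>R u - z) * gauss_kernel 1 u) \<longlonglongrightarrow> e (- z) * gauss_kernel 1 u"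
      proof (intro AE_I2 tendsto_mult tendsto_const e_cont)
        fix u
        have "(\<lambda>m. sqrt 2 *\<^sub>R \<delta> m *\<^sub>R u - z) \<longlonglongrightarrow> sqrt 2 *\<^sub>R 0 *\<^sub>R u - z" by (intro tendsto_intros \<delta>)
        then show "(\<lambda>m. sqrt 2 *\<^sub>R \<delta> m *\<^sub>R u - z) \<longlonglongrightarrow> - z" by simp
      qed
    qed (use int1 e gauss_kernel_nonneg[of 1] in \<open>auto simp: abs_mult intro!: AE_I2 mult_left_le_one_le\<close>)
    then show ?thesis using integral_gauss_kernel[of 1] e by simp
  qed
  have I_bnd: "\<bar>I m z\<bar> \<le> 1" for m z
  proof -
    have "I m z \<le> (\<integral>u. gauss_kernel 1 u \<partial>lborel)"
      unfolding I_def by (rule integral_mono'[OF int1]) (use e gauss_kernel_nonneg[of 1] in \<open>auto intro: mult_left_le_one_le\<close>)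
    moreover have "0 \<le> I m z" unfolding I_def using e gauss_kernel_nonneg[of 1] by (intro integral_nonneg_AE) auto
    ultimately show ?thesis by (simp add: integral_gauss_kernel)
  qed
  have "(\<lambda>m. \<integral>z. e z * (2 * I m z) \<partial>lborel) \<longlonglongrightarrow> (\<integral>z. e z * (2 * e z) \<partial>lborel)"
  proof (rule integral_dominated_convergence[where w="\<lambda>z. 2 * e z"])
    show "(\<lambda>z. e z * (2 * I m z)) \<in> borel_measurable lborel" for m unfolding I_def by measurable
    show "integrable lborel (\<lambda>z. 2 * e z)" unfolding e_def by (intro integrable_mult_right integrable_exp_cmod_powr[OF p])
    show "AE z in lborel. (\<lambda>m. e z * (2 * I m z)) \<longlonglongrightarrow> e z * (2 * e z)"
      by (intro AE_I2 tendsto_intros I_lim)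
    show "AE z in lborel. norm (e z * (2 * I m z)) \<le> 2 * e z" for m
      using I_bnd e by (intro AE_I2) (auto simp: abs_mult intro: mult_left_le)
  qed measurable
  moreover have "(\<integral>z. e z * (2 * e z) \<partial>lborel) = 2 * (2 powr (- 2 / p) * disc_const p)"
    unfolding integral_exp_cmod_powr_sq[OF p, symmetric] e_def
    by (simp only: integral_mult_right_zero[symmetric] mult.left_commute)
  ultimately show ?thesis
    unfolding integral_disc_char_square[OF p \<delta>(1)] e_def[symmetric] I by simp
qed

subsection \<open>Bounds on the diagonal section\<close>

definition vanish_seq :: "nat \<Rightarrow> real" where "vanish_seq m = inverse (real (Suc m))"

lemma vanish_seq: "0 < vanish_seq m" "vanish_seq \<longlonglongrightarrow> 0"
  unfolding vanish_seq_def[abs_def] using LIMSEQ_inverse_real_of_nat by auto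

lemma disc_char_0: "0 < p \<Longrightarrow> disc_char p 0 = disc_const p"
  by (simp add: disc_char_def integral_exp_cmod_powr)

text \<open>Each of the \<open>n - 2\<close> vanishing coordinates contributes
  \<open>disc_char p 0 = disc_const p\<close>. Against the normalising power \<open>n - 1\<close>
  this leaves one factor \<open>1 / disc_const p\<close>, which cancels the constant in the
  Plancherel limit.\<close>

lemma section_ratio_two_dir:
  assumes n: "2 \<le> n" and p: "2 \<le> p"
  shows "section_ratio n p (two_dir n) = 2 powr (1 - 2 / p)"
proof -
  define \<alpha> :: "nat \<Rightarrow> real" where "\<alpha> j = (if j < 2 then 1 / sqrt 2 else 0)" for j
  define K where "K = disc_const p"
  have K: "0 < K" using disc_const_pos[of p] p by (simp add: K_def)
  obtain k where k: "n = Suc (Suc k)" using n by (metis Suc_le_D numeral_2_eq_2 Suc_le_mono)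
  have dir: "two_dir n = (\<lambda>j\<in>{..<n}. complex_of_real (\<alpha> j))"
    by (auto simp: two_dir_def \<alpha>_def fun_eq_iff)
  have \<alpha>: "(\<Sum>j<n. (\<alpha> j)\<^sup>2) = 1" "\<alpha> 0 < 1"
    by (auto simp: k sum.lessThan_Suc_shift \<alpha>_def power_divide simp del: sum.lessThan_Suc)
  have prod: "(\<Prod>j<n. disc_char p (\<alpha> j *\<^sub>R \<xi>)) = (disc_char p ((1 / sqrt 2) *\<^sub>R \<xi>))\<^sup>2 * K ^ k" for \<xi>
    using p by (simp add: k prod.lessThan_Suc_shift \<alpha>_def disc_char_0 K_def power2_eq_square del: prod.lessThan_Suc)
  have eq: "(\<integral>\<xi>. gauss_weight (vanish_seq m) \<xi> * ((disc_char p ((1 / sqrt 2) *\<^sub>R \<xi>))\<^sup>2 * K ^ k) \<partial>lborel) / (2 * pi)\<^sup>2 / K ^ (n - 1)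
      = (\<integral>\<xi>. gauss_weight (vanish_seq m) \<xi> * (disc_char p ((1 / sqrt 2) *\<^sub>R \<xi>))\<^sup>2 \<partial>lborel) / (2 * pi)\<^sup>2 / K" for m
    using K by (simp add: mult.assoc[symmetric] k)
  have "(\<lambda>m. (\<integral>\<xi>. gauss_weight (vanish_seq m) \<xi> * ((disc_char p ((1 / sqrt 2) *\<^sub>R \<xi>))\<^sup>2 * K ^ k) \<partial>lborel) / (2 * pi)\<^sup>2 / K ^ (n - 1))
      \<longlonglongrightarrow> section_ratio n p (two_dir n)"
    using section_ratio_limit[OF n p vanish_seq \<alpha>] unfolding prod dir K_def[symmetric] .
  then have "(\<lambda>m. (\<integral>\<xi>. gauss_weight (vanish_seq m) \<xi> * (disc_char p ((1 / sqrt 2) *\<^sub>R \<xi>))\<^sup>2 \<partial>lborel) / (2 * pi)\<^sup>2 / K)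
      \<longlonglongrightarrow> section_ratio n p (two_dir n)"
    unfolding eq .
  moreover have "(\<lambda>m. (\<integral>\<xi>. gauss_weight (vanish_seq m) \<xi> * (disc_char p ((1 / sqrt 2) *\<^sub>R \<xi>))\<^sup>2 \<partial>lborel) / (2 * pi)\<^sup>2 / K)
      \<longlonglongrightarrow> 2 * (2 powr (- 2 / p) * K) / K"
    unfolding K_def
    using p K by (intro tendsto_divide disc_char_square_limit vanish_seq tendsto_const) (auto simp: K_def)
  ultimately have "section_ratio n p (two_dir n) = 2 * (2 powr (- 2 / p) * K) / K"
    by (rule LIMSEQ_unique)
  also have "\<dots> = 2 powr 1 * 2 powr (- 2 / p)" using K by simp
  also have "\<dots> = 2 powr (1 - 2 / p)" unfolding powr_add[symmetric] by simp
  finally show ?thesis .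
qed

definition gauss_limit :: "real \<Rightarrow> real" where
  "gauss_limit p = 2 * (Gamma (1 + 2 / p))\<^sup>2 / Gamma (1 + 4 / p)"

text \<open>This is \<open>disc_const p\<close> times 1 / (pi m), the density at the origin of the
  rotation-invariant Gaussian with second moment \<open>m = disc_moment p / disc_const p\<close>, as
  the central limit theorem predicts.\<close>

lemma gauss_limit_eq: "gauss_limit p = (disc_const p)\<^sup>2 / (pi * disc_moment p)"
  by (simp add: gauss_limit_def disc_const_def disc_moment_def power2_eq_square)

lemma section_ratio_diag_limit:
  assumes n: "2 \<le> n" and p: "2 \<le> p"
  shows "(\<lambda>m. (\<integral>\<xi>. gauss_weight (vanish_seq m) \<xi> * disc_char p ((1 / sqrt n) *\<^sub>R \<xi>) ^ n \<partial>lborel) / (2 * pi)\<^sup>2 / disc_const p ^ (n - 1))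
      \<longlonglongrightarrow> section_ratio n p (diag_dir n)"
proof -
  have "(\<Sum>j<n. (1 / sqrt n)\<^sup>2) = 1" using n by (simp add: power_divide)
  moreover have "1 / sqrt n < 1" using n by simp
  ultimately show ?thesis
    using section_ratio_limit[OF n p vanish_seq, of "\<lambda>_. 1 / sqrt n"] by (simp add: diag_dir_def)
qed

lemma integrable_weighted_disc_char_power:
  assumes p: "0 < p" and \<delta>: "0 < \<delta>"
  shows "integrable lborel (\<lambda>\<xi>. gauss_weight \<delta> \<xi> * disc_char p (s *\<^sub>R \<xi>) ^ k)"
proof (rule Bochner_Integration.integrable_bound[OF integrable_mult_left[OF integrable_gauss_weight[OF \<delta>]]])
  have "\<bar>disc_char p \<xi>\<bar> ^ k \<le> \<bar>disc_const p ^ k\<bar>" for \<xi>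
    using abs_disc_char_le[OF p, of \<xi>] disc_const_pos[OF p] by (simp add: power_mono)
  then show "AE \<xi> in lborel. norm (gauss_weight \<delta> \<xi> * disc_char p (s *\<^sub>R \<xi>) ^ k) \<le> norm (gauss_weight \<delta> \<xi> * disc_const p ^ k)"
    by (intro AE_I2) (auto simp: abs_mult power_abs intro!: mult_left_mono)
qed measurable

text \<open>The source of the factor n / (n + 1): the Gaussian exp(- c k r^2) in the modulus r would
  integrate to pi / (c k), the truncated power integrates to pi / (c (k + 1)).\<close>

lemma
  assumes c: "0 < c" and k: "0 < k"
  shows integrable_truncated_power: "integrable lborel (\<lambda>\<xi>. max 0 (1 - c * (cmod \<xi>)\<^sup>2) ^ k)"
    and integral_truncated_power: "(\<integral>\<xi>. max 0 (1 - c * (cmod \<xi>)\<^sup>2) ^ k \<partial>lborel) = pi / (c * (k + 1))"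
proof -
  have "(\<integral>\<^sup>+ \<xi>. ennreal (max 0 (1 - c * (cmod \<xi>)\<^sup>2) ^ k) \<partial>lborel)
      = ennreal pi * (\<integral>\<^sup>+ t. ennreal (max 0 (1 - c * t) ^ k) * indicator {0..} t \<partial>lborel)"
    by (rule nn_integral_cmod_sq) auto
  also have "(\<integral>\<^sup>+ t. ennreal (max 0 (1 - c * t) ^ k) * indicator {0..} t \<partial>lborel)
      = (\<integral>\<^sup>+ t. ennreal ((1 - c * t) ^ k) * indicator {0..1 / c} t \<partial>lborel)"
    using c k by (intro nn_integral_cong) (auto simp: indicator_def field_simps max_def)
  also have "\<dots> = ennreal ((- ((1 - c * (1 / c)) ^ Suc k) / (c * (k + 1))) - (- ((1 - c * 0) ^ Suc k) / (c * (k + 1))))"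
  proof (rule nn_integral_FTC_Icc)
    fix t assume t: "t \<in> {0..1 / c}"
    show "((\<lambda>t. - ((1 - c * t) ^ Suc k) / (c * (k + 1))) has_real_derivative (1 - c * t) ^ k) (at t)"
      using c by (auto intro!: derivative_eq_intros simp del: power_Suc)
    show "0 \<le> (1 - c * t) ^ k" using t c by (simp add: field_simps)
  qed (use c in auto)
  finally have *: "(\<integral>\<^sup>+ \<xi>. ennreal (max 0 (1 - c * (cmod \<xi>)\<^sup>2) ^ k) \<partial>lborel) = ennreal (pi / (c * (k + 1)))"
    using c by (simp add: ennreal_mult[symmetric])
  then show "integrable lborel (\<lambda>\<xi>. max 0 (1 - c * (cmod \<xi>)\<^sup>2) ^ k)"
    by (intro integrableI_nonneg) auto
  show "(\<integral>\<xi>. max 0 (1 - c * (cmod \<xi>)\<^sup>2) ^ k \<partial>lborel) = pi / (c * (k + 1))"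
    using * c by (subst integral_eq_nn_integral) auto
qed

text \<open>The constant \<open>c\<close> makes \<open>K * (1 - c * (cmod \<xi>)\<^sup>2)\<close>
  the quadratic minorant at the rescaled point. The truncated power yields the main term; the error
  is \<open>(K / 2) ^ (n - 2)\<close> times the Plancherel bound \<open>K * n\<close>, divided by
  \<open>K ^ (n - 1)\<close>.\<close>

lemma section_ratio_diag_ge:
  assumes n: "2 \<le> n" and p: "2 \<le> p"
  shows "gauss_limit p * (n / (n + 1)) - n * (1 / 2) ^ (n - 2) \<le> section_ratio n p (diag_dir n)"
proof -
  define K M where "K = disc_const p" and "M = disc_moment p"
  have K: "0 < K" and M: "0 < M" using disc_const_pos[of p] disc_moment_pos[of p] p by (auto simp: K_def M_def)
  have p0: "0 < p" using p by simp
  define s where "s = 1 / sqrt n"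
  have s: "0 < s" "s\<^sup>2 = 1 / n" using n by (auto simp: s_def power_divide)
  define c where "c = s\<^sup>2 * M / (4 * K)"
  have c: "0 < c" using K M s(1) by (simp add: c_def)
  define f where "f \<xi> = max 0 (1 - c * (cmod \<xi>)\<^sup>2) ^ n" for \<xi>
  have f_int: "integrable lborel f" unfolding f_def using n by (intro integrable_truncated_power[OF c]) auto
  have [measurable]: "f \<in> borel_measurable borel" unfolding f_def by measurable
  have f0: "0 \<le> f \<xi>" for \<xi> by (simp add: f_def)
  let ?\<Phi> = "\<lambda>\<xi>. disc_char p (s *\<^sub>R \<xi>)"
  let ?g = "\<lambda>m. gauss_weight (vanish_seq m)"
  let ?P2 = "\<lambda>m. \<integral>\<xi>. ?g m \<xi> * (?\<Phi> \<xi>)\<^sup>2 \<partial>lborel" and ?Pn = "\<lambda>m. \<integral>\<xi>. ?g m \<xi> * ?\<Phi> \<xi> ^ n \<partial>lborel" and ?F = "\<lambda>m. \<integral>\<xi>. ?g m \<xi> * f \<xi> \<partial>lborel"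
  obtain k where k: "n = Suc (Suc k)" using n by (metis Suc_le_D numeral_2_eq_2 Suc_le_mono)
  \<comment> \<open>Only negative values can do harm where \<open>f\<close> vanishes, and there the
    modulus is at most \<open>K / 2\<close>. Two factors stay untouched so that the remainder is a
    square with a bounded weighted integral.\<close>
  have pw: "K ^ n * f \<xi> - (K / 2) ^ k * (?\<Phi> \<xi>)\<^sup>2 \<le> ?\<Phi> \<xi> ^ n" for \<xi>
  proof (cases "c * (cmod \<xi>)\<^sup>2 < 1")
    case True
    have "K * (1 - c * (cmod \<xi>)\<^sup>2) \<le> ?\<Phi> \<xi>"
      using disc_char_ge_quadratic[OF p0, of "s *\<^sub>R \<xi>"] K
      by (simp add: c_def K_def[symmetric] M_def[symmetric] power_mult_distrib right_diff_distrib mult_ac)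
    then have "(K * (1 - c * (cmod \<xi>)\<^sup>2)) ^ n \<le> ?\<Phi> \<xi> ^ n"
      using True K by (intro power_mono) auto
    moreover have "(K * (1 - c * (cmod \<xi>)\<^sup>2)) ^ n = K ^ n * f \<xi>" using True by (simp add: f_def power_mult_distrib)
    moreover have "0 \<le> (K / 2) ^ k * (?\<Phi> \<xi>)\<^sup>2" using K by simp
    ultimately show ?thesis by linarith
  next
    case False
    then have "f \<xi> = 0" using n by (simp add: f_def)
    moreover have "- ((K / 2) ^ k * (?\<Phi> \<xi>)\<^sup>2) \<le> ?\<Phi> \<xi> ^ n"
    proof (cases "0 \<le> ?\<Phi> \<xi>")
      case True
      then have "0 \<le> ?\<Phi> \<xi> ^ n" "0 \<le> (K / 2) ^ k * (?\<Phi> \<xi>)\<^sup>2" using K by auto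
      then show ?thesis by linarith
    next
      case False
      then have "\<bar>?\<Phi> \<xi>\<bar> \<le> K / 2" using disc_char_ge_neg_half[OF p0, of "s *\<^sub>R \<xi>"] by (simp add: K_def)
      then have "\<bar>?\<Phi> \<xi>\<bar> ^ k * (?\<Phi> \<xi>)\<^sup>2 \<le> (K / 2) ^ k * (?\<Phi> \<xi>)\<^sup>2" by (intro mult_right_mono power_mono) auto
      moreover have "\<bar>?\<Phi> \<xi> ^ n\<bar> = \<bar>?\<Phi> \<xi>\<bar> ^ k * (?\<Phi> \<xi>)\<^sup>2" by (simp add: k power_abs power2_eq_square abs_mult)
      ultimately show ?thesis by linarith
    qed
    ultimately show ?thesis by simp
  qed
  have lower: "K / (2 * pi)\<^sup>2 * ?F m - n * (1 / 2) ^ k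
      \<le> ?Pn m / (2 * pi)\<^sup>2 / K ^ (n - 1)" for m
  proof -
    have g: "0 < ?g m \<xi>" for \<xi> by (rule gauss_weight_pos)
    have i1: "integrable lborel (\<lambda>\<xi>. ?g m \<xi> * f \<xi>)"
      by (rule Bochner_Integration.integrable_bound[OF f_int])
        (use f0 gauss_weight_le gauss_weight_pos in \<open>auto simp: abs_mult less_imp_le intro!: mult_left_le_one_le\<close>)
    have i2: "integrable lborel (\<lambda>\<xi>. ?g m \<xi> * (?\<Phi> \<xi>)\<^sup>2)" "integrable lborel (\<lambda>\<xi>. ?g m \<xi> * ?\<Phi> \<xi> ^ n)"
      by (rule integrable_weighted_disc_char_power[OF p0 vanish_seq(1)])+
    have "K ^ n * ?F m - (K / 2) ^ k * ?P2 m
        = (\<integral>\<xi>. K ^ n * (?g m \<xi> * f \<xi>) - (K / 2) ^ k * (?g m \<xi> * (?\<Phi> \<xi>)\<^sup>2) \<partial>lborel)"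
      using i1 i2 by simp
    also have "\<dots> \<le> ?Pn m"
    proof (rule integral_mono)
      show "K ^ n * (?g m \<xi> * f \<xi>) - (K / 2) ^ k * (?g m \<xi> * (?\<Phi> \<xi>)\<^sup>2) \<le> ?g m \<xi> * ?\<Phi> \<xi> ^ n" for \<xi>
        using mult_left_mono[OF pw less_imp_le[OF g], of \<xi> \<xi>] by (simp add: algebra_simps)
    qed (use i1 i2 in auto)
    finally have 1: "K ^ n * ?F m - (K / 2) ^ k * ?P2 m
        \<le> ?Pn m" .
    have "?P2 m / (2 * pi)\<^sup>2 \<le> K / s\<^sup>2"
      unfolding K_def by (rule disc_char_square_tail[OF p0 vanish_seq(1) s(1)])
    then have "?P2 m \<le> (2 * pi)\<^sup>2 * (K * n)"
      using s(2) by (simp add: divide_le_eq mult.commute)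
    then have "(K / 2) ^ k * ?P2 m \<le> (K / 2) ^ k * ((2 * pi)\<^sup>2 * (K * n))"
      using K by (intro mult_left_mono) auto
    with 1 have "K ^ n * ?F m - (K / 2) ^ k * ((2 * pi)\<^sup>2 * (K * n))
        \<le> ?Pn m" by linarith
    then have "(K ^ n * ?F m - (K / 2) ^ k * ((2 * pi)\<^sup>2 * (K * n))) / ((2 * pi)\<^sup>2 * K ^ Suc k)
        \<le> ?Pn m / ((2 * pi)\<^sup>2 * K ^ Suc k)"
      using K by (intro divide_right_mono) auto
    moreover have "(K ^ n * I - (K / 2) ^ k * ((2 * pi)\<^sup>2 * (K * n))) / ((2 * pi)\<^sup>2 * K ^ Suc k)
        = K / (2 * pi)\<^sup>2 * I - n * (1 / 2) ^ k" for I
      using K unfolding diff_divide_distrib by (simp add: k power_divide)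
    ultimately show ?thesis by (simp add: k)
  qed
  have lim: "(\<lambda>m. \<integral>\<xi>. ?g m \<xi> * f \<xi> \<partial>lborel) \<longlonglongrightarrow> (\<integral>\<xi>. f \<xi> \<partial>lborel)"
  proof (rule integral_dominated_convergence[where w=f])
    show "AE \<xi> in lborel. (\<lambda>m. ?g m \<xi> * f \<xi>) \<longlonglongrightarrow> f \<xi>"
    proof (rule AE_I2)
      fix \<xi>
      have "(\<lambda>m. ?g m \<xi>) \<longlonglongrightarrow> exp (- (0\<^sup>2 * (cmod \<xi>)\<^sup>2 / 2))"
        unfolding gauss_weight_def by (intro tendsto_intros vanish_seq) simp
      then show "(\<lambda>m. ?g m \<xi> * f \<xi>) \<longlonglongrightarrow> f \<xi>" using tendsto_mult_right[of _ 1 _ "f \<xi>"] by simp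
    qed
    show "AE \<xi> in lborel. norm (?g m \<xi> * f \<xi>) \<le> f \<xi>" for m
      by (intro AE_I2) (use f0 gauss_weight_le gauss_weight_pos in \<open>auto simp: abs_mult less_imp_le intro!: mult_left_le_one_le\<close>)
  qed (use f_int in auto)
  have "(\<lambda>m. K / (2 * pi)\<^sup>2 * ?F m - n * (1 / 2) ^ k)
      \<longlonglongrightarrow> K / (2 * pi)\<^sup>2 * (\<integral>\<xi>. f \<xi> \<partial>lborel) - n * (1 / 2) ^ k"
    by (intro tendsto_intros lim)
  from LIMSEQ_le[OF this section_ratio_diag_limit[OF n p, folded K_def s_def]] lower
  have "K / (2 * pi)\<^sup>2 * (\<integral>\<xi>. f \<xi> \<partial>lborel) - n * (1 / 2) ^ k \<le> section_ratio n p (diag_dir n)" by blast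
  moreover have "K / (2 * pi)\<^sup>2 * (\<integral>\<xi>. f \<xi> \<partial>lborel) = gauss_limit p * (n / (n + 1))"
  proof -
    have "(\<integral>\<xi>. f \<xi> \<partial>lborel) = pi / (c * (n + 1))"
      using integral_truncated_power[OF c, of n] n unfolding f_def by simp
    then show ?thesis
      using K M n unfolding gauss_limit_eq K_def[symmetric] M_def[symmetric] c_def s(2)
      by (simp add: power2_eq_square field_simps)
  qed
  ultimately show ?thesis by (simp add: k)
qed

text \<open>Any \<kappa> below the curvature at the origin leaves slack that absorbs the quartic
  term on a small disc, where a Gaussian majorant holds. Outside of it the explicit gap supplies
  \<open>q\<close>.\<close>

lemma disc_char_le_max:
  assumes p: "0 < p" and \<kappa>: "\<kappa> < disc_moment p / (4 * disc_const p)"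
  obtains q :: real where "1 / 2 \<le> q" "q < 1"
    "\<And>\<xi>. disc_char p \<xi> \<le> disc_const p * max (exp (- \<kappa> * (cmod \<xi>)\<^sup>2)) q"
proof -
  define K M where "K = disc_const p" and "M = disc_moment p"
  have K: "0 < K" using disc_const_pos[OF p] by (simp add: K_def)
  obtain C where C: "0 \<le> C" "\<And>\<xi>. disc_char p \<xi> \<le> K - (cmod \<xi>)\<^sup>2 * M / 4 + C * (cmod \<xi>) ^ 4"
    using disc_char_le_quartic[OF p] unfolding K_def M_def by blast
  \<comment> \<open>The squared radius up to which the slack beats the quartic term;
    \<open>C + 1\<close> avoids dividing by zero.\<close>
  define \<eta> where "\<eta> = (M / 4 - K * \<kappa>) / (C + 1)"
  have \<eta>: "0 < \<eta>" using \<kappa> K C(1) by (simp add: \<eta>_def K_def[symmetric] M_def[symmetric] field_simps)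
  have C\<eta>: "C * \<eta> \<le> M / 4 - K * \<kappa>"
  proof -
    have "C * \<eta> \<le> (C + 1) * \<eta>" using \<eta> by (intro mult_right_mono) auto
    then show ?thesis using C(1) by (simp add: \<eta>_def)
  qed
  define c0 where "c0 = exp (- (2 powr (p / 2))) * min \<eta> 1 / 9"
  have c0: "0 < c0" using \<eta> by (simp add: c0_def)
  \<comment> \<open>At least 1 / 2, so that the same \<open>q\<close> also controls the negative
    values of \<open>disc_char\<close>.\<close>
  define q where "q = max (1 / 2) (1 - c0 / K)"
  have "disc_char p \<xi> \<le> K * max (exp (- \<kappa> * (cmod \<xi>)\<^sup>2)) q" for \<xi>
  proof (cases "(cmod \<xi>)\<^sup>2 \<le> \<eta>")
    case True
    have "C * (cmod \<xi>) ^ 4 \<le> (cmod \<xi>)\<^sup>2 * (M / 4 - K * \<kappa>)"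
    proof -
      have "C * (cmod \<xi>) ^ 4 = (cmod \<xi>)\<^sup>2 * (C * (cmod \<xi>)\<^sup>2)" by (simp add: power4_eq_xxxx power2_eq_square)
      also have "\<dots> \<le> (cmod \<xi>)\<^sup>2 * (C * \<eta>)" using True C(1) by (intro mult_left_mono) auto
      also have "\<dots> \<le> (cmod \<xi>)\<^sup>2 * (M / 4 - K * \<kappa>)" using C\<eta> by (intro mult_left_mono) auto
      finally show ?thesis .
    qed
    then have "disc_char p \<xi> \<le> K * (1 - \<kappa> * (cmod \<xi>)\<^sup>2)" using C(2)[of \<xi>] by (simp add: algebra_simps)
    also have "\<dots> \<le> K * max (exp (- \<kappa> * (cmod \<xi>)\<^sup>2)) q"
      using exp_ge_add_one_self[of "- \<kappa> * (cmod \<xi>)\<^sup>2"] K by (intro mult_left_mono) auto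
    finally show ?thesis .
  next
    case False
    have "c0 \<le> exp (- (2 powr (p / 2))) * min ((cmod \<xi>)\<^sup>2) 1 / 9"
      unfolding c0_def using False by (intro divide_right_mono mult_left_mono) auto
    then have "disc_char p \<xi> \<le> K - c0"
      using disc_const_minus_disc_char_ge[OF p, of \<xi>] by (simp add: K_def)
    also have "\<dots> = K * (1 - c0 / K)" using K by (simp add: right_diff_distrib)
    also have "\<dots> \<le> K * max (exp (- \<kappa> * (cmod \<xi>)\<^sup>2)) q" using K by (intro mult_left_mono) (auto simp: q_def)
    finally show ?thesis .
  qed
  moreover have "1 / 2 \<le> q" "q < 1" using c0 K by (auto simp: q_def)
  ultimately show ?thesis using that unfolding K_def by blast
qed

text \<open>Where \<open>disc_char\<close> exceeds \<open>q * K\<close> it lies below the Gaussian,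
  whose n-th power does not depend on \<open>n\<close> because \<open>n * s\<^sup>2 = 1\<close>.
  Elsewhere two factors are kept for Plancherel. As \<kappa> rises to its bound, the main term
  decreases to \<open>gauss_limit p\<close>.\<close>

lemma section_ratio_diag_le:
  assumes p: "2 \<le> p" and \<kappa>: "0 < \<kappa>" "\<kappa> < disc_moment p / (4 * disc_const p)"
  obtains q :: real where "0 < q" "q < 1"
    "\<And>n. 2 \<le> n \<Longrightarrow> section_ratio n p (diag_dir n) \<le> disc_const p / (4 * pi * \<kappa>) + n * q ^ (n - 2)"
proof -
  define K where "K = disc_const p"
  have p0: "0 < p" using p by simp
  have K: "0 < K" using disc_const_pos[OF p0] by (simp add: K_def)
  obtain q where q: "1 / 2 \<le> q" "q < 1" "\<And>\<xi>. disc_char p \<xi> \<le> K * max (exp (- \<kappa> * (cmod \<xi>)\<^sup>2)) q"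
    using disc_char_le_max[OF p0 \<kappa>(2)] unfolding K_def by blast
  have "section_ratio n p (diag_dir n) \<le> K / (4 * pi * \<kappa>) + n * q ^ (n - 2)" if n: "2 \<le> n" for n
  proof -
    define s where "s = 1 / sqrt n"
    have s: "0 < s" "s\<^sup>2 = 1 / n" using n by (auto simp: s_def power_divide)
    let ?\<Phi> = "\<lambda>\<xi>. disc_char p (s *\<^sub>R \<xi>)"
    let ?g = "\<lambda>m. gauss_weight (vanish_seq m)"
    let ?P2 = "\<lambda>m. \<integral>\<xi>. ?g m \<xi> * (?\<Phi> \<xi>)\<^sup>2 \<partial>lborel" and ?Pn = "\<lambda>m. \<integral>\<xi>. ?g m \<xi> * ?\<Phi> \<xi> ^ n \<partial>lborel"
    define E where "E \<xi> = exp (- \<kappa> * (cmod \<xi>)\<^sup>2)" for \<xi> :: complex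
    have [measurable]: "E \<in> borel_measurable borel" unfolding E_def by measurable
    have E: "integrable lborel E" "(\<integral>\<xi>. E \<xi> \<partial>lborel) = pi / \<kappa>"
      using nn_integral_gauss_complex[OF \<kappa>(1)] \<kappa>(1) unfolding E_def
      by (auto intro!: integrableI_nonneg integral_eq_nn_integral[THEN trans] simp del: mult_minus_left)
    obtain k where k: "n = Suc (Suc k)" using n by (metis Suc_le_D numeral_2_eq_2 Suc_le_mono)
    have pw: "?\<Phi> \<xi> ^ n \<le> K ^ n * E \<xi> + (q * K) ^ k * (?\<Phi> \<xi>)\<^sup>2" for \<xi>
    proof -
      have tail: "?\<Phi> \<xi> ^ n \<le> (q * K) ^ k * (?\<Phi> \<xi>)\<^sup>2" if "\<bar>?\<Phi> \<xi>\<bar> \<le> q * K"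
      proof -
        have "?\<Phi> \<xi> ^ n \<le> \<bar>?\<Phi> \<xi> ^ n\<bar>" by simp
        also have "\<dots> = \<bar>?\<Phi> \<xi>\<bar> ^ k * (?\<Phi> \<xi>)\<^sup>2" by (simp add: k power_abs power2_eq_square abs_mult)
        also have "\<dots> \<le> (q * K) ^ k * (?\<Phi> \<xi>)\<^sup>2" using that by (intro mult_right_mono power_mono) auto
        finally show ?thesis .
      qed
      have nonneg: "0 \<le> K ^ n * E \<xi>" "0 \<le> (q * K) ^ k * (?\<Phi> \<xi>)\<^sup>2" using K q by (auto simp: E_def)
      show ?thesis
      proof (cases "0 \<le> ?\<Phi> \<xi>")
        case True
        show ?thesis
        proof (cases "?\<Phi> \<xi> \<le> q * K")
          case True
          then show ?thesis using tail nonneg \<open>0 \<le> ?\<Phi> \<xi>\<close> by simp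
        next
          case False
          let ?e = "exp (- \<kappa> * (cmod (s *\<^sub>R \<xi>))\<^sup>2)"
          have "K * q < K * max (?e) q"
            using False q(3)[of "s *\<^sub>R \<xi>"] by (simp add: mult.commute)
          then have "max (?e) q = ?e"
            using K by (auto simp: max_def split: if_splits)
          then have "?\<Phi> \<xi> \<le> K * ?e" using q(3)[of "s *\<^sub>R \<xi>"] by simp
          then have "?\<Phi> \<xi> ^ n \<le> (K * ?e) ^ n" using True by (intro power_mono) auto
          also have "\<dots> = K ^ n * E \<xi>"
            using n s by (simp add: E_def power_mult_distrib exp_of_nat_mult[symmetric])
          finally show ?thesis using nonneg by linarith
        qed
      next
        case False
        have "K / 2 \<le> q * K" using q(1) K mult_right_mono[of "1/2" q K] by simp
        moreover have "- K / 2 \<le> ?\<Phi> \<xi>"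
          unfolding K_def by (rule disc_char_ge_neg_half[OF p0])
        ultimately have "\<bar>?\<Phi> \<xi>\<bar> \<le> q * K" using False by linarith
        then show ?thesis using tail nonneg by simp
      qed
    qed
    have upper: "?Pn m / (2 * pi)\<^sup>2 / K ^ (n - 1) \<le> K / (4 * pi * \<kappa>) + n * q ^ k" for m
    proof -
      have g: "0 < ?g m \<xi>" "?g m \<xi> \<le> 1" for \<xi> by (rule gauss_weight_pos gauss_weight_le)+
      have i2: "integrable lborel (\<lambda>\<xi>. ?g m \<xi> * (?\<Phi> \<xi>)\<^sup>2)" "integrable lborel (\<lambda>\<xi>. ?g m \<xi> * ?\<Phi> \<xi> ^ n)"
        by (rule integrable_weighted_disc_char_power[OF p0 vanish_seq(1)])+
      have "?Pn m \<le> (\<integral>\<xi>. K ^ n * E \<xi> + (q * K) ^ k * (?g m \<xi> * (?\<Phi> \<xi>)\<^sup>2) \<partial>lborel)"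
      proof (rule integral_mono)
        fix \<xi>
        have "?g m \<xi> * ?\<Phi> \<xi> ^ n \<le> ?g m \<xi> * (K ^ n * E \<xi> + (q * K) ^ k * (?\<Phi> \<xi>)\<^sup>2)"
          using g by (intro mult_left_mono pw) (auto simp: less_imp_le)
        also have "\<dots> = ?g m \<xi> * (K ^ n * E \<xi>) + (q * K) ^ k * (?g m \<xi> * (?\<Phi> \<xi>)\<^sup>2)" by (simp add: algebra_simps)
        also have "\<dots> \<le> K ^ n * E \<xi> + (q * K) ^ k * (?g m \<xi> * (?\<Phi> \<xi>)\<^sup>2)"
          using g K by (intro add_right_mono mult_left_le_one_le) (auto simp: E_def less_imp_le)
        finally show "?g m \<xi> * ?\<Phi> \<xi> ^ n \<le> K ^ n * E \<xi> + (q * K) ^ k * (?g m \<xi> * (?\<Phi> \<xi>)\<^sup>2)" .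
      qed (use i2 E in auto)
      also have "\<dots> = K ^ n * (pi / \<kappa>) + (q * K) ^ k * ?P2 m"
        using i2 E by simp
      also have "\<dots> \<le> K ^ n * (pi / \<kappa>) + (q * K) ^ k * ((2 * pi)\<^sup>2 * (K * n))"
      proof -
        have "?P2 m / (2 * pi)\<^sup>2 \<le> K / s\<^sup>2"
          unfolding K_def by (rule disc_char_square_tail[OF p0 vanish_seq(1) s(1)])
        then have "?P2 m \<le> (2 * pi)\<^sup>2 * (K * n)"
          using s(2) by (simp add: divide_le_eq mult.commute)
        then show ?thesis using K q by (intro add_left_mono mult_left_mono) auto
      qed
      finally have "?Pn m / ((2 * pi)\<^sup>2 * K ^ Suc k)
          \<le> (K ^ n * (pi / \<kappa>) + (q * K) ^ k * ((2 * pi)\<^sup>2 * (K * n))) / ((2 * pi)\<^sup>2 * K ^ Suc k)"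
        using K by (intro divide_right_mono) auto
      also have "\<dots> = K / (4 * pi * \<kappa>) + n * q ^ k"
        using K unfolding add_divide_distrib by (simp add: k power_mult_distrib power2_eq_square)
      finally show ?thesis by (simp add: k)
    qed
    have "section_ratio n p (diag_dir n) \<le> K / (4 * pi * \<kappa>) + n * q ^ k"
      using upper by (intro LIMSEQ_le_const2[OF section_ratio_diag_limit[OF n p, folded K_def s_def]]) auto
    then show ?thesis by (simp add: k)
  qed
  moreover have "0 < q" using q(1) by simp
  ultimately show ?thesis using that q(2) unfolding K_def by blast
qed

lemma section_ratio_diag_tendsto:
  assumes p: "2 \<le> p"
  shows "(\<lambda>n. section_ratio n p (diag_dir n)) \<longlonglongrightarrow> gauss_limit p"
proof (rule order_tendstoI)
  define K M L where "K = disc_const p" and "M = disc_moment p" and "L = gauss_limit p"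
  have p0: "0 < p" using p by simp
  have K: "0 < K" and M: "0 < M" using disc_const_pos[OF p0] disc_moment_pos[OF p0] by (auto simp: K_def M_def)
  have L: "L = K\<^sup>2 / (pi * M)" unfolding L_def gauss_limit_eq K_def M_def by simp
  have L0: "0 < L" using K M by (simp add: L)
  have geo: "(\<lambda>n. real n * q ^ (n - 2)) \<longlonglongrightarrow> 0" if "0 < q" "q < 1" for q :: real
  proof (rule LIMSEQ_offset[of _ 2])
    have "(\<lambda>n. real n * q ^ n + 2 * q ^ n) \<longlonglongrightarrow> 0 + 2 * 0"
      using that by (intro tendsto_intros powser_times_n_limit_0 LIMSEQ_power_zero) auto
    then show "(\<lambda>n. real (n + 2) * q ^ (n + 2 - 2)) \<longlonglongrightarrow> 0" by (simp add: algebra_simps)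
  qed
  fix y :: real
  {
    assume y: "y < gauss_limit p"
    have "(\<lambda>n. real n / (real n + 1)) \<longlonglongrightarrow> 1"
      using LIMSEQ_n_over_Suc_n[where 'a=real] by (simp add: add.commute)
    then have "(\<lambda>n. L * (real n / (real n + 1)) - real n * (1 / 2) ^ (n - 2)) \<longlonglongrightarrow> L * 1 - 0"
      by (intro tendsto_diff tendsto_mult tendsto_const geo) auto
    then have "\<forall>\<^sub>F n in sequentially. y < L * (real n / (real n + 1)) - real n * (1 / 2) ^ (n - 2)"
      using y by (intro order_tendstoD(1)) (auto simp: L_def)
    then show "\<forall>\<^sub>F n in sequentially. y < section_ratio n p (diag_dir n)"
      using eventually_ge_at_top[of 2]
    proof eventually_elim
      case (elim n)
      with section_ratio_diag_ge[OF elim(2) p] show ?case by (simp add: L_def add.commute)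
    qed
  }
  {
    assume y: "gauss_limit p < y"
    \<comment> \<open>Chosen so that the main term \<open>K / (4 * pi * \<kappa>)\<close> is the
      midpoint of \<open>L\<close> and \<open>y\<close>; \<open>L < y\<close> is then exactly what
      places \<kappa> below the curvature.\<close>
    define \<kappa> where "\<kappa> = K / (2 * pi * (L + y))"
    have Ly: "2 * L < L + y" using y by (simp add: L_def)
    have \<kappa>: "0 < \<kappa>" using K Ly L0 by (simp add: \<kappa>_def)
    have "\<kappa> < K / (2 * pi * (2 * L))"
      unfolding \<kappa>_def using K Ly L0 by (intro divide_strict_left_mono mult_strict_left_mono) auto
    also have "\<dots> = M / (4 * K)" using K M by (simp add: L power2_eq_square)
    finally obtain q :: real where q: "0 < q" "q < 1"
      "\<And>n. 2 \<le> n \<Longrightarrow> section_ratio n p (diag_dir n) \<le> K / (4 * pi * \<kappa>) + n * q ^ (n - 2)"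
      using section_ratio_diag_le[OF p \<kappa>] unfolding K_def M_def by blast
    have k2: "K / (4 * pi * \<kappa>) = (L + y) / 2" using K Ly L0 by (simp add: \<kappa>_def)
    have "(\<lambda>n. K / (4 * pi * \<kappa>) + real n * q ^ (n - 2)) \<longlonglongrightarrow> (L + y) / 2 + 0"
      unfolding k2 by (intro tendsto_intros geo q)
    then have "\<forall>\<^sub>F n in sequentially. K / (4 * pi * \<kappa>) + real n * q ^ (n - 2) < y"
      by (rule order_tendstoD(2)) (use y in \<open>simp add: L_def\<close>)
    then show "\<forall>\<^sub>F n in sequentially. section_ratio n p (diag_dir n) < y"
      using eventually_ge_at_top[of 2]
    proof eventually_elim
      case (elim n)
      with q(3)[OF elim(2)] show ?case by linarith
    qed
  }
qed

subsection \<open>Gamma function estimates\<close>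

lemma Polygamma_1_1: "Polygamma 1 (1 :: real) = pi\<^sup>2 / 6"
proof -
  have "(\<lambda>k. inverse ((1 + of_nat k) ^ Suc 1)) sums ((-1) ^ Suc 1 * Polygamma 1 (1 :: real) / fact 1)"
    by (rule Polygamma_LIMSEQ) auto
  then have "(\<lambda>k. 1 / (real k + 1)\<^sup>2) sums Polygamma 1 (1 :: real)"
    by (simp add: inverse_eq_divide add.commute power2_eq_square)
  moreover have "(\<lambda>k. 1 / (real k + 1)\<^sup>2) sums (pi\<^sup>2 / 6)"
    using inverse_squares_sums by (simp add: add.commute)
  ultimately show ?thesis by (rule sums_unique2)
qed

lemma ln_Gamma_affine_derivative:
  assumes "0 < a + b * x"
  shows "((\<lambda>x. ln_Gamma (a + b * x)) has_real_derivative b * Digamma (a + b * x)) (at x)"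
proof -
  have "((\<lambda>x. a + b * x) has_real_derivative b) (at x)" by (auto intro!: derivative_eq_intros)
  from DERIV_chain2[OF has_field_derivative_ln_Gamma_real[OF assms] this]
  show ?thesis by (simp add: mult.commute)
qed

text \<open>The logarithm of the right side has derivative 2 (\<open>Digamma (1 + y)\<close> -
  \<open>Digamma (1 + 2 * y)\<close>). As the trigamma function decreases, this is at least - 2 y
  times its value pi^2 / 6 at 1, which 33 / 20 rounds up.\<close>

lemma Gamma_sq_over_Gamma_ge:
  fixes x :: real
  assumes x: "0 < x"
  shows "exp (- (33 / 20) * x\<^sup>2) \<le> (Gamma (1 + x))\<^sup>2 / Gamma (1 + 2 * x)"
proof -
  define F where "F x = 2 * ln_Gamma (1 + 1 * x) - ln_Gamma (1 + 2 * x) + 33 / 20 * x\<^sup>2" for x :: real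
  have "F 0 \<le> F x"
  proof (rule DERIV_nonneg_imp_nondecreasing[of 0 x])
    fix y assume y: "0 \<le> y" "y \<le> x"
    define D where "D = 2 * Digamma (1 + y) - 2 * Digamma (1 + 2 * y) + 33 / 10 * y"
    have "(F has_real_derivative D) (at y)"
      unfolding F_def[abs_def] D_def using y
      by (auto intro!: derivative_eq_intros ln_Gamma_affine_derivative)
    moreover have "0 \<le> D"
    proof (cases "y = 0")
      case False
      with y have y0: "0 < y" by simp
      have "\<exists>c. 1 + y < c \<and> c < 1 + 2 * y \<and> Digamma (1 + 2 * y) - Digamma (1 + y) = (1 + 2 * y - (1 + y)) * Polygamma (Suc 0) c"
        using y0 by (intro MVT2 has_field_derivative_Polygamma) (auto elim!: nonpos_Ints_cases)
      then obtain c where c: "1 + y < c" "Digamma (1 + 2 * y) - Digamma (1 + y) = y * Polygamma (Suc 0) c" by auto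
      have "Polygamma (Suc 0) c < Polygamma (Suc 0) 1"
        using c(1) y0 by (intro Polygamma_real_strict_antimono) auto
      also have "\<dots> \<le> 33 / 20"
      proof -
        have "pi\<^sup>2 \<le> (3.1415926535899)\<^sup>2" using pi_approx by (intro power_mono) auto
        then show ?thesis using Polygamma_1_1 by (simp add: power2_eq_square)
      qed
      finally have "y * Polygamma (Suc 0) c \<le> y * (33 / 20)" using y0 by (intro mult_left_mono) auto
      then show ?thesis using c(2) by (simp add: D_def)
    qed (simp add: D_def)
    ultimately show "\<exists>D. (F has_real_derivative D) (at y) \<and> 0 \<le> D" by blast
  qed (use x in auto)
  then have "- (33 / 20) * x\<^sup>2 \<le> 2 * ln_Gamma (1 + x) - ln_Gamma (1 + 2 * x)"
    by (simp add: F_def ln_Gamma_real_pos[of 1])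
  then have "exp (- (33 / 20) * x\<^sup>2) \<le> exp (2 * ln_Gamma (1 + x) - ln_Gamma (1 + 2 * x))" by simp
  also have "\<dots> = (Gamma (1 + x))\<^sup>2 / Gamma (1 + 2 * x)"
    using x by (simp add: exp_diff Gamma_real_pos_exp exp_double)
  finally show ?thesis .
qed

text \<open>The form the Gamma inequality takes after duplication. \<open>D\<close> is the
  derivative of \<open>H\<close> and decreases strictly since the trigamma function does; the end
  values agree because Gamma(3 / 2) is half of Gamma(1 / 2), which the term \<open>x * ln 2\<close>
  compensates.\<close>

lemma Gamma_ratio_half_gt:
  fixes x :: real
  assumes x: "0 < x" "x < 1"
  shows "2 powr x / sqrt pi < Gamma (1 + x) / Gamma (1 / 2 + x)"
proof -
  define H where "H x = ln_Gamma (1 + 1 * x) - ln_Gamma (1 / 2 + 1 * x) - x * ln 2" for x :: real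
  define D where "D x = Digamma (1 + x) - Digamma (1 / 2 + x) - ln 2" for x :: real
  have H': "(H has_real_derivative D y) (at y)" if "0 \<le> y" for y
    unfolding H_def[abs_def] D_def using that
    by (auto intro!: derivative_eq_intros ln_Gamma_affine_derivative)
  have D_decr: "D z < D y" if "0 \<le> y" "y < z" for y z
  proof -
    have neg: "\<exists>D'. (D has_real_derivative D') (at w) \<and> D' < 0" if "y \<le> w" for w
    proof -
      have w: "0 \<le> w" using that \<open>0 \<le> y\<close> by simp
      have pg: "((\<lambda>x. Digamma (a + x)) has_real_derivative Polygamma 1 (a + w)) (at w)" if "0 < a" for a :: real
      proof -
        have "((\<lambda>x. a + x) has_real_derivative 1) (at w)" by (auto intro!: derivative_eq_intros)
        moreover have "a + w \<notin> \<int>\<^sub>\<le>\<^sub>0" using that w nonpos_Ints_nonpos[of "a + w"] by auto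
        then have "(Digamma has_real_derivative Polygamma 1 (a + w)) (at (a + w))"
          using has_field_derivative_Polygamma[of "a + w" 0 UNIV] by simp
        ultimately show ?thesis using DERIV_chain2[of Digamma _ "\<lambda>x. a + x" w 1 UNIV] by simp
      qed
      have "((\<lambda>x. Digamma (1 + x) - Digamma (1 / 2 + x) - ln 2) has_real_derivative
          Polygamma 1 (1 + w) - Polygamma 1 (1 / 2 + w) - 0) (at w)"
        by (intro DERIV_diff pg DERIV_const) auto
      then have "(D has_real_derivative (Polygamma 1 (1 + w) - Polygamma 1 (1 / 2 + w))) (at w)"
        unfolding D_def[abs_def] by simp
      moreover have "Polygamma 1 (1 + w) < Polygamma 1 (1 / 2 + w)"
        using w by (intro Polygamma_real_strict_antimono) auto
      ultimately show ?thesis by (intro exI conjI) auto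
    qed
    show ?thesis by (rule DERIV_neg_imp_decreasing[OF that(2)]) (rule neg)
  qed
  have half: "ln_Gamma (1 / 2 :: real) = ln (sqrt pi)"
    by (simp add: ln_Gamma_real_pos Gamma_one_half_real)
  have g32: "Gamma (3 / 2 :: real) = sqrt pi / 2"
  proof -
    have "(1 / 2 :: real) \<notin> \<int>\<^sub>\<le>\<^sub>0" using nonpos_Ints_nonpos[of "1 / 2 :: real"] by auto
    from Gamma_plus1[OF this] show ?thesis by (simp add: Gamma_one_half_real)
  qed
  have l32: "ln_Gamma (3 / 2 :: real) = ln (sqrt pi / 2)"
    by (simp add: ln_Gamma_real_pos g32)
  have l2: "ln_Gamma (2 :: real) = 0"
    by (simp add: ln_Gamma_real_pos Gamma_numeral)
  have H0: "H 0 = - ln (sqrt pi)" by (simp add: H_def half ln_Gamma_real_pos[of 1])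
  have H1: "H 1 = - ln (sqrt pi)" by (simp add: H_def l32 l2 ln_div)
  \<comment> \<open>A value not above the common end value would force \<open>D c \<le> 0\<close> at
    some point left of \<open>x\<close> and \<open>0 \<le> D d\<close> at some point right of it,
    against the strict decrease of \<open>D\<close>.\<close>
  have "- ln (sqrt pi) < H x"
  proof (rule ccontr)
    assume "\<not> - ln (sqrt pi) < H x"
    then have le: "H x \<le> - ln (sqrt pi)" by simp
    have "\<exists>c. 0 < c \<and> c < x \<and> H x - H 0 = (x - 0) * D c" using x by (intro MVT2 H') auto
    then obtain c where c: "0 < c" "c < x" "H x - H 0 = x * D c" by auto
    have "\<exists>d. x < d \<and> d < 1 \<and> H 1 - H x = (1 - x) * D d" using x by (intro MVT2 H') auto
    then obtain d where d: "x < d" "d < 1" "H 1 - H x = (1 - x) * D d" by auto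
    have "x * D c \<le> 0" using c le H0 by simp
    then have "D c \<le> 0" using x by (simp add: mult_le_0_iff)
    moreover have "0 \<le> (1 - x) * D d" using d le H1 by simp
    then have "0 \<le> D d" using x by (simp add: zero_le_mult_iff)
    ultimately show False using D_decr[of c d] c d by linarith
  qed
  then have "exp (x * ln 2 - ln (sqrt pi)) < exp (ln_Gamma (1 + x) - ln_Gamma (1 / 2 + x))"
    by (simp add: H_def)
  then show ?thesis using x by (simp add: exp_diff Gamma_real_pos_exp powr_def)
qed

lemma Gamma_legendre_duplication_real:
  fixes x :: real
  assumes "0 < x"
  shows "Gamma x * Gamma (x + 1 / 2) = exp ((1 - 2 * x) * ln 2) * sqrt pi * Gamma (2 * x)"
proof -
  have np: "complex_of_real y \<notin> \<int>\<^sub>\<le>\<^sub>0" if "0 < y" for y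
    using that by (auto simp: of_real_in_nonpos_Ints_iff)
  have "complex_of_real (Gamma x * Gamma (x + 1 / 2)) = Gamma (complex_of_real x) * Gamma (complex_of_real x + 1 / 2)"
    by (simp add: Gamma_complex_of_real[symmetric])
  also have "\<dots> = exp ((1 - 2 * complex_of_real x) * of_real (ln 2)) * of_real (sqrt pi) * Gamma (2 * complex_of_real x)"
    using np[of x] np[of "x + 1 / 2"] assms by (intro Gamma_legendre_duplication) auto
  also have "\<dots> = complex_of_real (exp ((1 - 2 * x) * ln 2) * sqrt pi * Gamma (2 * x))"
    by (simp add: Gamma_complex_of_real[symmetric] exp_of_real[symmetric])
  finally show ?thesis by (simp only: of_real_eq_iff)
qed

lemma Gamma_sq_over_Gamma_gt:
  fixes x :: real
  assumes x: "0 < x" "x < 1"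
  shows "2 powr (- x) < (Gamma (1 + x))\<^sup>2 / Gamma (1 + 2 * x)"
proof -
  have "Gamma (1 / 2 + x) * Gamma (1 + x) = 2 powr (- (2 * x)) * sqrt pi * Gamma (1 + 2 * x)"
    using Gamma_legendre_duplication_real[of "1 / 2 + x"] x by (simp add: powr_def algebra_simps)
  then have dup: "Gamma (1 + 2 * x) = Gamma (1 / 2 + x) * Gamma (1 + x) * 2 powr (2 * x) / sqrt pi"
    by (simp add: powr_minus field_simps)
  have g: "0 < Gamma (1 + x)" "0 < Gamma (1 / 2 + x)" using x by (auto intro!: Gamma_real_pos)
  have "(Gamma (1 + x))\<^sup>2 / Gamma (1 + 2 * x) = Gamma (1 + x) / Gamma (1 / 2 + x) * (sqrt pi / 2 powr (2 * x))"
    using g unfolding dup by (simp add: power2_eq_square)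
  also have "\<dots> > 2 powr x / sqrt pi * (sqrt pi / 2 powr (2 * x))"
    using Gamma_ratio_half_gt[OF x] by (intro mult_strict_right_mono) auto
  also have "2 powr x / sqrt pi * (sqrt pi / 2 powr (2 * x)) = 2 powr x / 2 powr (2 * x)" by simp
  also have "\<dots> = 2 powr (- x)" by (simp add: powr_diff[symmetric])
  finally show ?thesis .
qed

section \<open>Elementary inequalities for the explicit ranges\<close>

text \<open>With \<open>y = x * ln 2\<close>, the upper bound 1 - y + y^2 / 2 for exp(- y) follows
  from the lower one for exp y, as their product is 1 + y^4 / 4. Then ln 2 lies between 2 / 3 and 25
  / 36, and the square of 25 / 36 is below 1 / 2.\<close>

lemma two_powr_minus_le:
  fixes x :: real
  assumes x: "0 \<le> x"
  shows "2 powr (- x) \<le> 1 - 2 / 3 * x + x\<^sup>2 / 4"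
proof -
  define y where "y = x * ln 2"
  have y: "2 / 3 * x \<le> y" "0 \<le> y" "y \<le> 25 / 36 * x"
    using mult_left_mono[OF ln2_ge_two_thirds x] mult_left_mono[OF ln2_le_25_over_36 x] x by (auto simp: y_def)
  have "0 < 1 + y + y\<^sup>2 / 2" using y(2) by (simp add: add_pos_nonneg)
  have "exp (- y) \<le> 1 / (1 + y + y\<^sup>2 / 2)"
    using exp_lower_Taylor_quadratic[OF y(2)] \<open>0 < 1 + y + y\<^sup>2 / 2\<close>
    by (simp add: exp_minus inverse_eq_divide divide_left_mono)
  also have "\<dots> \<le> 1 - y + y\<^sup>2 / 2"
  proof -
    have "(1 - y + y\<^sup>2 / 2) * (1 + y + y\<^sup>2 / 2) = 1 + (y\<^sup>2 / 2)\<^sup>2" by (simp add: power2_eq_square algebra_simps)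
    then show ?thesis using \<open>0 < 1 + y + y\<^sup>2 / 2\<close> by (simp add: divide_le_eq)
  qed
  also have "\<dots> \<le> 1 - 2 / 3 * x + x\<^sup>2 / 4"
  proof -
    have "y\<^sup>2 \<le> (25 / 36 * x)\<^sup>2" using y by (intro power_mono) auto
    also have "\<dots> \<le> x\<^sup>2 / 2" by (simp add: power_mult_distrib power2_eq_square)
    finally show ?thesis using y by simp
  qed
  finally show ?thesis by (simp add: powr_def y_def)
qed

lemma exp_minus_sq_ge: "1 - 33 / 20 * x\<^sup>2 \<le> exp (- (33 / 20) * x\<^sup>2)" for x :: real
  using exp_ge_add_one_self[of "- (33 / 20) * x\<^sup>2"] by simp

text \<open>Here \<open>x = 2 / p\<close> with \<open>p \<ge> 9\<close>, the factor
  \<open>1 + x / 5\<close> stands for \<open>1 + 1 / n\<close>, and \<open>x / 500\<close> is room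
  for the error term. The linear coefficient - 697 / 1500 outweighs the higher terms, which total
  less than 2 x / 5 on this range.\<close>

lemma linear_bound_case_small:
  fixes x :: real
  assumes x: "0 < x" "x \<le> 2 / 9"
  shows "(2 powr (- x) + x / 500) * (1 + x / 5) < exp (- (33 / 20) * x\<^sup>2)"
proof -
  have "(2 powr (- x) + x / 500) * (1 + x / 5) \<le> (1 - 2 / 3 * x + x\<^sup>2 / 4 + x / 500) * (1 + x / 5)"
    using two_powr_minus_le[of x] x by (intro mult_right_mono) auto
  also have "\<dots> < 1 - 33 / 20 * x\<^sup>2"
  proof -
    have eq: "(1 - 2 / 3 * x + x\<^sup>2 / 4 + x / 500) * (1 + x / 5)
        = 1 - 697 / 1500 * x + 878 / 7500 * x\<^sup>2 + x ^ 3 / 20"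
      by (simp add: power2_eq_square power3_eq_cube field_simps)
    have "x\<^sup>2 \<le> x * (2 / 9)" using x unfolding power2_eq_square by (intro mult_left_mono) auto
    moreover have "x ^ 3 \<le> x * (2 / 9 * (2 / 9))"
      using x unfolding power3_eq_cube mult.assoc by (intro mult_left_mono mult_mono) auto
    ultimately show ?thesis unfolding eq using x by linarith
  qed
  also have "\<dots> \<le> exp (- (33 / 20) * x\<^sup>2)" by (rule exp_minus_sq_ge)
  finally show ?thesis .
qed

text \<open>The same comparison for \<open>p \<ge> 140\<close>. The larger factor
  \<open>1 + x / 2\<close> shrinks the linear coefficient to - 247 / 1500, still far beyond the
  quadratic loss of at most (33 / 20) (x / 70).\<close>

lemma linear_bound_case_tiny:
  fixes x :: real
  assumes x: "0 < x" "x \<le> 1 / 70"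
  shows "(2 powr (- x) + x / 500) * (1 + x / 2) < exp (- (33 / 20) * x\<^sup>2)"
proof -
  have "(2 powr (- x) + x / 500) * (1 + x / 2) \<le> (1 - 2 / 3 * x + x\<^sup>2 / 4 + x / 500) * (1 + x / 2)"
    using two_powr_minus_le[of x] x by (intro mult_right_mono) auto
  also have "\<dots> < 1 - 33 / 20 * x\<^sup>2"
  proof -
    have eq: "(1 - 2 / 3 * x + x\<^sup>2 / 4 + x / 500) * (1 + x / 2)
        = 1 - 247 / 1500 * x - 247 / 3000 * x\<^sup>2 + x ^ 3 / 8"
      by (simp add: power2_eq_square power3_eq_cube field_simps)
    have "x\<^sup>2 \<le> x * (1 / 70)" using x unfolding power2_eq_square by (intro mult_left_mono) auto
    moreover have "x ^ 3 \<le> x * (1 / 70 * (1 / 70))"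
      using x unfolding power3_eq_cube mult.assoc by (intro mult_left_mono mult_mono) auto
    moreover have "0 \<le> x\<^sup>2" by simp
    ultimately show ?thesis unfolding eq using x by linarith
  qed
  also have "\<dots> \<le> exp (- (33 / 20) * x\<^sup>2)" by (rule exp_minus_sq_ge)
  finally show ?thesis .
qed

text \<open>The least integer not below 9 times 5 / 2 is 23. The induction step only needs that
  \<open>n\<^sup>2\<close> less than doubles when \<open>n\<close> grows by one.\<close>

lemma square_times_half_power_le:
  assumes "23 \<le> n"
  shows "(real n)\<^sup>2 * (1 / 2) ^ (n - 1) \<le> 1 / 1000"
  using assms
proof (induction n rule: dec_induct)
  case (step n)
  have "(real n + 1)\<^sup>2 \<le> 2 * (real n)\<^sup>2"
  proof -
    have "3 * real n \<le> real n * real n" using step(1) by (intro mult_right_mono) auto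
    moreover have "1 \<le> real n" using step(1) by simp
    moreover have "(real n + 1)\<^sup>2 = real n * real n + 2 * real n + 1" by (simp add: power2_eq_square algebra_simps)
    ultimately show ?thesis unfolding power2_eq_square[of "real n"] by linarith
  qed
  then have "(real (Suc n))\<^sup>2 * (1 / 2) ^ (Suc n - 1) \<le> 2 * (real n)\<^sup>2 * (1 / 2) ^ (Suc n - 1)"
    by (intro mult_right_mono) (auto simp: add.commute)
  also have "\<dots> = (real n)\<^sup>2 * (1 / 2) ^ (n - 1)"
    using step(1) by (cases n) auto
  finally show ?case using step(3) by simp
qed (simp add: power_one_over)

lemma gauss_limit_gt:
  assumes "2 < p" shows "2 powr (1 - 2 / p) < gauss_limit p"
proof -
  have "2 powr (- (2 / p)) < (Gamma (1 + 2 / p))\<^sup>2 / Gamma (1 + 2 * (2 / p))"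
    using assms by (intro Gamma_sq_over_Gamma_gt) auto
  moreover have "2 powr (1 - 2 / p) = 2 * 2 powr (- (2 / p))" by (simp add: powr_diff powr_minus divide_inverse)
  ultimately show ?thesis by (simp add: gauss_limit_def)
qed

text \<open>Serves both explicit ranges: \<open>t\<close> is the slope in
  \<open>1 / n \<le> x * t\<close> for \<open>x = 2 / p\<close>, hence 1 / 5 or 1 / 2. The error n /
  2^(n - 1) is written as n^2 / 2^(n - 1) times 1 / n, so it becomes linear in \<open>x\<close> and
  fits into the term \<open>x / 500\<close> of \<open>num\<close>.\<close>

lemma section_ratio_diag_gt:
  assumes p: "2 < p" and n: "23 \<le> n" and t: "t \<le> 1 / 2" "1 / n \<le> 2 / p * t"
    and num: "(2 powr (- (2 / p)) + 2 / p / 500) * (1 + 2 / p * t) < exp (- (33 / 20) * (2 / p)\<^sup>2)"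
  shows "2 powr (1 - 2 / p) < section_ratio n p (diag_dir n)"
proof -
  define x where "x = 2 / p"
  define R where "R = (Gamma (1 + x))\<^sup>2 / Gamma (1 + 2 * x)"
  have x: "0 < x" using p by (simp add: x_def)
  have lim: "gauss_limit p = 2 * R" by (simp add: gauss_limit_def R_def x_def)
  have n0: "0 < real n" using n by simp
  have nx: "1 / n \<le> x * t" using t(2) by (simp add: x_def)
  have "x * t \<le> x * (1 / 2)" using x t(1) by (intro mult_left_mono) auto
  with nx have nx2: "1 / n \<le> x / 2" by simp
  have tail: "n * (1 / 2) ^ (n - 1) \<le> x / 500"
  proof -
    have "n * (1 / 2) ^ (n - 1) = (real n)\<^sup>2 * (1 / 2) ^ (n - 1) * (1 / n)"
      using n0 by (simp add: power2_eq_square)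
    also have "\<dots> \<le> 1 / 1000 * (x / 2)"
      using square_times_half_power_le[OF n] nx2 x by (intro mult_mono) auto
    also have "\<dots> \<le> x / 500" using x by simp
    finally show ?thesis .
  qed
  have "(2 powr (- x) + x / 500) * (1 + 1 / n) \<le> (2 powr (- x) + x / 500) * (1 + x * t)"
    using nx x by (intro mult_left_mono) auto
  also have "\<dots> < exp (- (33 / 20) * x\<^sup>2)" using num by (simp add: x_def)
  also have "\<dots> \<le> R" unfolding R_def by (rule Gamma_sq_over_Gamma_ge[OF x])
  finally have "2 powr (- x) + x / 500 < R * (n / (n + 1))"
    using n0 by (simp add: field_simps)
  with tail have "2 * 2 powr (- x) < 2 * R * (n / (n + 1)) - n * (2 * (1 / 2) ^ (n - 1))" by (simp add: algebra_simps)
  also have "2 * (1 / 2) ^ (n - 1) = (1 / 2 :: real) ^ (n - 2)"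
    using n by (simp add: power_diff power_one_over eval_nat_numeral)
  also have "2 * R * (n / (n + 1)) - n * (1 / 2) ^ (n - 2) \<le> section_ratio n p (diag_dir n)"
    using section_ratio_diag_ge[of n p] n p by (simp add: lim add.commute)
  also have "2 * 2 powr (- x) = 2 powr (1 - 2 / p)" by (simp add: x_def powr_diff powr_minus divide_inverse)
  finally show ?thesis .
qed

theorem theorem1p1:
  fixes p :: real
  assumes "2 < p"
  shows "(\<exists>N::real. N > 0 \<and>
            (\<forall>n::nat. real n \<ge> N \<longrightarrow>
               section_ratio n p (diag_dir n) > section_ratio n p (two_dir n)))
       \<and> (p \<ge> 9 \<longrightarrow>
            (\<forall>n::nat. real n \<ge> 5 / 2 * p \<longrightarrow>
               section_ratio n p (diag_dir n) > section_ratio n p (two_dir n)))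
       \<and> (p \<ge> 140 \<longrightarrow>
            (\<forall>n::nat. real n \<ge> p \<longrightarrow>
               section_ratio n p (diag_dir n) > section_ratio n p (two_dir n)))
       \<and> (\<lambda>n. section_ratio n p (diag_dir n))
            \<longlonglongrightarrow> 2 * (Gamma (1 + 2 / p))\<^sup>2 / Gamma (1 + 4 / p)
       \<and> (\<forall>n::nat. n \<ge> 2 \<longrightarrow>
            2 * (Gamma (1 + 2 / p))\<^sup>2 / Gamma (1 + 4 / p) > section_ratio n p (two_dir n)
            \<and> section_ratio n p (two_dir n) = 2 powr (1 - 2 / p))"
proof -
  have two: "section_ratio n p (two_dir n) = 2 powr (1 - 2 / p)" if "2 \<le> n" for n
    using section_ratio_two_dir[OF that, of p] assms by simp
  have lim: "(\<lambda>n. section_ratio n p (diag_dir n)) \<longlonglongrightarrow> gauss_limit p"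
    using section_ratio_diag_tendsto[of p] assms by simp
  have "\<forall>\<^sub>F n in sequentially. 2 powr (1 - 2 / p) < section_ratio n p (diag_dir n)"
    using order_tendstoD(1)[OF lim gauss_limit_gt[OF assms]] .
  then obtain n0 where n0: "\<And>n. n0 \<le> n \<Longrightarrow> 2 powr (1 - 2 / p) < section_ratio n p (diag_dir n)"
    by (auto simp: eventually_sequentially)
  have "\<exists>N::real. N > 0 \<and> (\<forall>n::nat. real n \<ge> N \<longrightarrow> section_ratio n p (diag_dir n) > section_ratio n p (two_dir n))"
  \<comment> \<open>The summand 2 makes the threshold positive and forces \<open>n \<ge> 2\<close>,
    where the value for \<open>two_dir\<close> is known.\<close>
  proof (intro exI[of _ "real (n0 + 2)"] conjI allI impI)
    fix n :: nat assume "real (n0 + 2) \<le> real n"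
    then have "n0 + 2 \<le> n" by (simp only: of_nat_le_iff)
    then show "section_ratio n p (two_dir n) < section_ratio n p (diag_dir n)" using n0[of n] two[of n] by simp
  qed simp
  moreover have "section_ratio n p (diag_dir n) > section_ratio n p (two_dir n)"
    if p: "9 \<le> p" and n: "5 / 2 * p \<le> real n" for n
  proof -
    have n23: "23 \<le> n" using p n by linarith
    have "2 powr (1 - 2 / p) < section_ratio n p (diag_dir n)"
    proof (rule section_ratio_diag_gt[OF assms n23, where t="1 / 5"])
      show "1 / real n \<le> 2 / p * (1 / 5)" using p n by (simp add: field_simps)
      show "(2 powr (- (2 / p)) + 2 / p / 500) * (1 + 2 / p * (1 / 5)) < exp (- (33 / 20) * (2 / p)\<^sup>2)"
        using linear_bound_case_small[of "2 / p"] p by (simp add: field_simps)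
    qed simp
    then show ?thesis using two[of n] n23 by simp
  qed
  moreover have "section_ratio n p (diag_dir n) > section_ratio n p (two_dir n)"
    if p: "140 \<le> p" and n: "p \<le> real n" for n
  proof -
    have n23: "23 \<le> n" using p n by linarith
    have "2 powr (1 - 2 / p) < section_ratio n p (diag_dir n)"
    proof (rule section_ratio_diag_gt[OF assms n23, where t="1 / 2"])
      show "1 / real n \<le> 2 / p * (1 / 2)" using p n by (simp add: field_simps)
      show "(2 powr (- (2 / p)) + 2 / p / 500) * (1 + 2 / p * (1 / 2)) < exp (- (33 / 20) * (2 / p)\<^sup>2)"
        using linear_bound_case_tiny[of "2 / p"] p by (simp add: field_simps)
    qed simp
    then show ?thesis using two[of n] n23 by simp
  qed
  ultimately show ?thesis
    using lim gauss_limit_gt[OF assms] two by (simp add: gauss_limit_def)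
qed

end
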